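(* Let $0<\varepsilon<\omega_1$ and $2\le\iota<\omega$. Let $S=(\omega,\bar r,\bar\jmath,\bar k)$ be a cute $\mathcal{YZR}(\varepsilon)$-system, and let $\bar T^{\varepsilon,\iota}=\langle T_m^{\varepsilon,\iota}:m<\omega\rangle$ be a sequence of trees $T_m^{\varepsilon,\iota}\subseteq{}^{\omega>}2$ without maximal nodes and $\bar c=\langle c_m:m<\omega\rangle\subseteq\omega$ be such that $\bar T^{\varepsilon,\iota}$ has the $(\bar c,S)$-controlled amalgamation property and $\varepsilon\le\mathrm{ndrk}_\iota(\bar T^{\varepsilon,\iota})\le\omega\cdot(\varepsilon+2)+2$ (ordinal multiplication). Let $B_{\varepsilon,\iota}=\bigcup_{m<\omega}\lim(T_m^{\varepsilon,\iota})$. Assume Martin's Axiom (MA) and $\aleph_\varepsilon<\mathfrak c$. Then (i) there is a sequence $\langle\rho_\alpha:\alpha<\aleph_\varepsilon\rangle$ of distinct elements of ${}^{\omega}2$ such that for $\alpha,\beta<\aleph_\varepsilon$ \[\big|(\rho_\alpha+B_{\varepsilon,\iota})\cap(\rho_\beta+B_{\varepsilon,\iota})\big|\ge2\iota,\] (ii) for every perfect set $P\subseteq{}^{\omega}2$ there are $\eta,\nu\in P$ such that \[\big|(\eta+B_{\varepsilon,\iota})\cap(\nu+B_{\varepsilon,\iota})\big|<2\iota.\]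
   Context: **Basic notation.** $\mathfrak c=2^{\aleph_0}$. Every ordinal (in particular every natural number) is identified with the set of smaller ordinals; for a set $w$ of ordinals and an ordinal $b$, $w\cap b=\{a\in w:a<b\}$. $[X]^{<\omega}$ is the family of finite subsets of $X$. For a set $u$, $u^{\langle2\rangle}=\{(x,y)\in u\times u:x\ne y\}$. ${}^n2$ is the set of 0-1 sequences of length $n$, ${}^{\omega>}2=\bigcup_{n<\omega}{}^n2$, ${}^{\omega}2$ is the Cantor space; $+$ on ${}^n2$ and on ${}^{\omega}2$ is coordinatewise addition mod 2. $\nu\vartriangleleft\eta$ means that $\nu$ is a proper initial segment of $\eta$; $\nu\trianglelefteq\eta$ means $\nu\vartriangleleft\eta$ or $\nu=\eta$. A tree is a $\vartriangleleft$-downward closed set of sequences; $\lim(T)$ is the set of $\omega$-branches through $T\subseteq{}^{\omega>}2$. A perfect set is a nonempty closed set with no isolated points. **$\mathcal{YZR}$-systems.** Let $0<\varepsilon<\omega_1$. A $\mathcal{YZR}(\varepsilon)$-system is a tuple $s=(X^s,\bar r^s,\bar\jmath^s,\bar k^s)=(X,\bar r,\bar\jmath,\bar k)$ such that: $( * )_1$ $X$ is a nonempty set of ordinals; $( * )_2$ $\bar r:[X]^{<\omega}\setminus\{\emptyset\}\to\varepsilon+1$, $\bar\jmath,\bar k:[X]^{<\omega}\setminus\{\emptyset\}\to\omega$; $( * )_3$ if $\emptyset\ne u\subseteq w\in[X]^{<\omega}$ then $\bar r(u)\ge\bar r(w)$; $( * )_4$ $\bar r(\{a\})>0$ for all $a\in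 X$; $( * )_5$ if $\emptyset\neq w\in[X]^{<\omega}$ and $w=\{a_0,\dots,a_{n-1}\}$ is the increasing enumeration, then $\bar k(w)<n$ and there is no $b\in X\setminus w$ such that $|w\cap b|=\bar k(w)$ and $\bar\jmath((w\setminus\{a_{\bar k(w)}\})\cup\{b\})=\bar\jmath(w)$ and $\bar r(w\cup\{b\})=\bar r(w)$. It is finite if $X^s$ is finite. A quasi-embedding of $q$ in $s$ (both $\mathcal{YZR}(\varepsilon)$-systems) is an increasing injection $\varphi:X^q\to X^s$ such that for all nonempty finite $v\subseteq X^q$: $\bar r^s(\varphi[v])=\bar r^q(v)$, $\bar k^s(\varphi[v])=\bar k^q(v)$, and if $\bar r^q(v)>0$ then $\bar\jmath^s(\varphi[v])=\bar\jmath^q(v)$. If $w\subseteq X^s$, an increasing injection $\varphi:w\to X^s$ is a quasi-embedding (into $s$) if it is a quasi-embedding of the restricted system $s\restriction w$ in $s$. A $\mathcal{YZR}(\varepsilon)$-system $S$ is cute if $X^S=\omega$ and for every finite $\mathcal{YZR}(\varepsilon)$-system $q$ and $M<\omega$ there is a quasi-embedding $\varphi$ of $q$ in $S$ with $\mathrm{rng}(\varphi)\subseteq[M,\omega)$. **The family $\mathbf M_{\bar T,\iota}$.** Let $2\le\iota<\omega$ and let $\bar T=\langle T_n:n<\omega\rangle$ be a sequence of trees $T_n\subseteq{}^{\omega>}2$ with no maximal nodes. $\mathbf M_{\bar T,\iota}$ consists of all tuples $\mathbf m=(\ell_{\mathbf m},u_{\mathbf m},\bar h_{\mathbf m},\bar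 g_{\mathbf m})=(\ell,u,\bar h,\bar g)$ such that: (a) $0<\ell<\omega$, $u\subseteq{}^\ell2$, $|u|\ge2$; (b) $\bar h=\langle h_i:i<\iota\rangle$, $\bar g=\langle g_i:i<\iota\rangle$, $h_i:u^{\langle2\rangle}\to\omega$, $g_i:u^{\langle2\rangle}\to\bigcup_{n<\omega}(T_n\cap{}^\ell2)$; (c) $g_i(\eta,\nu)\in T_{h_i(\eta,\nu)}\cap{}^\ell2$ for all $(\eta,\nu)\in u^{\langle2\rangle}$, $i<\iota$; (d) $\eta+g_i(\eta,\nu)=\nu+g_i(\nu,\eta)$ for $(\eta,\nu)\in u^{\langle2\rangle}$, $i<\iota$; (e) for each $(\eta,\nu)\in u^{\langle2\rangle}$ there are no repetitions in $\langle g_i(\eta,\nu),g_i(\nu,\eta):i<\iota\rangle$; (f) there are $\langle F(\eta):\eta\in u\rangle$ and $\langle G_i(\eta,\nu):i<\iota,(\eta,\nu)\in u^{\langle2\rangle}\rangle$ such that $\eta\vartriangleleft F(\eta)\in{}^{\omega}2$, $g_i(\eta,\nu)\vartriangleleft G_i(\eta,\nu)\in\lim(T_{h_i(\eta,\nu)})$ and $F(\eta)+G_i(\eta,\nu)=F(\nu)+G_i(\nu,\eta)$ for all $i<\iota$, $(\eta,\nu)\in u^{\langle 2\rangle}$. We write $h_i^{\mathbf m},g_i^{\mathbf m}$ for the components. For $\rho\in{}^{\ell_{\mathbf m}}2$, $\mathbf m+\rho=(\ell',u',\bar h',\bar g')$ where $\ell'=\ell_{\mathbf m}$, $u'=\{\eta+\rho:\eta\in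 u_{\mathbf m}\}$, $h'_i(\eta+\rho,\nu+\rho)=h^{\mathbf m}_i(\eta,\nu)$, $g'_i(\eta+\rho,\nu+\rho)=g^{\mathbf m}_i(\eta,\nu)$. For $\mathbf m,\mathbf n\in\mathbf M_{\bar T,\iota}$, $\mathbf n$ essentially extends $\mathbf m$ ($\mathbf m\sqsubseteq^*\mathbf n$) iff $\ell_{\mathbf m}\le\ell_{\mathbf n}$, $u_{\mathbf m}=\{\eta\restriction\ell_{\mathbf m}:\eta\in u_{\mathbf n}\}$ and for every $(\eta,\nu)\in(u_{\mathbf n})^{\langle2\rangle}$ with $\eta'=\eta\restriction\ell_{\mathbf m}\ne\nu'=\nu\restriction\ell_{\mathbf m}$: if $\iota>2$ then $\{\{g_i^{\mathbf m}(\eta',\nu'),g_i^{\mathbf m}(\nu',\eta')\}:i<\iota\}=\{\{g_i^{\mathbf n}(\eta,\nu)\restriction\ell_{\mathbf m},g_i^{\mathbf n}(\nu,\eta)\restriction\ell_{\mathbf m}\}:i<\iota\}$; if $\iota=2$ then $\{g_0^{\mathbf m}(\eta',\nu'),g_0^{\mathbf m}(\nu',\eta'),g_1^{\mathbf m}(\eta',\nu'),g_1^{\mathbf m}(\nu',\eta')\}=\{g_0^{\mathbf n}(\eta,\nu)\restriction\ell_{\mathbf m},g_0^{\mathbf n}(\nu,\eta)\restriction\ell_{\mathbf m},g_1^{\mathbf n}(\eta,\nu)\restriction\ell_{\mathbf m},g_1^{\mathbf n}(\nu,\eta)\restriction\ell_{\mathbf m}\}$; and for $i,j<\iota$: if $g_i^{\mathbf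 m}(\eta',\nu')=g_j^{\mathbf n}(\eta,\nu)\restriction\ell_{\mathbf m}$ then $h_i^{\mathbf m}(\eta',\nu')=h_j^{\mathbf n}(\eta,\nu)$, and if $g_i^{\mathbf m}(\eta',\nu')=g_j^{\mathbf n}(\nu,\eta)\restriction\ell_{\mathbf m}$ then $h_i^{\mathbf m}(\eta',\nu')=h_j^{\mathbf n}(\nu,\eta)$. $\mathbf m,\mathbf n$ are essentially the same ($\mathbf m\doteqdot\mathbf n$) iff $\ell_{\mathbf m}=\ell_{\mathbf n}$, $u_{\mathbf m}=u_{\mathbf n}$ and these same conditions hold for all $(\eta,\nu)\in(u_{\mathbf m})^{\langle2\rangle}$ (with $\eta'=\eta$, $\nu'=\nu$). **Bricks.** Let $S=(\omega,\bar r,\bar\jmath,\bar k)$ be a cute $\mathcal{YZR}(\varepsilon)$-system and $\bar c=\langle c_m:m<\omega\rangle\subseteq\omega$. An $(S,\iota,\bar T,\bar c)$-brick is a tuple $\mathfrak b=(w^{\mathfrak b},n^{\mathfrak b},\bar\eta^{\mathfrak b},\bar h^{\mathfrak b},\bar g^{\mathfrak b},\mathcal M^{\mathfrak b})=(w,n,\bar\eta,\bar h,\bar g,\mathcal M)$ such that: $(\boxplus)_1$ $w\in[\omega]^{<\omega}$, $|w|\ge3$, $0<n<\omega$. $(\boxplus)_2$ $\bar\eta=\langle\eta_a:a\in w\rangle$ is a sequence of linearly independent vectors in ${}^n2$ over $\mathbb Z_2$. $(\boxplus)_3$ $\bar h=\langle h_i:i<\iota\rangle$, $h_i:w^{\langle2\rangle}\to\omega$,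 $c_{h_i(a,b)}\le n$ for all $(a,b)\in w^{\langle2\rangle}$, $i<\iota$; $\bar g=\langle g_i:i<\iota\rangle$, $g_i:w^{\langle2\rangle}\to\bigcup_{m<\omega}(T_m\cap{}^n2)$. $(\boxplus)_4$ Letting $n^*=n$, $u^*=\{\eta_a:a\in w\}$, $h_i^*(\eta_a,\eta_b)=h_i(a,b)$, $g_i^*(\eta_a,\eta_b)=g_i(a,b)$, we have $(n^*,u^*,\bar h^*,\bar g^* )\in\mathbf M_{\bar T,\iota}$. $(\boxplus)_5$ $\mathcal M$ consists of all $\mathbf m\in\mathbf M_{\bar T,\iota}$ such that for some $\ell_*,w_*$: $w_*\subseteq w$, $|w_*|\ge3$, $0<\ell_{\mathbf m}=\ell_*\le n$, and $c_{h_i(a,b)}\le\ell_*$ for all $(a,b)\in(w_* )^{\langle2\rangle}$, $i<\iota$; $u_{\mathbf m}=\{\eta_a\restriction\ell_*:a\in w_*\}$ and $\eta_a\restriction\ell_*\ne\eta_b\restriction\ell_*$ for distinct $a,b\in w_*$; $h_i^{\mathbf m}(\eta_a\restriction\ell_*,\eta_b\restriction\ell_* )=h_i(a,b)$ and $g_i^{\mathbf m}(\eta_a\restriction\ell_*,\eta_b\restriction\ell_* )=g_i(a,b)\restriction\ell_*$ for $(a,b)\in (w_* )^{\langle 2\rangle}$, $i<\iota$. In this situation we write $\mathbf m=\mathbf m(\ell_*,w_* )$. $(\boxplus)_6$ If $\mathbf m(\ell,w_0),\mathbf m(\ell,w_1)\in\mathcal M$, $\rho\in{}^\ell2$ and $\mathbf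 m(\ell,w_0)\doteqdot\mathbf m(\ell,w_1)+\rho$, then the order isomorphism $\pi:w_0\to w_1$ is a quasi-embedding (into $S$) and $(\eta_a\restriction\ell)+\rho=\eta_{\pi(a)}\restriction\ell$ for all $a\in w_0$. $(\boxplus)_7$ If $\mathbf m(\ell_*,w_* )\in\mathcal M$, $a\in w_*$, $|a\cap w_*|=\bar k(w_* )$, $\bar r(w_* )=0$ and $\mathbf m(\ell_*,w_* )\sqsubseteq^*\mathbf n\in\mathcal M$, then $|\{\nu\in u_{\mathbf n}:(\eta_a\restriction\ell_* )\trianglelefteq\nu\}|=1$. For bricks, $\mathfrak b_0\Subset\mathfrak b_1$ iff $w^{\mathfrak b_0}\subseteq w^{\mathfrak b_1}$, $n^{\mathfrak b_0}\le n^{\mathfrak b_1}$, $\eta_a^{\mathfrak b_0}\trianglelefteq\eta_a^{\mathfrak b_1}$ for $a\in w^{\mathfrak b_0}$, and $h_i^{\mathfrak b_1}\restriction(w^{\mathfrak b_0})^{\langle2\rangle}=h_i^{\mathfrak b_0}$, $g_i^{\mathfrak b_0}(a,b)\trianglelefteq g_i^{\mathfrak b_1}(a,b)$ for $i<\iota$, $(a,b)\in(w^{\mathfrak b_0})^{\langle2\rangle}$. For $w^*\subseteq w^{\mathfrak b}$ with $|w^*|\ge3$, $\mathfrak b\restriction w^*$ is the unique brick $\mathfrak b^*$ with $w^{\mathfrak b^*}=w^*$, $n^{\mathfrak b^*}=n^{\mathfrak b}$, $\mathfrak b^*\Subset\mathfrak b$. For a quasi-embedding $\varphi:w^{\mathfrak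 b}\to\omega$ (into $S$), $\varphi(\mathfrak b)$ is the unique brick $\mathfrak b^*$ with $w^{\mathfrak b^*}=\varphi[w^{\mathfrak b}]$, $n^{\mathfrak b^*}=n^{\mathfrak b}$, $\mathcal M^{\mathfrak b^*}=\mathcal M^{\mathfrak b}$, $\eta^{\mathfrak b}_a=\eta^{\mathfrak b^*}_{\varphi(a)}$, $h_i^{\mathfrak b}(a,b)=h_i^{\mathfrak b^*}(\varphi(a),\varphi(b))$, $g_i^{\mathfrak b}(a,b)=g_i^{\mathfrak b^*}(\varphi(a),\varphi(b))$. **Controlled amalgamation.** $\bar T$ has the $(\bar c,S)$-controlled amalgamation property if there is a sequence $\langle\mathfrak b_n:n<\omega\rangle$ of $(S,\iota,\bar T,\bar c)$-bricks such that: (1) $\mathfrak b_n\Subset\mathfrak b_{n+1}$ for each $n$; (2) $\bigcup_nw^{\mathfrak b_n}=\omega$ and $\lim_{n\to\infty}n^{\mathfrak b_n}=\infty$; (3) if (a) $n<\omega$, $u\subseteq w\subseteq w^{\mathfrak b_n}$, $|w|\ge3$, (b) $\bar k(v\cup\{\delta\})\ne|\delta\cap v|$ whenever $v\subseteq u$, $\delta\in w\setminus u$ and $\bar r(v\cup\{\delta\})=0$, and (c) $\pi_0,\pi_1:w\to\omega$ are quasi-embeddings (into $S$) with $\pi_0(a)=\pi_1(a)$ for $a\in u$ and $\pi_0[w\setminus u]\cap\pi_1[w\setminus u]=\emptyset$, then there are $K<\omega$ and a quasi-embedding $\pi:\mathrm{rng}(\pi_0)\cup\mathrm{rng}(\pi_1)\to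 w^{\mathfrak b_K}$ (into $S$) such that $(\pi\circ\pi_0)(\mathfrak b_n\restriction w)\Subset\mathfrak b_K\restriction(\pi\circ\pi_0[w])$ and $(\pi\circ\pi_1)(\mathfrak b_n\restriction w)\Subset\mathfrak b_K\restriction(\pi\circ\pi_1[w])$; (4) if $n<\omega$, $w\subseteq w^{\mathfrak b_n}$, $|w|\ge3$, $\pi_0:w\to\omega$ is a quasi-embedding (into $S$) and $\mathrm{rng}(\pi_0)\subseteq u\in[\omega]^{<\omega}$, then there are $K<\omega$ and a quasi-embedding $\pi:u\to w^{\mathfrak b_K}$ (into $S$) such that $(\pi\circ\pi_0)(\mathfrak b_n\restriction w)\Subset\mathfrak b_K\restriction(\pi\circ\pi_0[w])$. **Non-disjointness rank.** For $\mathbf m,\mathbf n\in\mathbf M_{\bar T,\iota}$, $\mathbf n$ extends $\mathbf m$ ($\mathbf m\sqsubseteq\mathbf n$) iff $\ell_{\mathbf m}\le\ell_{\mathbf n}$, $u_{\mathbf m}=\{\eta\restriction\ell_{\mathbf m}:\eta\in u_{\mathbf n}\}$, and for every $(\eta,\nu)\in(u_{\mathbf n})^{\langle2\rangle}$ with $\eta\restriction\ell_{\mathbf m}\ne\nu\restriction\ell_{\mathbf m}$ and each $i<\iota$: $h_i^{\mathbf m}(\eta\restriction\ell_{\mathbf m},\nu\restriction\ell_{\mathbf m})=h_i^{\mathbf n}(\eta,\nu)$ and $g_i^{\mathbf m}(\eta\restriction\ell_{\mathbf m},\nu\restriction\ell_{\mathbf m})=g_i^{\mathbf n}(\eta,\nu)\restriction\ell_{\mathbf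 m}$. The function $\mathrm{ndrk}_\iota:\mathbf M_{\bar T,\iota}\to\mathrm{ON}\cup\{\infty\}$ is defined by declaring when $\mathrm{ndrk}_\iota(\mathbf m)\ge\alpha$: always for $\alpha=0$; for limit $\alpha$ iff $\mathrm{ndrk}_\iota(\mathbf m)\ge\beta$ for all $\beta<\alpha$; for $\alpha=\beta+1$ iff for every $\nu\in u_{\mathbf m}$ there is $\mathbf n\in\mathbf M_{\bar T,\iota}$ with $\ell_{\mathbf n}>\ell_{\mathbf m}$, $\mathbf m\sqsubseteq\mathbf n$, $\mathrm{ndrk}_\iota(\mathbf n)\ge\beta$ and $|\{\eta\in u_{\mathbf n}:\nu\vartriangleleft\eta\}|\ge2$; and $\mathrm{ndrk}_\iota(\mathbf m)=\infty$ iff $\mathrm{ndrk}_\iota(\mathbf m)\ge\alpha$ for all ordinals $\alpha$. Put $\mathrm{ndrk}_\iota(\bar T)=\sup\{\mathrm{ndrk}_\iota(\mathbf m):\mathbf m\in\mathbf M_{\bar T,\iota}\}$. *)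

theory Defs
  imports
    "HOL-Analysis.Function_Topology"
    "HOL-Library.Sublist"
    "HOL-Library.Z2"
    "HOL-Library.Function_Algebras"
begin

unbundle cardinal_syntax

section \<open>Ordinals\<close>

text \<open>
  The ordinals of cardinality at most the continuum, as isomorphism classes of the well-orders
  whose field is a set of sets of natural numbers.  These are the ordinals below the cardinal
  successor of the continuum, so all countable ordinals and all initial ordinals of size at most
  the continuum are among them, and the type is closed under the operations used below.
\<close>

quotient_type ordinal = "nat set rel" / partial: "\<lambda>r s. (r, s) \<in> ordIso"
proof (rule part_equivpI)
  show "\<exists>x :: nat set rel. (x, x) \<in> ordIso"
    by (rule exI[of _ "|UNIV|"]) (simp add: ordIso_reflexive card_of_Well_order)
  show "symp (\<lambda>r s :: nat set rel. (r, s) \<in> ordIso)"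
    by (auto intro!: sympI intro: ordIso_symmetric)
  show "transp (\<lambda>r s :: nat set rel. (r, s) \<in> ordIso)"
    by (auto intro!: transpI intro: ordIso_transitive)
qed

instantiation ordinal :: wellorder
begin

lift_definition less_eq_ordinal :: "ordinal \<Rightarrow> ordinal \<Rightarrow> bool" is "\<lambda>r s. r \<le>o s"
  by (meson ordIso_ordLeq_trans ordIso_symmetric ordLeq_ordIso_trans)

lift_definition less_ordinal :: "ordinal \<Rightarrow> ordinal \<Rightarrow> bool" is "\<lambda>r s. r <o s"
  by (meson ordIso_ordLess_trans ordIso_symmetric ordLess_ordIso_trans)

instance
proof
  fix x y z :: ordinal
  show "x < y \<longleftrightarrow> x \<le> y \<and> \<not> y \<le> x"
  proof transfer
    fix x y :: "nat set rel"
    assume "x =o x" "y =o y"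
    then have "Well_order x" "Well_order y" by (auto simp: ordIso_def)
    then show "x <o y \<longleftrightarrow> x \<le>o y \<and> \<not> y \<le>o x"
      using not_ordLeq_iff_ordLess ordLess_imp_ordLeq by blast
  qed
  show "x \<le> x"
    by transfer (simp add: ordIso_iff_ordLeq)
  show "x \<le> y \<Longrightarrow> y \<le> z \<Longrightarrow> x \<le> z"
    by transfer (rule ordLeq_transitive)
  show "x \<le> y \<Longrightarrow> y \<le> x \<Longrightarrow> x = y"
    by transfer (simp add: ordIso_iff_ordLeq)
  show "x \<le> y \<or> y \<le> x"
    by transfer (use ordLeq_total in \<open>auto simp: ordIso_def\<close>)
next
  fix P :: "ordinal \<Rightarrow> bool" and a :: ordinal
  assume step: "\<And>x. (\<And>y. y < x \<Longrightarrow> P y) \<Longrightarrow> P x"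
  have "wf {(x, y :: ordinal). x < y}"
  proof (rule wf_subset)
    show "wf (inv_image ordLess rep_ordinal)"
      by (intro wf_inv_image wf_ordLess)
    show "{(x, y :: ordinal). x < y} \<subseteq> inv_image ordLess rep_ordinal"
      by (auto simp: inv_image_def less_ordinal_def)
  qed
  then show "P a"
    by (induction a rule: wf_induct_rule) (use step in auto)
qed

end

text \<open>
  The order type of a well-order on an arbitrary type: the ordinal whose set of predecessors is
  isomorphic to it.
\<close>

definition below :: "ordinal \<Rightarrow> ordinal rel" where
  "below \<alpha> = {(x, y). x \<le> y \<and> y < \<alpha>}"

definition otype :: "'a rel \<Rightarrow> ordinal" where
  "otype r = (THE \<alpha>. r =o below \<alpha>)"

lemma Field_below: "Field (below \<alpha>) = {..<\<alpha>}"
  by (auto simp: Field_def below_def)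

lemma Well_order_below: "Well_order (below \<alpha>)"
proof -
  have "wf (below \<alpha> - Id)"
    by (rule wf_subset[OF wf]) (auto simp: below_def)
  then show ?thesis
    unfolding well_order_on_def linear_order_on_def partial_order_on_def preorder_on_def
      total_on_def Field_below
    by (auto simp: below_def refl_on_def trans_def antisym_def)
qed

lemma below_less:
  assumes "\<alpha> < \<beta>"
  shows "below \<alpha> <o below \<beta>"
proof -
  have "Restr (below \<beta>) (underS (below \<beta>) \<alpha>) = below \<alpha>"
    using assms by (auto simp: below_def underS_def)
  moreover have "Field (below \<beta>) \<noteq> {}"
    using assms by (auto simp: Field_below)
  ultimately show ?thesis
    using underS_Restr_ordLess[OF Well_order_below, of \<beta> \<alpha>] by simp
qed

lemma below_inject: "below \<alpha> =o below \<beta> \<longleftrightarrow> \<alpha> = \<beta>"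
  by (metis Well_order_below below_less linorder_less_linear not_ordLess_ordIso
      ordIso_reflexive ordIso_symmetric)

lemma otype_eqI: "r =o below \<alpha> \<Longrightarrow> otype r = \<alpha>"
  unfolding otype_def
  by (rule the_equality) (auto simp: below_inject[symmetric] intro: ordIso_symmetric ordIso_transitive)

lemma Well_order_rep: "Well_order (rep_ordinal \<alpha>)"
  using Quotient3_rep_reflp[OF Quotient3_ordinal, of \<alpha>] by (simp add: ordIso_def)

lemma rep_abs_ordinal: "Well_order r \<Longrightarrow> rep_ordinal (abs_ordinal r) =o r"
  using Quotient3_rel_rep[OF Quotient3_ordinal] ordIso_reflexive[of r]
    rep_abs_rsp_left[OF Quotient3_ordinal, of r r] by simp

lemma below_ordIso_rep: "below \<alpha> =o rep_ordinal \<alpha>"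
proof (induction \<alpha> rule: less_induct)
  case (less \<alpha>)
  consider "below \<alpha> =o rep_ordinal \<alpha>" | "below \<alpha> <o rep_ordinal \<alpha>" | "rep_ordinal \<alpha> <o below \<alpha>"
    using Well_order_below Well_order_rep not_ordLess_iff_ordLeq ordLeq_iff_ordLess_or_ordIso
    by blast
  then show ?case
  proof cases
    case 2
    then obtain a where a: "a \<in> Field (rep_ordinal \<alpha>)"
      and iso: "below \<alpha> =o Restr (rep_ordinal \<alpha>) (underS (rep_ordinal \<alpha>) a)"
      using ordLess_iff_ordIso_Restr[OF Well_order_rep Well_order_below] by blast
    define s where "s = Restr (rep_ordinal \<alpha>) (underS (rep_ordinal \<alpha>) a)"
    have s: "s <o rep_ordinal \<alpha>" "Well_order s"
      using a underS_Restr_ordLess[OF Well_order_rep] by (auto simp: s_def ordLess_def)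
    have eq: "rep_ordinal (abs_ordinal s) =o s"
      by (rule rep_abs_ordinal) (rule s)
    then have lt: "abs_ordinal s < \<alpha>"
      unfolding less_ordinal_def using ordIso_ordLess_trans[OF eq s(1)] by simp
    have "below (abs_ordinal s) =o below \<alpha>"
      using ordIso_transitive[OF ordIso_transitive[OF less.IH[OF lt] eq]
          ordIso_symmetric[OF iso[folded s_def]]] .
    with lt show ?thesis by (simp add: below_inject)
  next
    case 3
    then obtain a where a: "a \<in> Field (below \<alpha>)"
      and iso: "rep_ordinal \<alpha> =o Restr (below \<alpha>) (underS (below \<alpha>) a)"
      using ordLess_iff_ordIso_Restr[OF Well_order_below Well_order_rep] by blast
    have lt: "a < \<alpha>" using a by (simp add: Field_below)
    then have "Restr (below \<alpha>) (underS (below \<alpha>) a) = below a"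
      by (auto simp: below_def underS_def)
    with iso have "rep_ordinal \<alpha> =o rep_ordinal a"
      using ordIso_transitive[OF _ less.IH[OF lt]] by simp
    then have "\<alpha> = a"
      using Quotient3_rel_rep[OF Quotient3_ordinal, of \<alpha> a] by simp
    with lt show ?thesis by simp
  qed
qed

lemma ex_below:
  assumes "Well_order (r :: 'a rel)" and "|Field r| \<le>o |UNIV :: nat set set|"
  shows "\<exists>\<alpha>. r =o below \<alpha>"
proof -
  obtain f :: "'a \<Rightarrow> nat set" where f: "inj_on f (Field r)"
    using assms(2) card_of_ordLeq[of "Field r" "UNIV :: nat set set"] by auto
  have iso: "r =o dir_image r f"
    by (rule dir_image_ordIso[OF assms(1) f])
  then have "Well_order (dir_image r f)" by (simp add: ordIso_def)
  then have "r =o below (abs_ordinal (dir_image r f))"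
    using ordIso_transitive[OF iso ordIso_transitive[OF ordIso_symmetric[OF rep_abs_ordinal]
        ordIso_symmetric[OF below_ordIso_rep]]] by simp
  then show ?thesis ..
qed

lemma card_of_below: "|{..<\<alpha> :: ordinal}| \<le>o |UNIV :: nat set set|"
proof -
  have "below \<alpha> =o rep_ordinal \<alpha>" by (rule below_ordIso_rep)
  then have "|{..<\<alpha>}| =o |Field (rep_ordinal \<alpha>)|"
    unfolding Field_below[symmetric] by (rule card_of_cong)
  moreover have "|Field (rep_ordinal \<alpha>)| \<le>o |UNIV :: nat set set|"
    by (rule card_of_mono1) simp
  ultimately show ?thesis by (rule ordIso_ordLeq_trans)
qed

lemma ex_uncountable_below: "\<exists>\<alpha> :: ordinal. uncountable {..<\<alpha>}"
proof -
  obtain \<alpha> where "|UNIV :: nat set set| =o below \<alpha>"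
    using ex_below[of "|UNIV :: nat set set|"] card_of_Well_order
    by (auto simp: Field_card_of ordLeq_reflexive)
  then have "|Field |UNIV :: nat set set|| =o |{..<\<alpha>}|"
    unfolding Field_below[symmetric] by (rule card_of_cong)
  then obtain f where f: "bij_betw f (UNIV :: nat set set) {..<\<alpha>}"
    using card_of_ordIso by (auto simp: Field_card_of)
  have "uncountable {..<\<alpha>}"
  proof
    assume "countable {..<\<alpha>}"
    then have "countable (UNIV :: nat set set)"
      using f countable_image_inj_on bij_betw_imp_inj_on bij_betw_imp_surj_on by metis
    then have "\<exists>g :: nat \<Rightarrow> nat set. range g = UNIV"
      using uncountable_def by blast
    then show False
      using Cantors_theorem[of "UNIV :: nat set"] by auto
  qed
  then show ?thesis ..
qed

lemma ex_greater_ordinal: "\<exists>\<beta>. \<alpha> < (\<beta> :: ordinal)"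
proof (rule ccontr)
  assume *: "\<not> ?thesis"
  obtain \<gamma> :: ordinal where "uncountable {..<\<gamma>}"
    using ex_uncountable_below by blast
  then have inf: "infinite {..<\<gamma>}" using countable_finite by blast
  moreover have "{..<\<gamma>} \<subseteq> {..<\<alpha>}" using * by (auto intro: less_le_trans simp: not_less)
  ultimately have "infinite {..<\<alpha>}" using finite_subset by blast
  then have "\<exists>h. bij_betw h {..<\<alpha>} ({..<\<alpha>} \<union> {\<alpha>})"
    by (rule infinite_imp_bij_betw2)
  then have "|{..<\<alpha>}| =o |insert \<alpha> {..<\<alpha>}|"
    by (simp add: card_of_ordIso)
  moreover have U: "insert \<alpha> {..<\<alpha>} = UNIV" using * by (auto simp: not_less intro: neq_le_trans)
  ultimately have card: "|UNIV :: ordinal set| \<le>o |UNIV :: nat set set|"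
    using ordIso_ordLeq_trans[OF ordIso_symmetric card_of_below] by metis
  define r where "r = {(x, y :: ordinal). x \<le> y}"
  have F: "Field r = UNIV" by (auto simp: r_def Field_def)
  have "wf (r - Id)" by (rule wf_subset[OF wf]) (auto simp: r_def)
  then have r: "Well_order r"
    unfolding well_order_on_def linear_order_on_def partial_order_on_def preorder_on_def
      total_on_def F
    by (auto simp: r_def refl_on_def trans_def antisym_def)
  obtain \<beta> where \<beta>: "r =o below \<beta>" using ex_below[OF r] card F by auto
  have "Restr r (underS r \<beta>) = below \<beta>" by (auto simp: r_def below_def underS_def)
  then have "below \<beta> <o r" using underS_Restr_ordLess[OF r, of \<beta>] F by simp
  with \<beta> show False using not_ordLess_ordIso ordIso_symmetric by blast
qed

definition ord_zero :: ordinal where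
  "ord_zero = (LEAST \<alpha>. True)"

definition ord_suc :: "ordinal \<Rightarrow> ordinal" where
  "ord_suc \<alpha> = (LEAST \<beta>. \<alpha> < \<beta>)"

definition ord_limit :: "ordinal \<Rightarrow> bool" where
  "ord_limit \<alpha> \<longleftrightarrow> \<alpha> \<noteq> ord_zero \<and> (\<forall>\<beta>. \<alpha> \<noteq> ord_suc \<beta>)"

definition omega :: ordinal where
  "omega = (LEAST \<alpha>. infinite {..<\<alpha>})"

definition omega1 :: ordinal where
  "omega1 = (LEAST \<alpha>. uncountable {..<\<alpha>})"

text \<open>Ordinal multiplication: \<open>\<beta>\<close> consecutive copies of \<open>\<alpha>\<close>.\<close>

definition ord_mult :: "ordinal \<Rightarrow> ordinal \<Rightarrow> ordinal" where
  "ord_mult \<alpha> \<beta> = otype {((a, b), (a', b')).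
     a < \<alpha> \<and> a' < \<alpha> \<and> b < \<beta> \<and> b' < \<beta> \<and> (b < b' \<or> b = b' \<and> a \<le> a')}"

definition infinite_cardinal :: "ordinal \<Rightarrow> bool" where
  "infinite_cardinal \<kappa> \<longleftrightarrow> infinite {..<\<kappa>} \<and> (\<forall>\<beta><\<kappa>. |{..<\<beta>}| <o |{..<\<kappa>}| )"

text \<open>
  A relation rather than a function, since \<open>\<aleph>\<^sub>\<alpha>\<close> need not be represented in the type
  \<^typ>\<open>ordinal\<close>; it is whenever \<open>\<aleph>\<^sub>\<alpha>\<close> is at most the continuum.
\<close>

definition is_aleph :: "ordinal \<Rightarrow> ordinal \<Rightarrow> bool" where
  "is_aleph \<alpha> \<kappa> \<longleftrightarrow> infinite_cardinal \<kappa> \<and>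
     otype {(x, y). x \<le> y \<and> y < \<kappa> \<and> infinite_cardinal x \<and> infinite_cardinal y} = \<alpha>"

text \<open>The class of ordinals extended by a largest element.\<close>

datatype xordinal = Ord ordinal | Infty

instantiation xordinal :: wellorder
begin

definition less_eq_xordinal :: "xordinal \<Rightarrow> xordinal \<Rightarrow> bool" where
  "x \<le> y \<longleftrightarrow> y = Infty \<or> (\<exists>\<alpha> \<beta>. x = Ord \<alpha> \<and> y = Ord \<beta> \<and> \<alpha> \<le> \<beta>)"

definition less_xordinal :: "xordinal \<Rightarrow> xordinal \<Rightarrow> bool" where
  "x < y \<longleftrightarrow> x \<le> y \<and> \<not> y \<le> (x :: xordinal)"

instance
proof
  fix x y z :: xordinal
  show "x < y \<longleftrightarrow> x \<le> y \<and> \<not> y \<le> x" by (simp add: less_xordinal_def)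
  show "x \<le> x" by (cases x) (auto simp: less_eq_xordinal_def)
  show "x \<le> y \<Longrightarrow> y \<le> z \<Longrightarrow> x \<le> z" by (auto simp: less_eq_xordinal_def)
  show "x \<le> y \<Longrightarrow> y \<le> x \<Longrightarrow> x = y" by (auto simp: less_eq_xordinal_def)
  show "x \<le> y \<or> y \<le> x" by (cases x; cases y) (auto simp: less_eq_xordinal_def)
next
  fix P :: "xordinal \<Rightarrow> bool" and a :: xordinal
  assume step: "\<And>x. (\<And>y. y < x \<Longrightarrow> P y) \<Longrightarrow> P x"
  have *: "P (Ord \<alpha>)" for \<alpha>
  proof (induction \<alpha> rule: less_induct)
    case (less \<alpha>)
    show ?case
      by (rule step) (use less in \<open>auto simp: less_xordinal_def less_eq_xordinal_def not_le\<close>)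
  qed
  show "P a"
  proof (cases a)
    case Infty
    show ?thesis
      unfolding Infty
    proof (rule step)
      fix y assume "y < Infty"
      with * show "P y" by (cases y) (auto simp: less_xordinal_def)
    qed
  qed (use * in simp)
qed

end


section \<open>Sequences, trees, perfect sets\<close>

text \<open>
  The set of 0-1 sequences of length \<open>n\<close> is rendered as the set of lists of length \<open>n\<close> over the
  two-element field, and the Cantor space as \<open>nat \<Rightarrow> bit\<close> with the pointwise addition and the
  product topology.
\<close>

instantiation bit :: discrete_topology
begin

definition open_bit :: "bit set \<Rightarrow> bool" where
  "open_bit A \<longleftrightarrow> True"

instance
  by standard (auto simp: open_bit_def)

end

definition ladd :: "bit list \<Rightarrow> bit list \<Rightarrow> bit list" where
  "ladd \<eta> \<nu> = map2 (+) \<eta> \<nu>"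

definition init_seg :: "nat \<Rightarrow> (nat \<Rightarrow> bit) \<Rightarrow> bit list" where
  "init_seg n x = map x [0..<n]"

definition seg_of :: "bit list \<Rightarrow> (nat \<Rightarrow> bit) \<Rightarrow> bool" where
  "seg_of \<eta> x \<longleftrightarrow> \<eta> = init_seg (length \<eta>) x"

definition tree :: "bit list set \<Rightarrow> bool" where
  "tree T \<longleftrightarrow> (\<forall>\<eta>\<in>T. \<forall>\<nu>. strict_prefix \<nu> \<eta> \<longrightarrow> \<nu> \<in> T)"

definition no_maximal_nodes :: "bit list set \<Rightarrow> bool" where
  "no_maximal_nodes T \<longleftrightarrow> (\<forall>\<eta>\<in>T. \<exists>\<nu>\<in>T. strict_prefix \<eta> \<nu>)"

definition branches :: "bit list set \<Rightarrow> (nat \<Rightarrow> bit) set" where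
  "branches T = {x. \<forall>n. init_seg n x \<in> T}"

definition perfect_set :: "(nat \<Rightarrow> bit) set \<Rightarrow> bool" where
  "perfect_set P \<longleftrightarrow> P \<noteq> {} \<and> closed P \<and> (\<forall>x\<in>P. x islimpt P)"

definition offdiag :: "'a set \<Rightarrow> ('a \<times> 'a) set" where
  "offdiag u = {(x, y). x \<in> u \<and> y \<in> u \<and> x \<noteq> y}"


section \<open>YZR-systems\<close>

text \<open>
  The underlying set is a subset of an arbitrary well-ordered type; it is instantiated with
  \<^typ>\<open>ordinal\<close> for sets of ordinals and with \<^typ>\<open>nat\<close> for systems on \<open>\<omega>\<close>.
  The values of the three functions matter only on nonempty finite subsets of the underlying set.
\<close>

record 'a yzr =
  ypts :: "'a set"
  yr :: "'a set \<Rightarrow> ordinal"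
  yj :: "'a set \<Rightarrow> nat"
  yk :: "'a set \<Rightarrow> nat"

definition yzr_system :: "ordinal \<Rightarrow> 'a::wellorder yzr \<Rightarrow> bool" where
  "yzr_system \<epsilon> s \<longleftrightarrow>
     ypts s \<noteq> {} \<and>
     (\<forall>w. finite w \<and> w \<noteq> {} \<and> w \<subseteq> ypts s \<longrightarrow> yr s w \<le> \<epsilon>) \<and>
     (\<forall>u w. u \<noteq> {} \<and> u \<subseteq> w \<and> finite w \<and> w \<subseteq> ypts s \<longrightarrow> yr s u \<ge> yr s w) \<and>
     (\<forall>a\<in>ypts s. yr s {a} > ord_zero) \<and>
     (\<forall>w. finite w \<and> w \<noteq> {} \<and> w \<subseteq> ypts s \<longrightarrow>
        yk s w < card w \<and>
        \<not> (\<exists>b\<in>ypts s - w.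
             card (w \<inter> {..<b}) = yk s w \<and>
             yj s ((w - {sorted_list_of_set w ! yk s w}) \<union> {b}) = yj s w \<and>
             yr s (w \<union> {b}) = yr s w))"

definition quasi_embedding :: "'a::wellorder yzr \<Rightarrow> 'b::wellorder yzr \<Rightarrow> ('a \<Rightarrow> 'b) \<Rightarrow> bool" where
  "quasi_embedding q s \<phi> \<longleftrightarrow>
     strict_mono_on (ypts q) \<phi> \<and> \<phi> ` ypts q \<subseteq> ypts s \<and>
     (\<forall>v. finite v \<and> v \<noteq> {} \<and> v \<subseteq> ypts q \<longrightarrow>
        yr s (\<phi> ` v) = yr q v \<and> yk s (\<phi> ` v) = yk q v \<and>
        (yr q v > ord_zero \<longrightarrow> yj s (\<phi> ` v) = yj q v))"

definition quasi_embedding_on :: "'a::wellorder yzr \<Rightarrow> 'a set \<Rightarrow> ('a \<Rightarrow> 'a) \<Rightarrow> bool" where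
  "quasi_embedding_on s w \<phi> \<longleftrightarrow>
     w \<subseteq> ypts s \<and> quasi_embedding (s\<lparr>ypts := w\<rparr>) s \<phi>"

definition cute :: "ordinal \<Rightarrow> nat yzr \<Rightarrow> bool" where
  "cute \<epsilon> S \<longleftrightarrow> yzr_system \<epsilon> S \<and> ypts S = UNIV \<and>
     (\<forall>(q :: ordinal yzr) M. yzr_system \<epsilon> q \<and> finite (ypts q) \<longrightarrow>
        (\<exists>\<phi>. quasi_embedding q S \<phi> \<and> \<phi> ` ypts q \<subseteq> {M..}))"


section \<open>The family \<open>\<^bold>M\<close> of configurations\<close>

text \<open>
  \<open>configs \<iota> T\<close> is the family \<open>\<^bold>M\<^bsub>T,\<iota>\<^esub>\<close>.  The values of \<open>cfg_h i\<close> and \<open>cfg_g i\<close> matter only for \<open>i < \<iota>\<close> and on pairs of distinct elements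
  of \<open>cfg_u\<close>; every notion below depends on these values only.
\<close>

record config =
  cfg_l :: nat
  cfg_u :: "bit list set"
  cfg_h :: "nat \<Rightarrow> bit list \<Rightarrow> bit list \<Rightarrow> nat"
  cfg_g :: "nat \<Rightarrow> bit list \<Rightarrow> bit list \<Rightarrow> bit list"

definition configs :: "nat \<Rightarrow> (nat \<Rightarrow> bit list set) \<Rightarrow> config set" where
  "configs \<iota> T = {m.
     0 < cfg_l m \<and> (\<forall>\<eta>\<in>cfg_u m. length \<eta> = cfg_l m) \<and> card (cfg_u m) \<ge> 2 \<and>
     (\<forall>(\<eta>, \<nu>)\<in>offdiag (cfg_u m). \<forall>i<\<iota>.
        cfg_g m i \<eta> \<nu> \<in> T (cfg_h m i \<eta> \<nu>) \<and> length (cfg_g m i \<eta> \<nu>) = cfg_l m) \<and>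
     (\<forall>(\<eta>, \<nu>)\<in>offdiag (cfg_u m). \<forall>i<\<iota>.
        ladd \<eta> (cfg_g m i \<eta> \<nu>) = ladd \<nu> (cfg_g m i \<nu> \<eta>)) \<and>
     (\<forall>(\<eta>, \<nu>)\<in>offdiag (cfg_u m).
        distinct (map (\<lambda>i. cfg_g m i \<eta> \<nu>) [0..<\<iota>] @ map (\<lambda>i. cfg_g m i \<nu> \<eta>) [0..<\<iota>])) \<and>
     (\<exists>(F :: bit list \<Rightarrow> nat \<Rightarrow> bit) (G :: nat \<Rightarrow> bit list \<Rightarrow> bit list \<Rightarrow> nat \<Rightarrow> bit).
        (\<forall>\<eta>\<in>cfg_u m. seg_of \<eta> (F \<eta>)) \<and>
        (\<forall>(\<eta>, \<nu>)\<in>offdiag (cfg_u m). \<forall>i<\<iota>.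
           seg_of (cfg_g m i \<eta> \<nu>) (G i \<eta> \<nu>) \<and>
           G i \<eta> \<nu> \<in> branches (T (cfg_h m i \<eta> \<nu>)) \<and>
           F \<eta> + G i \<eta> \<nu> = F \<nu> + G i \<nu> \<eta>))}"

text \<open>Translation by \<open>\<rho>\<close> is an involution on sequences of the length of \<open>\<rho>\<close>.\<close>

definition cfg_shift :: "config \<Rightarrow> bit list \<Rightarrow> config" where
  "cfg_shift m \<rho> = \<lparr>cfg_l = cfg_l m, cfg_u = (\<lambda>\<eta>. ladd \<eta> \<rho>) ` cfg_u m,
     cfg_h = (\<lambda>i \<eta> \<nu>. cfg_h m i (ladd \<eta> \<rho>) (ladd \<nu> \<rho>)),
     cfg_g = (\<lambda>i \<eta> \<nu>. cfg_g m i (ladd \<eta> \<rho>) (ladd \<nu> \<rho>))\<rparr>"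

definition ess_match :: "nat \<Rightarrow> config \<Rightarrow> config \<Rightarrow> bit list \<Rightarrow> bit list \<Rightarrow> bool" where
  "ess_match \<iota> m n \<eta> \<nu> \<longleftrightarrow>
     (let l = cfg_l m; \<eta>' = take l \<eta>; \<nu>' = take l \<nu> in
       (\<iota> > 2 \<longrightarrow>
          {{cfg_g m i \<eta>' \<nu>', cfg_g m i \<nu>' \<eta>'} | i. i < \<iota>} =
          {{take l (cfg_g n i \<eta> \<nu>), take l (cfg_g n i \<nu> \<eta>)} | i. i < \<iota>}) \<and>
       (\<iota> = 2 \<longrightarrow>
          {cfg_g m 0 \<eta>' \<nu>', cfg_g m 0 \<nu>' \<eta>', cfg_g m 1 \<eta>' \<nu>', cfg_g m 1 \<nu>' \<eta>'} =
          {take l (cfg_g n 0 \<eta> \<nu>), take l (cfg_g n 0 \<nu> \<eta>),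
           take l (cfg_g n 1 \<eta> \<nu>), take l (cfg_g n 1 \<nu> \<eta>)}) \<and>
       (\<forall>i<\<iota>. \<forall>j<\<iota>.
          (cfg_g m i \<eta>' \<nu>' = take l (cfg_g n j \<eta> \<nu>) \<longrightarrow> cfg_h m i \<eta>' \<nu>' = cfg_h n j \<eta> \<nu>) \<and>
          (cfg_g m i \<eta>' \<nu>' = take l (cfg_g n j \<nu> \<eta>) \<longrightarrow> cfg_h m i \<eta>' \<nu>' = cfg_h n j \<nu> \<eta>)))"

definition ess_extends :: "nat \<Rightarrow> config \<Rightarrow> config \<Rightarrow> bool" where
  "ess_extends \<iota> m n \<longleftrightarrow>
     cfg_l m \<le> cfg_l n \<and> cfg_u m = take (cfg_l m) ` cfg_u n \<and>
     (\<forall>(\<eta>, \<nu>)\<in>offdiag (cfg_u n).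
        take (cfg_l m) \<eta> \<noteq> take (cfg_l m) \<nu> \<longrightarrow> ess_match \<iota> m n \<eta> \<nu>)"

definition ess_same :: "nat \<Rightarrow> config \<Rightarrow> config \<Rightarrow> bool" where
  "ess_same \<iota> m n \<longleftrightarrow>
     cfg_l m = cfg_l n \<and> cfg_u m = cfg_u n \<and>
     (\<forall>(\<eta>, \<nu>)\<in>offdiag (cfg_u m). ess_match \<iota> m n \<eta> \<nu>)"

definition cfg_extends :: "nat \<Rightarrow> config \<Rightarrow> config \<Rightarrow> bool" where
  "cfg_extends \<iota> m n \<longleftrightarrow>
     cfg_l m \<le> cfg_l n \<and> cfg_u m = take (cfg_l m) ` cfg_u n \<and>
     (\<forall>(\<eta>, \<nu>)\<in>offdiag (cfg_u n). take (cfg_l m) \<eta> \<noteq> take (cfg_l m) \<nu> \<longrightarrow>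
        (\<forall>i<\<iota>.
           cfg_h m i (take (cfg_l m) \<eta>) (take (cfg_l m) \<nu>) = cfg_h n i \<eta> \<nu> \<and>
           cfg_g m i (take (cfg_l m) \<eta>) (take (cfg_l m) \<nu>) = take (cfg_l m) (cfg_g n i \<eta> \<nu>)))"


section \<open>Bricks\<close>

record brick =
  bk_w :: "nat set"
  bk_n :: nat
  bk_eta :: "nat \<Rightarrow> bit list"
  bk_h :: "nat \<Rightarrow> nat \<Rightarrow> nat \<Rightarrow> nat"
  bk_g :: "nat \<Rightarrow> nat \<Rightarrow> nat \<Rightarrow> bit list"
  bk_M :: "config set"

definition cfg_at :: "nat \<Rightarrow> brick \<Rightarrow> nat \<Rightarrow> nat set \<Rightarrow> config \<Rightarrow> bool" where
  "cfg_at \<iota> B l w m \<longleftrightarrow>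
     cfg_l m = l \<and> cfg_u m = (\<lambda>a. take l (bk_eta B a)) ` w \<and>
     inj_on (\<lambda>a. take l (bk_eta B a)) w \<and>
     (\<forall>(a, b)\<in>offdiag w. \<forall>i<\<iota>.
        cfg_h m i (take l (bk_eta B a)) (take l (bk_eta B b)) = bk_h B i a b \<and>
        cfg_g m i (take l (bk_eta B a)) (take l (bk_eta B b)) = take l (bk_g B i a b))"

text \<open>\<open>brick_cfg \<iota> T c B l w m\<close> is the situation written \<open>m = m(l, w)\<close> in clause 5 of a brick.\<close>

definition brick_cfg ::
  "nat \<Rightarrow> (nat \<Rightarrow> bit list set) \<Rightarrow> (nat \<Rightarrow> nat) \<Rightarrow> brick \<Rightarrow> nat \<Rightarrow> nat set \<Rightarrow> config \<Rightarrow> bool" where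
  "brick_cfg \<iota> T c B l w m \<longleftrightarrow>
     m \<in> configs \<iota> T \<and> w \<subseteq> bk_w B \<and> card w \<ge> 3 \<and> 0 < l \<and> l \<le> bk_n B \<and>
     (\<forall>(a, b)\<in>offdiag w. \<forall>i<\<iota>. c (bk_h B i a b) \<le> l) \<and>
     cfg_at \<iota> B l w m"

definition brick_cfgs ::
  "nat \<Rightarrow> (nat \<Rightarrow> bit list set) \<Rightarrow> (nat \<Rightarrow> nat) \<Rightarrow> brick \<Rightarrow> config set" where
  "brick_cfgs \<iota> T c B = {m. \<exists>l w. brick_cfg \<iota> T c B l w m}"

definition lin_indep :: "nat \<Rightarrow> 'a set \<Rightarrow> ('a \<Rightarrow> bit list) \<Rightarrow> bool" where
  "lin_indep n w \<eta> \<longleftrightarrow>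
     (\<forall>x :: 'a \<Rightarrow> bit. (\<forall>i<n. (\<Sum>a\<in>w. x a * \<eta> a ! i) = 0) \<longrightarrow> (\<forall>a\<in>w. x a = 0))"

text \<open>
  In clause 4 all sequences have length \<open>bk_n B\<close>, so the truncations in \<open>cfg_at\<close> are trivial.
  In clause 6 the order isomorphism is the increasing bijection (a quasi-embedding is increasing).
\<close>

definition is_brick ::
  "nat yzr \<Rightarrow> nat \<Rightarrow> (nat \<Rightarrow> bit list set) \<Rightarrow> (nat \<Rightarrow> nat) \<Rightarrow> brick \<Rightarrow> bool" where
  "is_brick S \<iota> T c B \<longleftrightarrow>
     finite (bk_w B) \<and> card (bk_w B) \<ge> 3 \<and> 0 < bk_n B \<and>
     (\<forall>a\<in>bk_w B. length (bk_eta B a) = bk_n B) \<and> lin_indep (bk_n B) (bk_w B) (bk_eta B) \<and>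
     (\<forall>(a, b)\<in>offdiag (bk_w B). \<forall>i<\<iota>.
        c (bk_h B i a b) \<le> bk_n B \<and>
        bk_g B i a b \<in> (\<Union>m. T m) \<and> length (bk_g B i a b) = bk_n B) \<and>
     (\<exists>m\<in>configs \<iota> T. cfg_at \<iota> B (bk_n B) (bk_w B) m) \<and>
     bk_M B = brick_cfgs \<iota> T c B \<and>
     (\<forall>l w\<^sub>0 w\<^sub>1 m\<^sub>0 m\<^sub>1 \<rho>.
        brick_cfg \<iota> T c B l w\<^sub>0 m\<^sub>0 \<and> brick_cfg \<iota> T c B l w\<^sub>1 m\<^sub>1 \<and> length \<rho> = l \<and>
        ess_same \<iota> m\<^sub>0 (cfg_shift m\<^sub>1 \<rho>) \<longrightarrow>
        (\<exists>\<pi>. bij_betw \<pi> w\<^sub>0 w\<^sub>1 \<and> quasi_embedding_on S w\<^sub>0 \<pi> \<and>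
           (\<forall>a\<in>w\<^sub>0. ladd (take l (bk_eta B a)) \<rho> = take l (bk_eta B (\<pi> a))))) \<and>
     (\<forall>l w a m n.
        brick_cfg \<iota> T c B l w m \<and> a \<in> w \<and> card (w \<inter> {..<a}) = yk S w \<and> yr S w = ord_zero \<and>
        ess_extends \<iota> m n \<and> n \<in> bk_M B \<longrightarrow>
        card {\<nu> \<in> cfg_u n. prefix (take l (bk_eta B a)) \<nu>} = 1)"

definition brick_le :: "nat \<Rightarrow> brick \<Rightarrow> brick \<Rightarrow> bool" where
  "brick_le \<iota> B\<^sub>0 B\<^sub>1 \<longleftrightarrow>
     bk_w B\<^sub>0 \<subseteq> bk_w B\<^sub>1 \<and> bk_n B\<^sub>0 \<le> bk_n B\<^sub>1 \<and>
     (\<forall>a\<in>bk_w B\<^sub>0. prefix (bk_eta B\<^sub>0 a) (bk_eta B\<^sub>1 a)) \<and>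
     (\<forall>(a, b)\<in>offdiag (bk_w B\<^sub>0). \<forall>i<\<iota>.
        bk_h B\<^sub>1 i a b = bk_h B\<^sub>0 i a b \<and> prefix (bk_g B\<^sub>0 i a b) (bk_g B\<^sub>1 i a b))"

text \<open>
  The components of the restriction of a brick, and of its image under a quasi-embedding defined
  on \<open>bk_w B\<close>, written out; values at irrelevant arguments aside they are determined uniquely by
  the requirements that the result is a brick below \<open>B\<close> on \<open>w\<close>, respectively a copy of \<open>B\<close>.
\<close>

definition brick_restrict ::
  "nat \<Rightarrow> (nat \<Rightarrow> bit list set) \<Rightarrow> (nat \<Rightarrow> nat) \<Rightarrow> brick \<Rightarrow> nat set \<Rightarrow> brick" where
  "brick_restrict \<iota> T c B w = B\<lparr>bk_w := w, bk_M := brick_cfgs \<iota> T c (B\<lparr>bk_w := w\<rparr>)\<rparr>"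

definition brick_image :: "(nat \<Rightarrow> nat) \<Rightarrow> brick \<Rightarrow> brick" where
  "brick_image \<phi> B = (let \<psi> = inv_into (bk_w B) \<phi> in
     \<lparr>bk_w = \<phi> ` bk_w B, bk_n = bk_n B, bk_eta = (\<lambda>a. bk_eta B (\<psi> a)),
      bk_h = (\<lambda>i a b. bk_h B i (\<psi> a) (\<psi> b)), bk_g = (\<lambda>i a b. bk_g B i (\<psi> a) (\<psi> b)),
      bk_M = bk_M B\<rparr>)"

definition controlled_amalgamation ::
  "nat yzr \<Rightarrow> nat \<Rightarrow> (nat \<Rightarrow> bit list set) \<Rightarrow> (nat \<Rightarrow> nat) \<Rightarrow> bool" where
  "controlled_amalgamation S \<iota> T c \<longleftrightarrow>
     (\<exists>B :: nat \<Rightarrow> brick.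
        (\<forall>n. is_brick S \<iota> T c (B n)) \<and>
        (\<forall>n. brick_le \<iota> (B n) (B (Suc n))) \<and>
        (\<Union>n. bk_w (B n)) = UNIV \<and>
        filterlim (\<lambda>n. bk_n (B n)) at_top sequentially \<and>
        (\<forall>n u w \<pi>\<^sub>0 \<pi>\<^sub>1.
           u \<subseteq> w \<and> w \<subseteq> bk_w (B n) \<and> card w \<ge> 3 \<and>
           (\<forall>v \<delta>. v \<subseteq> u \<and> \<delta> \<in> w - u \<and> yr S (v \<union> {\<delta>}) = ord_zero \<longrightarrow>
              yk S (v \<union> {\<delta>}) \<noteq> card (v \<inter> {..<\<delta>})) \<and>
           quasi_embedding_on S w \<pi>\<^sub>0 \<and> quasi_embedding_on S w \<pi>\<^sub>1 \<and>
           (\<forall>a\<in>u. \<pi>\<^sub>0 a = \<pi>\<^sub>1 a) \<and> \<pi>\<^sub>0 ` (w - u) \<inter> \<pi>\<^sub>1 ` (w - u) = {} \<longrightarrow>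
           (\<exists>K \<pi>. quasi_embedding_on S (\<pi>\<^sub>0 ` w \<union> \<pi>\<^sub>1 ` w) \<pi> \<and>
              \<pi> ` (\<pi>\<^sub>0 ` w \<union> \<pi>\<^sub>1 ` w) \<subseteq> bk_w (B K) \<and>
              brick_le \<iota> (brick_image (\<pi> \<circ> \<pi>\<^sub>0) (brick_restrict \<iota> T c (B n) w))
                         (brick_restrict \<iota> T c (B K) ((\<pi> \<circ> \<pi>\<^sub>0) ` w)) \<and>
              brick_le \<iota> (brick_image (\<pi> \<circ> \<pi>\<^sub>1) (brick_restrict \<iota> T c (B n) w))
                         (brick_restrict \<iota> T c (B K) ((\<pi> \<circ> \<pi>\<^sub>1) ` w)))) \<and>
        (\<forall>n w u \<pi>\<^sub>0.
           w \<subseteq> bk_w (B n) \<and> card w \<ge> 3 \<and> quasi_embedding_on S w \<pi>\<^sub>0 \<and>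
           finite u \<and> \<pi>\<^sub>0 ` w \<subseteq> u \<longrightarrow>
           (\<exists>K \<pi>. quasi_embedding_on S u \<pi> \<and> \<pi> ` u \<subseteq> bk_w (B K) \<and>
              brick_le \<iota> (brick_image (\<pi> \<circ> \<pi>\<^sub>0) (brick_restrict \<iota> T c (B n) w))
                         (brick_restrict \<iota> T c (B K) ((\<pi> \<circ> \<pi>\<^sub>0) ` w)))))"


section \<open>Non-disjointness rank\<close>

text \<open>
  \<open>ndrk_ge \<iota> T m \<alpha>\<close> is the recursively defined relation ``the rank of \<open>m\<close> is at least \<open>\<alpha>\<close>''.
  The three clauses concern disjoint cases for \<open>\<alpha>\<close> and refer to smaller ordinals only, so the
  least relation closed under them is the only one satisfying the recursion.
\<close>

inductive ndrk_ge :: "nat \<Rightarrow> (nat \<Rightarrow> bit list set) \<Rightarrow> config \<Rightarrow> ordinal \<Rightarrow> bool"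
  for \<iota> :: nat and T :: "nat \<Rightarrow> bit list set" where
  zero: "ndrk_ge \<iota> T m ord_zero"
| limit: "ord_limit \<alpha> \<Longrightarrow> (\<And>\<beta>. \<beta> < \<alpha> \<Longrightarrow> ndrk_ge \<iota> T m \<beta>) \<Longrightarrow> ndrk_ge \<iota> T m \<alpha>"
| suc: "(\<And>\<nu>. \<nu> \<in> cfg_u m \<Longrightarrow>
           \<exists>n\<in>configs \<iota> T. cfg_l n > cfg_l m \<and> cfg_extends \<iota> m n \<and> ndrk_ge \<iota> T n \<beta> \<and>
             card {\<eta> \<in> cfg_u n. strict_prefix \<nu> \<eta>} \<ge> 2) \<Longrightarrow>
        ndrk_ge \<iota> T m (ord_suc \<beta>)"

text \<open>
  There are only countably many configurations up to irrelevant values, so a rank which is not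
  \<open>\<infinity>\<close> is countable, and letting \<open>\<alpha>\<close> range over \<^typ>\<open>ordinal\<close> is as good as over all ordinals.
\<close>

definition ndrk :: "nat \<Rightarrow> (nat \<Rightarrow> bit list set) \<Rightarrow> config \<Rightarrow> xordinal" where
  "ndrk \<iota> T m =
     (if \<forall>\<alpha>. ndrk_ge \<iota> T m \<alpha> then Infty else Ord (GREATEST \<alpha>. ndrk_ge \<iota> T m \<alpha>))"

definition ndrk_sup :: "nat \<Rightarrow> (nat \<Rightarrow> bit list set) \<Rightarrow> xordinal" where
  "ndrk_sup \<iota> T = (LEAST x. \<forall>m\<in>configs \<iota> T. ndrk \<iota> T m \<le> x)"


section \<open>Martin's Axiom\<close>

text \<open>
  \<open>(p, q) \<in> le\<close> means that \<open>p\<close> is a stronger condition than \<open>q\<close>.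
\<close>

definition compatible_in :: "'p set \<Rightarrow> 'p rel \<Rightarrow> 'p \<Rightarrow> 'p \<Rightarrow> bool" where
  "compatible_in P le p q \<longleftrightarrow> (\<exists>s\<in>P. (s, p) \<in> le \<and> (s, q) \<in> le)"

definition ccc :: "'p set \<Rightarrow> 'p rel \<Rightarrow> bool" where
  "ccc P le \<longleftrightarrow>
     (\<forall>A\<subseteq>P. (\<forall>p\<in>A. \<forall>q\<in>A. p \<noteq> q \<longrightarrow> \<not> compatible_in P le p q) \<longrightarrow> countable A)"

definition dense_in :: "'p set \<Rightarrow> 'p rel \<Rightarrow> 'p set \<Rightarrow> bool" where
  "dense_in P le D \<longleftrightarrow> D \<subseteq> P \<and> (\<forall>p\<in>P. \<exists>d\<in>D. (d, p) \<in> le)"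

definition filter_in :: "'p set \<Rightarrow> 'p rel \<Rightarrow> 'p set \<Rightarrow> bool" where
  "filter_in P le G \<longleftrightarrow> G \<subseteq> P \<and> G \<noteq> {} \<and>
     (\<forall>p\<in>G. \<forall>q\<in>P. (p, q) \<in> le \<longrightarrow> q \<in> G) \<and>
     (\<forall>p\<in>G. \<forall>q\<in>G. \<exists>s\<in>G. (s, p) \<in> le \<and> (s, q) \<in> le)"

text \<open>
  Forcing notions whose underlying set has size at most the continuum, represented on sets of
  sets of natural numbers.  By the usual Loewenheim-Skolem argument this is equivalent to the
  axiom for arbitrary ccc forcing notions (over which one cannot quantify in HOL); as a
  hypothesis it is formally weaker.
\<close>

definition martins_axiom :: bool where
  "martins_axiom \<longleftrightarrow>
     (\<forall>(P :: nat set set) le \<D>.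
        P \<noteq> {} \<and> preorder_on P le \<and> ccc P le \<and>
        |\<D>| <o |UNIV :: nat set set| \<and> (\<forall>D\<in>\<D>. dense_in P le D) \<longrightarrow>
        (\<exists>G. filter_in P le G \<and> (\<forall>D\<in>\<D>. G \<inter> D \<noteq> {})))"

definition translate :: "(nat \<Rightarrow> bit) \<Rightarrow> (nat \<Rightarrow> bit) set \<Rightarrow> (nat \<Rightarrow> bit) set" where
  "translate x A = (\<lambda>y. x + y) ` A"

end

theory Submission
  imports Defs
begin

text \<open>
  The two halves of the theorem have unrelated proofs.

  \<^bold>\<open>No perfect set.\<close>  Suppose that \<open>P\<close> is perfect and that any two translates of \<open>B\<close> by elements of
  \<open>P\<close> share at least \<open>2 * \<iota>\<close> points.  For \<open>d = \<eta> + \<nu>\<close> the intersection of the translates by \<open>\<eta>\<close> and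
  \<open>\<nu>\<close> is invariant under the involution \<open>x \<mapsto> x + d\<close>, so it contains \<open>\<iota>\<close> disjoint orbits, and these
  are \<open>\<iota>\<close> disjoint pairs of branches with sum \<open>d\<close> (\<open>overlap_pattern\<close>).  Up to finite
  approximation there are only countably many ways to choose such pairs; each of these
  patterns is realized by a closed set of differences, because the branches range over a compact set.
  By the Baire category theorem for \<open>P \<times> P\<close> one pattern is realized by all pairs in the product of
  two relatively open subsets of \<open>P\<close> (\<open>baire_rectangle\<close>).  Hence a configuration which is realized
  uniformly on open pieces of \<open>P\<close> can be prolonged so that a prescribed one of its nodes splits and
  the uniformity persists (\<open>scheme_split\<close>).  Such a configuration has every ordinal as a lower
  bound of its rank, which contradicts the bound on the rank of \<open>T\<close>
  (\<open>bounded_rank_no_perfect_overlap\<close>).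

  \<^bold>\<open>Many translates.\<close>  A set of size \<open>\<aleph>\<^sub>\<epsilon>\<close> carries a YZR-system \<open>s\<close> of rank \<open>\<epsilon>\<close>: well-order the set
  in its cardinality, take by induction a system on each proper initial segment, and let the rank of
  a finite set be the least rank that one of its elements sees below itself
  (\<open>ex_rank_coloring\<close>, \<open>ex_yzr_system\<close>).  Consider the partial order of finite subsets of \<open>s\<close>
  embedded into a brick, ordered by extension of the brick that they inherit.  Cuteness and the
  extension of one copy of a brick, as provided by controlled amalgamation, make the obvious sets
  dense.  As to the countable chain condition, an uncountable family of conditions contains two with
  the same brick and the same image whose domains meet in a common root as in a Delta-system
  (\<open>delta_system_pair\<close>), and controlled amalgamation glues them.  Its hypothesis on sets of rank \<open>0\<close> holds because otherwise the
  two copies of a single point over a subset of the root would be twins of rank \<open>0\<close>, and these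
  are excluded by the last axiom of YZR-systems (\<open>yzr_no_twins\<close>, \<open>ccc_conds\<close>).  A filter from
  Martin's Axiom then produces the points \<open>\<rho> \<alpha>\<close> together with \<open>2 * \<iota>\<close> common points of any two
  translates (\<open>ex_overlapping_family\<close>).
\<close>

section \<open>Cantor space\<close>

instance bit :: finite
proof
  have "(UNIV :: bit set) = {0, 1}"
    using bit_not_zero_iff by blast
  then show "finite (UNIV :: bit set)"
    by (metis finite.emptyI finite.insertI)
qed

instance "fun" :: (type, t2_space) t2_space
proof
  fix f g :: "'a \<Rightarrow> 'b"
  assume "f \<noteq> g"
  then obtain i where "f i \<noteq> g i" by auto
  then obtain U V where "open U" "open V" "f i \<in> U" "g i \<in> V" "U \<inter> V = {}"
    using hausdorff[of "f i" "g i"] by metis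
  then show "\<exists>U V. open U \<and> open V \<and> f \<in> U \<and> g \<in> V \<and> U \<inter> V = {}"
    by (intro exI[of _ "(\<lambda>f. f i) -` U"] exI[of _ "(\<lambda>f. f i) -` V"])
      (simp add: open_vimage, auto)
qed

lemma bit_add_self [simp]: "(a :: bit) + a = 0"
  by (cases a) simp_all

lemma cantor_add_self [simp]: "(x :: nat \<Rightarrow> bit) + x = 0"
  by (simp add: fun_eq_iff)

lemma cantor_add_cancel [simp]: "(x :: nat \<Rightarrow> bit) + (x + y) = y"
  by (simp flip: add.assoc)

lemma cantor_add_eq_iff: "(x :: nat \<Rightarrow> bit) + y = z \<longleftrightarrow> y = x + z"
  by (metis cantor_add_cancel)

definition cyl :: "bit list \<Rightarrow> (nat \<Rightarrow> bit) set" where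
  "cyl s = {x. seg_of s x}"

lemma length_init_seg [simp]: "length (init_seg n x) = n"
  by (simp add: init_seg_def)

lemma nth_init_seg [simp]: "i < n \<Longrightarrow> init_seg n x ! i = x i"
  by (simp add: init_seg_def)

lemma mem_cyl_iff: "x \<in> cyl s \<longleftrightarrow> (\<forall>i<length s. s ! i = x i)"
  by (auto simp: cyl_def seg_of_def list_eq_iff_nth_eq)

lemma mem_cyl_init_seg [simp]: "x \<in> cyl (init_seg n x)"
  by (simp add: mem_cyl_iff)

lemma init_seg_eq: "x \<in> cyl s \<Longrightarrow> n \<le> length s \<Longrightarrow> init_seg n x = take n s"
  by (auto simp: mem_cyl_iff list_eq_iff_nth_eq)

lemma prefix_init_seg: "x \<in> cyl s \<Longrightarrow> length s \<le> n \<Longrightarrow> prefix s (init_seg n x)"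
  unfolding prefix_def mem_cyl_iff
  by (intro exI[of _ "drop (length s) (init_seg n x)"]) (auto simp: list_eq_iff_nth_eq nth_append)

lemma prefix_nthD: "prefix s t \<Longrightarrow> i < length s \<Longrightarrow> t ! i = s ! i"
  by (auto simp: prefix_def nth_append)

lemma cyl_mono: "prefix s t \<Longrightarrow> cyl t \<subseteq> cyl s"
  using prefix_length_le[of s t] prefix_nthD[of s t] by (fastforce simp: mem_cyl_iff)

lemma cyl_take: "cyl s \<subseteq> cyl (take n s)"
  by (rule cyl_mono) (rule take_is_prefix)

lemma open_cyl: "open (cyl s)"
proof -
  have "open {f :: nat \<Rightarrow> bit. \<forall>i\<in>{..<length s}. f (id i) \<in> {s ! i}}"
    by (rule product_topology_basis') (auto intro: open_discrete)
  also have "{f. \<forall>i\<in>{..<length s}. f (id i) \<in> {s ! i}} = cyl s"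
    by (auto simp: mem_cyl_iff)
  finally show ?thesis .
qed

text \<open>
  A basic open set of the product topology restricts finitely many coordinates only.
\<close>

lemma open_contains_cyl:
  assumes "open U" "x \<in> U"
  shows "\<exists>n. cyl (init_seg n x) \<subseteq> U"
proof -
  obtain X :: "nat \<Rightarrow> bit set" where
    X: "x \<in> (\<Pi>\<^sub>E i\<in>UNIV. X i)" "finite {i. X i \<noteq> UNIV}" "(\<Pi>\<^sub>E i\<in>UNIV. X i) \<subseteq> U"
    using product_topology_open_contains_basis[OF assms(1)[unfolded open_fun_def] assms(2)]
    by auto
  obtain n where n: "\<forall>i\<in>{i. X i \<noteq> UNIV}. i < n"
    using X(2) finite_nat_set_iff_bounded by blast
  have "cyl (init_seg n x) \<subseteq> (\<Pi>\<^sub>E i\<in>UNIV. X i)"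
  proof
    fix y assume y: "y \<in> cyl (init_seg n x)"
    have "y i \<in> X i" for i
    proof (cases "i < n")
      case True
      then have "y i = x i" using y by (simp add: mem_cyl_iff)
      then show ?thesis using X(1) by auto
    next
      case False
      then have "X i = UNIV" using n by auto
      then show ?thesis by simp
    qed
    then show "y \<in> (\<Pi>\<^sub>E i\<in>UNIV. X i)" by auto
  qed
  then show ?thesis using X(3) by blast
qed

lemma closed_contains_limit:
  assumes "closed C" "\<And>n. cyl (init_seg n x) \<inter> C \<noteq> {}"
  shows "x \<in> C"
  using open_contains_cyl[of "- C" x] assms by (auto simp: closed_def)

lemma closed_cyl: "closed (cyl s)"
proof -
  have "open (- cyl s)"
  proof (subst open_subopen, intro ballI)
    fix x assume "x \<in> - cyl s"
    then have "cyl (init_seg (length s) x) \<subseteq> - cyl s"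
      by (auto simp: mem_cyl_iff)
    then show "\<exists>U. open U \<and> x \<in> U \<and> U \<subseteq> - cyl s"
      by (intro exI[of _ "cyl (init_seg (length s) x)"]) (simp add: open_cyl)
  qed
  then show ?thesis by (simp add: closed_def)
qed

lemma compact_cantor: "compact (UNIV :: (nat \<Rightarrow> bit) set)"
proof -
  have "compact_space (euclidean :: bit topology)"
    by (simp add: compact_space_def finite_imp_compact)
  then have "compact_space (product_topology (\<lambda>i :: nat. euclidean :: bit topology) UNIV)"
    by (subst compact_space_product_topology) simp
  then show ?thesis
    by (simp add: euclidean_product_topology compact_space_def)
qed

lemma continuous_on_cantor_add:
  "continuous_on UNIV (\<lambda>p :: (nat \<Rightarrow> bit) \<times> (nat \<Rightarrow> bit). fst p + snd p)"
proof (rule continuous_on_coordinatewise_then_product)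
  fix i :: nat
  have "open ((\<lambda>p :: (nat \<Rightarrow> bit) \<times> (nat \<Rightarrow> bit). (fst p + snd p) i) -` A)" for A
    unfolding open_prod_def
  proof (intro ballI)
    fix p :: "(nat \<Rightarrow> bit) \<times> (nat \<Rightarrow> bit)"
    assume p: "p \<in> (\<lambda>p. (fst p + snd p) i) -` A"
    let ?n = "Suc i"
    have "cyl (init_seg ?n (fst p)) \<times> cyl (init_seg ?n (snd p)) \<subseteq> (\<lambda>p. (fst p + snd p) i) -` A"
      using p by (auto simp: mem_cyl_iff)
    then show "\<exists>U V. open U \<and> open V \<and> p \<in> U \<times> V \<and> U \<times> V \<subseteq> (\<lambda>p. (fst p + snd p) i) -` A"
      by (intro exI[of _ "cyl (init_seg ?n (fst p))"] exI[of _ "cyl (init_seg ?n (snd p))"])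
        (auto simp: open_cyl mem_Times_iff)
  qed
  then show "continuous_on UNIV (\<lambda>p :: (nat \<Rightarrow> bit) \<times> (nat \<Rightarrow> bit). (fst p + snd p) i)"
    by (simp add: continuous_on_open_vimage)
qed

lemma closed_branches: "closed (branches T)"
proof -
  have "open (- branches T)"
  proof (subst open_subopen, intro ballI)
    fix x assume "x \<in> - branches T"
    then obtain n where n: "init_seg n x \<notin> T" by (auto simp: branches_def)
    have "cyl (init_seg n x) \<subseteq> - branches T"
    proof
      fix y assume "y \<in> cyl (init_seg n x)"
      then have "init_seg n y = init_seg n x" using init_seg_eq[of y "init_seg n x" n] by simp
      with n show "y \<in> - branches T" by (metis (mono_tags) ComplI branches_def mem_Collect_eq)
    qed
    then show "\<exists>U. open U \<and> x \<in> U \<and> U \<subseteq> - branches T"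
      by (intro exI[of _ "cyl (init_seg n x)"]) (simp add: open_cyl)
  qed
  then show ?thesis by (simp add: closed_def)
qed

text \<open>
  This is where compactness enters: since \<open>d + x = y\<close> and \<open>d = x + y\<close> are equivalent, the set is
  the image of \<open>K \<times> L\<close> under addition.
\<close>

lemma closed_sums:
  assumes "closed K" "closed (L :: (nat \<Rightarrow> bit) set)"
  shows "closed {d. \<exists>x\<in>K. d + x \<in> L}"
proof -
  have "compact K" "compact L"
    using assms compact_cantor by (metis compact_Int_closed Int_UNIV_left)+
  then have "compact ((\<lambda>p. fst p + snd p) ` (K \<times> L))"
    by (intro compact_continuous_image compact_Times)
      (auto intro: continuous_on_subset[OF continuous_on_cantor_add])
  then have "closed ((\<lambda>p. fst p + snd p) ` (K \<times> L))"
    by (rule compact_imp_closed)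
  also have "(\<lambda>p. fst p + snd p) ` (K \<times> L) = {d. \<exists>x\<in>K. d + x \<in> L}"
  proof (intro equalityI subsetI)
    fix d assume "d \<in> (\<lambda>p. fst p + snd p) ` (K \<times> L)"
    then obtain x y where "x \<in> K" "y \<in> L" "d = x + y" by auto
    then show "d \<in> {d. \<exists>x\<in>K. d + x \<in> L}"
      by (auto intro!: bexI[of _ x] simp: ac_simps)
  next
    fix d assume "d \<in> {d. \<exists>x\<in>K. d + x \<in> L}"
    then obtain x where "x \<in> K" "d + x \<in> L" by auto
    then show "d \<in> (\<lambda>p. fst p + snd p) ` (K \<times> L)"
      by (intro image_eqI[of _ _ "(x, d + x)"]) (auto simp: ac_simps)
  qed
  finally show ?thesis .
qed

text \<open>
  The Baire category argument, run on pairs of nodes.  If no \<open>Z k\<close> contained the sums from a product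
  of two pieces of \<open>P\<close>, one could shrink the two nodes infinitely often and avoid the \<open>n\<close>-th set \<open>Z\<close>
  at step \<open>n\<close>; the sum of the two points in the limit would then lie in none of these sets.
\<close>

lemma baire_rectangle:
  fixes P :: "(nat \<Rightarrow> bit) set" and Z :: "'k \<Rightarrow> (nat \<Rightarrow> bit) set"
  assumes "closed P" "P \<inter> cyl s \<noteq> {}" "P \<inter> cyl t \<noteq> {}"
    and K: "countable K" "\<And>k. k \<in> K \<Longrightarrow> closed (Z k)"
    and cover: "\<And>x y. x \<in> P \<inter> cyl s \<Longrightarrow> y \<in> P \<inter> cyl t \<Longrightarrow> \<exists>k\<in>K. x + y \<in> Z k"
  shows "\<exists>k\<in>K. \<exists>s' t'. prefix s s' \<and> prefix t t' \<and> P \<inter> cyl s' \<noteq> {} \<and> P \<inter> cyl t' \<noteq> {} \<and>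
           (\<forall>x\<in>P \<inter> cyl s'. \<forall>y\<in>P \<inter> cyl t'. x + y \<in> Z k)"
proof (rule ccontr)
  assume neg: "\<not> ?thesis"
  define good where "good = (\<lambda>q. prefix s (fst q) \<and> prefix t (snd q) \<and>
    P \<inter> cyl (fst q) \<noteq> {} \<and> P \<inter> cyl (snd q) \<noteq> {})"
  have "K \<noteq> {}" using assms(2,3) cover by blast
  then obtain e :: "nat \<Rightarrow> 'k" where e: "range e = K"
    using K(1) by (metis uncountable_def)
  have step: "\<exists>q. good q \<and> prefix (fst p) (fst q) \<and> prefix (snd p) (snd q) \<and>
      n < length (fst q) \<and> n < length (snd q) \<and>
      (\<forall>x\<in>cyl (fst q). \<forall>y\<in>cyl (snd q). x + y \<notin> Z (e n))"
    if "good p" for p n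
  proof -
    obtain s' t' where p: "p = (s', t')" by (cases p)
    have "e n \<in> K" using e by auto
    with that neg obtain x y where xy: "x \<in> P \<inter> cyl s'" "y \<in> P \<inter> cyl t'" "x + y \<notin> Z (e n)"
      unfolding p good_def fst_conv snd_conv by blast
    have "open (- Z (e n))" using K(2) \<open>e n \<in> K\<close> by auto
    then obtain m where m: "cyl (init_seg m (x + y)) \<subseteq> - Z (e n)"
      using open_contains_cyl xy(3) by blast
    \<comment> \<open>long enough to decide that the sum avoids the \<open>n\<close>-th set, to extend both nodes, and to make
      the lengths tend to infinity\<close>
    define N where "N = Suc (m + n + length s' + length t')"
    have "x' + y' \<notin> Z (e n)" if "x' \<in> cyl (init_seg N x)" "y' \<in> cyl (init_seg N y)" for x' y'
    proof -
      have "x' + y' \<in> cyl (init_seg m (x + y))"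
        using that by (simp add: mem_cyl_iff N_def)
      then show ?thesis using m by auto
    qed
    moreover have "prefix s' (init_seg N x)" "prefix t' (init_seg N y)"
      using xy by (auto intro!: prefix_init_seg simp: N_def)
    moreover have "good (init_seg N x, init_seg N y)"
      using that xy calculation(2,3) unfolding good_def p fst_conv snd_conv
      by (auto intro: prefix_order.trans)
    ultimately show ?thesis
      by (intro exI[of _ "(init_seg N x, init_seg N y)"]) (auto simp: p N_def)
  qed
  have "good (s, t)" using assms by (simp add: good_def)
  then obtain p where p: "\<And>n. good (p n)"
    "\<And>n. prefix (fst (p n)) (fst (p (Suc n))) \<and> prefix (snd (p n)) (snd (p (Suc n))) \<and>
      n < length (fst (p (Suc n))) \<and> n < length (snd (p (Suc n))) \<and>
      (\<forall>x\<in>cyl (fst (p (Suc n))). \<forall>y\<in>cyl (snd (p (Suc n))). x + y \<notin> Z (e n))"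
    using dependent_nat_choice[of "\<lambda>_. good"
      "\<lambda>n p q. prefix (fst p) (fst q) \<and> prefix (snd p) (snd q) \<and>
        n < length (fst q) \<and> n < length (snd q) \<and>
        (\<forall>x\<in>cyl (fst q). \<forall>y\<in>cyl (snd q). x + y \<notin> Z (e n))"] step by metis
  have lim: "\<exists>x\<in>P. \<forall>n. x \<in> cyl (q n)"
    if q: "\<And>n. prefix (q n) (q (Suc n))" "\<And>n. n < length (q (Suc n))" "\<And>n. P \<inter> cyl (q n) \<noteq> {}"
    for q :: "nat \<Rightarrow> bit list"
  proof -
    have mono: "prefix (q m) (q n)" if "m \<le> n" for m n
      using that by (induction rule: dec_induct) (auto intro: prefix_order.trans q(1))
    define x where "x i = q (Suc i) ! i" for i
    have x: "x \<in> cyl (q n)" for n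
      unfolding mem_cyl_iff
    proof (intro allI impI)
      fix i assume "i < length (q n)"
      then show "q n ! i = x i"
        using prefix_nthD[OF mono[of n "Suc i"], of i] prefix_nthD[OF mono[of "Suc i" n], of i] q(2)[of i]
        by (cases "n \<le> Suc i") (auto simp: x_def)
    qed
    have "x \<in> P"
    proof (rule closed_contains_limit[OF assms(1)])
      fix n
      obtain y where y: "y \<in> P" "y \<in> cyl (q (Suc n))" using q(3) by blast
      have "y \<in> cyl (init_seg n x)"
        using y(2) x[of "Suc n"] q(2)[of n] by (auto simp: mem_cyl_iff)
      then show "cyl (init_seg n x) \<inter> P \<noteq> {}" using y by blast
    qed
    then show ?thesis using x by blast
  qed
  have "\<exists>x\<in>P. \<forall>n. x \<in> cyl (fst (p n))"
    by (rule lim) (use p in \<open>auto simp: good_def\<close>)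
  moreover have "\<exists>y\<in>P. \<forall>n. y \<in> cyl (snd (p n))"
    by (rule lim) (use p in \<open>auto simp: good_def\<close>)
  ultimately obtain x y where xy: "x \<in> P" "y \<in> P" "\<And>n. x \<in> cyl (fst (p n))" "\<And>n. y \<in> cyl (snd (p n))"
    by blast
  have "prefix s (fst (p 0))" "prefix t (snd (p 0))"
    using p(1)[of 0] by (auto simp: good_def)
  then have "x \<in> cyl s" "y \<in> cyl t" using xy cyl_mono by blast+
  then obtain k where "k \<in> K" "x + y \<in> Z k" using cover xy by blast
  then obtain n where "x + y \<in> Z (e n)" using e by blast
  then show False using p(2)[of n] xy by blast
qed

section \<open>Patterns of finitely many pairs of branches\<close>

text \<open>
  An arm \<open>(h, g)\<close> stands for a branch of \<open>T h\<close> that passes through the node \<open>g\<close>.  A pattern lists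
  pairs of arms; it is meant to be realized by pairs of branches all of which have the same sum.  As
  lists of finite objects, patterns form a countable type, which the Baire argument requires.
\<close>

type_synonym arm = "nat \<times> bit list"
type_synonym pattern = "(arm \<times> arm) list"

definition tips :: "(nat \<Rightarrow> bit list set) \<Rightarrow> arm \<Rightarrow> (nat \<Rightarrow> bit) set" where
  "tips T k = branches (T (fst k)) \<inter> cyl (snd k)"

text \<open>
  Only the sum of the points \<open>F \<eta>\<close> and \<open>F \<nu>\<close> matters for the equation \<open>F \<eta> + G = F \<nu> + G'\<close>: it says
  that \<open>G' = d + G\<close> for \<open>d = F \<eta> + F \<nu>\<close>.
\<close>

definition realized :: "(nat \<Rightarrow> bit list set) \<Rightarrow> pattern \<Rightarrow> (nat \<Rightarrow> bit) set" where
  "realized T ps = {d. \<forall>e\<in>set ps. \<exists>x\<in>tips T (fst e). d + x \<in> tips T (snd e)}"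

definition admissible :: "nat \<Rightarrow> nat \<Rightarrow> pattern \<Rightarrow> bool" where
  "admissible \<iota> n ps \<longleftrightarrow> length ps = \<iota> \<and>
     (\<forall>e\<in>set ps. length (snd (fst e)) = n \<and> length (snd (snd e)) = n) \<and>
     distinct (map (snd \<circ> fst) ps @ map (snd \<circ> snd) ps)"

text \<open>
  Passage from the pattern of a pair \<open>(\<eta>, \<nu>)\<close> to the pattern of \<open>(\<nu>, \<eta>)\<close>.
\<close>

definition flip :: "pattern \<Rightarrow> pattern" where
  "flip ps = map prod.swap ps"

definition pattern_refines :: "pattern \<Rightarrow> pattern \<Rightarrow> bool" where
  "pattern_refines ps qs \<longleftrightarrow> list_all2 (\<lambda>e e'.
     fst (fst e') = fst (fst e) \<and> prefix (snd (fst e)) (snd (fst e')) \<and>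
     fst (snd e') = fst (snd e) \<and> prefix (snd (snd e)) (snd (snd e'))) ps qs"

lemma flip_flip [simp]: "flip (flip ps) = ps"
  by (simp add: flip_def comp_def)

lemma admissible_flip [simp]: "admissible \<iota> n (flip ps) \<longleftrightarrow> admissible \<iota> n ps"
  by (auto simp: admissible_def flip_def comp_def)

lemma pattern_refines_flip: "pattern_refines ps qs \<Longrightarrow> pattern_refines (flip ps) (flip qs)"
  by (auto simp: pattern_refines_def flip_def list_all2_conv_all_nth)

lemma closed_realized: "closed (realized T ps)"
proof -
  have "realized T ps = (\<Inter>e\<in>set ps. {d. \<exists>x\<in>tips T (fst e). d + x \<in> tips T (snd e)})"
    by (auto simp: realized_def)
  moreover have "closed (tips T k)" for k
    unfolding tips_def by (intro closed_Int closed_branches closed_cyl)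
  ultimately show ?thesis
    by (simp only:) (intro closed_INT ballI closed_sums, auto)
qed

lemma realized_flip [simp]: "realized T (flip ps) = realized T ps"
proof -
  have "realized T ps \<subseteq> realized T (flip ps)" for ps
  proof
    fix d assume d: "d \<in> realized T ps"
    show "d \<in> realized T (flip ps)"
      unfolding realized_def mem_Collect_eq
    proof
      fix e assume "e \<in> set (flip ps)"
      then have "prod.swap e \<in> set ps" by (auto simp: flip_def)
      then obtain x where "x \<in> tips T (snd e)" "d + x \<in> tips T (fst e)"
        using d unfolding realized_def by force
      then show "\<exists>x\<in>tips T (fst e). d + x \<in> tips T (snd e)"
        by (intro bexI[of _ "d + x"]) auto
    qed
  qed
  from this[of ps] this[of "flip ps"] show ?thesis by auto
qed

lemma distinct_map_take:
  assumes "distinct xs" "list_all2 (\<lambda>x y. prefix x y \<and> length x = n) xs ys"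
  shows "distinct ys"
proof -
  have "map (take n) ys = xs"
    using assms(2) by (auto simp: list_all2_conv_all_nth prefix_def intro!: nth_equalityI)
  then show ?thesis using assms(1) distinct_map by metis
qed

text \<open>
  Replace the nodes of \<open>ps\<close> by longer initial segments of the realizing branches; these are distinct
  because their restrictions to \<open>m\<close>, the nodes of \<open>ps\<close>, are.
\<close>

lemma realized_refine:
  assumes d: "d \<in> realized T ps" and ps: "admissible \<iota> m ps" and "m \<le> n"
  shows "\<exists>qs. admissible \<iota> n qs \<and> pattern_refines ps qs \<and> d \<in> realized T qs"
proof -
  obtain x where x: "\<And>e. e \<in> set ps \<Longrightarrow> x e \<in> tips T (fst e) \<and> d + x e \<in> tips T (snd e)"
    using d unfolding realized_def by (simp add: Bex_def) metis
  define ext where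
    "ext e = ((fst (fst e), init_seg n (x e)), (fst (snd e), init_seg n (d + x e)))" for e
  have len: "length (snd (fst e)) = m" "length (snd (snd e)) = m" if "e \<in> set ps" for e
    using ps that by (auto simp: admissible_def)
  have pre: "prefix (snd (fst e)) (init_seg n (x e))" "prefix (snd (snd e)) (init_seg n (d + x e))"
    if "e \<in> set ps" for e
    using x[OF that] len[OF that] \<open>m \<le> n\<close> by (auto simp: tips_def intro!: prefix_init_seg)
  have "pattern_refines ps (map ext ps)"
    unfolding pattern_refines_def by (auto simp: list_all2_conv_all_nth ext_def pre)
  moreover have "d \<in> realized T (map ext ps)"
    unfolding realized_def using x by (auto simp: ext_def tips_def intro!: bexI)
  moreover have "distinct (map (snd \<circ> fst) (map ext ps) @ map (snd \<circ> snd) (map ext ps))"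
  proof (rule distinct_map_take[where n = m])
    show "distinct (map (snd \<circ> fst) ps @ map (snd \<circ> snd) ps)"
      using ps by (simp add: admissible_def)
    show "list_all2 (\<lambda>x y. prefix x y \<and> length x = m) (map (snd \<circ> fst) ps @ map (snd \<circ> snd) ps)
      (map (snd \<circ> fst) (map ext ps) @ map (snd \<circ> snd) (map ext ps))"
      by (intro list_all2_appendI)
        (auto simp: list_all2_conv_all_nth ext_def pre len)
  qed
  then have "admissible \<iota> n (map ext ps)"
    using ps by (auto simp: admissible_def ext_def)
  ultimately show ?thesis by blast
qed

lemma ex_inj_on_init_seg:
  assumes "finite (A :: (nat \<Rightarrow> bit) set)"
  shows "\<exists>n. inj_on (init_seg n) A"
proof -
  have "\<exists>i. x i \<noteq> y i" if "x \<noteq> y" for x y :: "nat \<Rightarrow> bit" using that by auto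
  then obtain i where i: "\<And>x y :: nat \<Rightarrow> bit. x \<noteq> y \<Longrightarrow> x (i x y) \<noteq> y (i x y)" by metis
  have "finite ((\<lambda>(x, y). i x y) ` (A \<times> A))" using assms by simp
  then obtain n where "\<forall>k\<in>(\<lambda>(x, y). i x y) ` (A \<times> A). k < n"
    using finite_nat_set_iff_bounded by blast
  then have n: "i x y < n" if "x \<in> A" "y \<in> A" for x y using that by auto
  have "inj_on (init_seg n) A"
  proof (rule inj_onI, rule ccontr)
    fix x y assume "x \<in> A" "y \<in> A" "init_seg n x = init_seg n y" "x \<noteq> y"
    then show False using n[of x y] i[of x y] by (metis nth_init_seg)
  qed
  then show ?thesis ..
qed

text \<open>
  The orbits are chosen greedily: \<open>j < k\<close> orbits of the involution \<open>\<sigma>\<close> cover only \<open>2 * j\<close> points.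
\<close>

lemma ex_orbit_representatives:
  assumes X: "|{..<2 * k}| \<le>o |X|"
    and \<sigma>: "\<And>x. x \<in> X \<Longrightarrow> \<sigma> x \<noteq> x" "\<And>x. x \<in> X \<Longrightarrow> \<sigma> (\<sigma> x) = x"
  shows "\<exists>xs. length xs = k \<and> set xs \<subseteq> X \<and> distinct (xs @ map \<sigma> xs)"
proof -
  have "\<exists>xs. length xs = j \<and> set xs \<subseteq> X \<and> distinct (xs @ map \<sigma> xs)" if "j \<le> k" for j
    using that
  proof (induction j)
    case (Suc j)
    then obtain xs where xs: "length xs = j" "set xs \<subseteq> X" "distinct (xs @ map \<sigma> xs)"
      by auto
    have "card (set (xs @ map \<sigma> xs)) < 2 * k"
      using xs(1,3) Suc.prems distinct_card[OF xs(3)] by simp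
    then have "\<not> X \<subseteq> set (xs @ map \<sigma> xs)"
      using X card_of_ordLeq[of "{..<2 * k}" X]
      by (metis (no_types, lifting) List.finite_set card_inj_on_le card_lessThan dual_order.trans not_le)
    then obtain x where x: "x \<in> X" "x \<notin> set xs" "x \<notin> \<sigma> ` set xs" by auto
    have "\<sigma> x \<notin> set xs"
    proof
      assume "\<sigma> x \<in> set xs"
      then have "\<sigma> (\<sigma> x) \<in> \<sigma> ` set xs" by blast
      then show False using x \<sigma> by simp
    qed
    moreover have "\<sigma> x \<notin> \<sigma> ` set xs"
    proof
      assume "\<sigma> x \<in> \<sigma> ` set xs"
      then obtain y where y: "y \<in> set xs" "\<sigma> x = \<sigma> y" by auto
      then have "x = y" using \<sigma>(2) x(1) xs(2) by (metis subsetD)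
      then show False using x y by simp
    qed
    ultimately have "distinct ((x # xs) @ map \<sigma> (x # xs))"
      using x xs \<sigma>(1)[of x] by auto
    then show ?case using xs x by (intro exI[of _ "x # xs"]) auto
  qed simp
  then show ?thesis by blast
qed

text \<open>
  The intersection of the two translates is invariant under \<open>z \<mapsto> z + (x + y)\<close>.  A point \<open>z\<close> of it
  yields the branches \<open>x + z\<close> and \<open>y + z\<close>, whose sum is \<open>x + y\<close>, and the other point in the orbit
  of \<open>z\<close> yields the same branches in the opposite order.  So branches from distinct orbits are
  distinct.
\<close>

lemma overlap_pattern:
  assumes "x \<noteq> y" and B: "B = (\<Union>m. branches (T m))"
    and big: "|{..<2 * \<iota>}| \<le>o |translate x B \<inter> translate y B|"
  shows "\<exists>n ps. admissible \<iota> n ps \<and> x + y \<in> realized T ps"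
proof -
  define \<sigma> where "\<sigma> z = z + (x + y)" for z
  have mem: "z \<in> translate u B \<longleftrightarrow> u + z \<in> B" for u z
    unfolding translate_def by (force intro: image_eqI[of _ _ "u + z"])
  have "\<sigma> z \<noteq> z" for z
    using \<open>x \<noteq> y\<close> cantor_add_eq_iff[of z "x + y" z] cantor_add_eq_iff[of x y 0] by (auto simp: \<sigma>_def)
  moreover have "\<sigma> (\<sigma> z) = z" for z by (simp add: \<sigma>_def ac_simps)
  ultimately obtain zs where zs: "length zs = \<iota>" "set zs \<subseteq> translate x B \<inter> translate y B"
    "distinct (zs @ map \<sigma> zs)"
    using ex_orbit_representatives[OF big, of \<sigma>] by blast
  have "\<exists>h h'. x + z \<in> branches (T h) \<and> y + z \<in> branches (T h')" if "z \<in> set zs" for z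
    using that zs(2) mem by (auto simp: B)
  then obtain h h' where h: "\<And>z. z \<in> set zs \<Longrightarrow> x + z \<in> branches (T (h z)) \<and> y + z \<in> branches (T (h' z))"
    by metis
  obtain n where n: "inj_on (init_seg n) (set (map ((+) x) (zs @ map \<sigma> zs)))"
    using ex_inj_on_init_seg by blast
  define ps where "ps = map (\<lambda>z. ((h z, init_seg n (x + z)), (h' z, init_seg n (y + z)))) zs"
  have "distinct (map ((+) x) (zs @ map \<sigma> zs))"
    unfolding distinct_map using zs(3) by (auto intro!: inj_onI)
  then have "distinct (map (init_seg n) (map ((+) x) (zs @ map \<sigma> zs)))"
    using n by (simp only: distinct_map)
  moreover have "x + \<sigma> z = y + z" for z
    unfolding \<sigma>_def by (metis add.commute add.left_commute cantor_add_cancel)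
  ultimately have "admissible \<iota> n ps"
    using zs(1) by (auto simp: admissible_def ps_def comp_def)
  moreover have "x + y \<in> realized T ps"
    unfolding realized_def
  proof (clarify, goal_cases)
    case (1 a b c d)
    then obtain z where z: "z \<in> set zs" "a = h z" "b = init_seg n (x + z)" "c = h' z" "d = init_seg n (y + z)"
      by (auto simp: ps_def)
    have "x + y + (x + z) = y + z" by (metis add.commute add.left_commute cantor_add_cancel)
    then show ?case using z h by (intro bexI[of _ "x + z"]) (auto simp: tips_def)
  qed
  ultimately show ?thesis by blast
qed

section \<open>Configurations realized on open pieces of a perfect set\<close>

text \<open>
  A configuration that is realized uniformly on open pieces of \<open>P\<close>.  The elements of \<open>A\<close> are names
  for its nodes; names are used since the nodes themselves change when they are prolonged.  The
  node named \<open>a\<close> is the restriction of \<open>s a\<close> to \<open>n\<close>, and \<open>s a\<close> may be longer, so that the piece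
  \<open>P \<inter> cyl (s a)\<close> can be shrunk while the configuration stays the same.  Every pair of points from
  two different pieces realizes the pattern \<open>c a b\<close>.
\<close>

definition scheme ::
  "(nat \<Rightarrow> bit list set) \<Rightarrow> nat \<Rightarrow> (nat \<Rightarrow> bit) set \<Rightarrow> nat set \<Rightarrow> nat \<Rightarrow>
   (nat \<Rightarrow> bit list) \<Rightarrow> (nat \<Rightarrow> nat \<Rightarrow> pattern) \<Rightarrow> bool" where
  "scheme T \<iota> P A n s c \<longleftrightarrow>
     finite A \<and> A \<noteq> {} \<and> (\<forall>a\<in>A. n \<le> length (s a) \<and> P \<inter> cyl (s a) \<noteq> {}) \<and>
     inj_on (\<lambda>a. take n (s a)) A \<and>
     (\<forall>a\<in>A. \<forall>b\<in>A. a \<noteq> b \<longrightarrow> admissible \<iota> n (c a b) \<and> c b a = flip (c a b) \<and>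
        (\<forall>x\<in>P \<inter> cyl (s a). \<forall>y\<in>P \<inter> cyl (s b). x + y \<in> realized T (c a b)))"

definition represents ::
  "nat \<Rightarrow> config \<Rightarrow> nat set \<Rightarrow> nat \<Rightarrow> (nat \<Rightarrow> bit list) \<Rightarrow> (nat \<Rightarrow> nat \<Rightarrow> pattern) \<Rightarrow> bool" where
  "represents \<iota> m A n s c \<longleftrightarrow>
     cfg_l m = n \<and> cfg_u m = (\<lambda>a. take n (s a)) ` A \<and>
     (\<forall>a\<in>A. \<forall>b\<in>A. a \<noteq> b \<longrightarrow> (\<forall>i<\<iota>.
        cfg_h m i (take n (s a)) (take n (s b)) = fst (fst (c a b ! i)) \<and>
        cfg_g m i (take n (s a)) (take n (s b)) = snd (fst (c a b ! i))))"

lemma ex_represents: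
  assumes "inj_on (\<lambda>a. take n (s a)) A"
  shows "\<exists>m. represents \<iota> m A n s c"
proof -
  define inv where "inv = inv_into A (\<lambda>a. take n (s a))"
  have inv: "inv (take n (s a)) = a" if "a \<in> A" for a
    unfolding inv_def by (rule inv_into_f_f[OF assms that])
  show ?thesis
    by (rule exI[of _ "\<lparr>cfg_l = n, cfg_u = (\<lambda>a. take n (s a)) ` A,
        cfg_h = (\<lambda>i \<eta> \<nu>. fst (fst (c (inv \<eta>) (inv \<nu>) ! i))),
        cfg_g = (\<lambda>i \<eta> \<nu>. snd (fst (c (inv \<eta>) (inv \<nu>) ! i)))\<rparr>"])
      (auto simp: represents_def inv)
qed

lemma ladd_eq_iff:
  assumes "length a = n" "length b = n" "length c = n" "length d = n"
  shows "ladd a b = ladd c d \<longleftrightarrow> (\<forall>i<n. a ! i + b ! i = c ! i + d ! i)"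
  using assms by (auto simp: ladd_def list_eq_iff_nth_eq)

text \<open>
  Any choice of points in the pieces serves as \<open>F\<close> in the last clause of the definition of
  \<open>configs\<close>.  The branches for \<open>(a, b)\<close> and for \<open>(b, a)\<close> determine each other by the equation that
  they have to satisfy; so those with \<open>a < b\<close> are chosen and the others are computed.
\<close>

lemma scheme_config:
  assumes sch: "scheme T \<iota> P A n s c" and rep: "represents \<iota> m A n s c"
    and "0 < n" "2 \<le> card A"
  shows "m \<in> configs \<iota> T"
proof -
  define e where "e a = take n (s a)" for a
  have inj: "inj_on e A" using sch by (simp add: scheme_def e_def[abs_def])
  have u: "cfg_u m = e ` A" and l: "cfg_l m = n" using rep by (auto simp: represents_def e_def)
  have h: "cfg_h m i (e a) (e b) = fst (fst (c a b ! i))"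
    and g: "cfg_g m i (e a) (e b) = snd (fst (c a b ! i))"
    if "a \<in> A" "b \<in> A" "a \<noteq> b" "i < \<iota>" for a b i
    using rep that by (auto simp: represents_def e_def)
  have len_e: "length (e a) = n" if "a \<in> A" for a using sch that by (auto simp: scheme_def e_def)
  have off: "offdiag (e ` A) = {(e a, e b) | a b. a \<in> A \<and> b \<in> A \<and> a \<noteq> b}"
    using inj by (auto simp: offdiag_def inj_on_def)
  have pair: "admissible \<iota> n (c a b)" "c b a = flip (c a b)"
    "\<And>x y. x \<in> P \<inter> cyl (s a) \<Longrightarrow> y \<in> P \<inter> cyl (s b) \<Longrightarrow> x + y \<in> realized T (c a b)"
    if "a \<in> A" "b \<in> A" "a \<noteq> b" for a b
    using sch that unfolding scheme_def by blast+
  have adm: "length (c a b) = \<iota>" "\<And>k. k \<in> set (c a b) \<Longrightarrow> length (snd (fst k)) = n"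
    "\<And>k. k \<in> set (c a b) \<Longrightarrow> length (snd (snd k)) = n"
    "distinct (map (snd \<circ> fst) (c a b) @ map (snd \<circ> snd) (c a b))"
    if "a \<in> A" "b \<in> A" "a \<noteq> b" for a b
    using pair(1)[OF that] by (auto simp: admissible_def)
  have swap: "c b a ! i = prod.swap (c a b ! i)" if "a \<in> A" "b \<in> A" "a \<noteq> b" "i < \<iota>" for a b i
    using pair(2)[OF that(1-3)] adm(1)[OF that(1-3)] that(4) by (simp add: flip_def)
  have "\<forall>a\<in>A. \<exists>x. x \<in> P \<inter> cyl (s a)"
    using sch unfolding scheme_def by blast
  then obtain F where F: "\<And>a. a \<in> A \<Longrightarrow> F a \<in> P \<inter> cyl (s a)"
    by metis
  have "\<exists>x\<in>tips T (fst (c a b ! i)). F a + F b + x \<in> tips T (snd (c a b ! i))"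
    if "a \<in> A" "b \<in> A" "a \<noteq> b" "i < \<iota>" for a b i
  proof -
    have "F a + F b \<in> realized T (c a b)" using pair(3) that F by blast
    moreover have "c a b ! i \<in> set (c a b)" using adm(1)[OF that(1-3)] that(4) by simp
    ultimately show ?thesis by (simp add: realized_def)
  qed
  then obtain x where x: "\<And>a b i. a \<in> A \<Longrightarrow> b \<in> A \<Longrightarrow> a \<noteq> b \<Longrightarrow> i < \<iota> \<Longrightarrow>
      x a b i \<in> tips T (fst (c a b ! i)) \<and> F a + F b + x a b i \<in> tips T (snd (c a b ! i))"
    by metis
  define G where "G i a b = (if a < b then x a b i else F b + F a + x b a i)" for i and a b :: nat
  have G: "G i a b \<in> tips T (fst (c a b ! i))" "F a + G i a b = F b + G i b a"
    if "a \<in> A" "b \<in> A" "a \<noteq> b" "i < \<iota>" for a b i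
  proof -
    show "G i a b \<in> tips T (fst (c a b ! i))"
    proof (cases "a < b")
      case False
      then show ?thesis using x[of b a i] swap[of b a i] that by (auto simp: G_def)
    qed (use x that in \<open>simp add: G_def\<close>)
    show "F a + G i a b = F b + G i b a"
      using that(3) cantor_add_cancel by (auto simp: G_def ac_simps)
  qed
  have g': "cfg_g m i (e a) (e b) \<in> T (cfg_h m i (e a) (e b))"
    "length (cfg_g m i (e a) (e b)) = n" "G i a b \<in> cyl (cfg_g m i (e a) (e b))"
    "G i a b \<in> branches (T (cfg_h m i (e a) (e b)))"
    if "a \<in> A" "b \<in> A" "a \<noteq> b" "i < \<iota>" for a b i
  proof -
    have "c a b ! i \<in> set (c a b)" using adm(1)[OF that(1-3)] that(4) by simp
    then show len: "length (cfg_g m i (e a) (e b)) = n" using adm(2) that g by simp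
    show cyl: "G i a b \<in> cyl (cfg_g m i (e a) (e b))"
      and br: "G i a b \<in> branches (T (cfg_h m i (e a) (e b)))"
      using G(1)[OF that] g[OF that] h[OF that] by (simp_all add: tips_def)
    have "init_seg n (G i a b) = cfg_g m i (e a) (e b)"
      using init_seg_eq[OF cyl, of n] len by simp
    then show "cfg_g m i (e a) (e b) \<in> T (cfg_h m i (e a) (e b))"
      using br by (metis (mono_tags, lifting) branches_def mem_Collect_eq)
  qed
  have Fe: "F a \<in> cyl (e a)" if "a \<in> A" for a
    using F[OF that] cyl_take by (auto simp: e_def)
  define inv where "inv = inv_into A e"
  have inv: "inv (e a) = a" if "a \<in> A" for a
    unfolding inv_def by (rule inv_into_f_f[OF inj that])
  have 1: "\<forall>i<\<iota>. cfg_g m i (e a) (e b) \<in> T (cfg_h m i (e a) (e b)) \<and> length (cfg_g m i (e a) (e b)) = n"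
    and 2: "\<forall>i<\<iota>. ladd (e a) (cfg_g m i (e a) (e b)) = ladd (e b) (cfg_g m i (e b) (e a))"
    and 3: "distinct (map (\<lambda>i. cfg_g m i (e a) (e b)) [0..<\<iota>] @ map (\<lambda>i. cfg_g m i (e b) (e a)) [0..<\<iota>])"
    if ab: "a \<in> A" "b \<in> A" "a \<noteq> b" for a b
  proof -
    show "\<forall>i<\<iota>. cfg_g m i (e a) (e b) \<in> T (cfg_h m i (e a) (e b)) \<and> length (cfg_g m i (e a) (e b)) = n"
      using g' ab by blast
    show "\<forall>i<\<iota>. ladd (e a) (cfg_g m i (e a) (e b)) = ladd (e b) (cfg_g m i (e b) (e a))"
    proof (intro allI impI)
      fix i assume i: "i < \<iota>"
      have "e a ! j + cfg_g m i (e a) (e b) ! j = e b ! j + cfg_g m i (e b) (e a) ! j" if "j < n" for j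
      proof -
        have "(F a + G i a b) j = (F b + G i b a) j" using G(2)[OF ab i] by simp
        then show ?thesis
          using Fe[OF ab(1)] Fe[OF ab(2)] g'(2,3)[OF ab i] g'(2,3)[OF ab(2,1) ab(3)[symmetric] i]
            len_e ab that by (simp add: mem_cyl_iff)
      qed
      then show "ladd (e a) (cfg_g m i (e a) (e b)) = ladd (e b) (cfg_g m i (e b) (e a))"
        using ladd_eq_iff[of _ n] len_e ab g'(2)[OF ab i] g'(2)[OF ab(2,1) ab(3)[symmetric] i] by simp
    qed
    have "map (\<lambda>i. cfg_g m i (e a) (e b)) [0..<\<iota>] = map (snd \<circ> fst) (c a b)"
      using ab adm(1)[OF ab] g by (intro nth_equalityI) auto
    moreover have "cfg_g m i (e b) (e a) = snd (snd (c a b ! i))" if "i < \<iota>" for i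
      using g[OF ab(2,1) ab(3)[symmetric] that] swap[OF ab that] by simp
    then have "map (\<lambda>i. cfg_g m i (e b) (e a)) [0..<\<iota>] = map (snd \<circ> snd) (c a b)"
      by (intro nth_equalityI) (auto simp: adm(1)[OF ab])
    ultimately show "distinct (map (\<lambda>i. cfg_g m i (e a) (e b)) [0..<\<iota>] @
        map (\<lambda>i. cfg_g m i (e b) (e a)) [0..<\<iota>])"
      using adm(4)[OF ab] by simp
  qed
  have 4: "\<exists>(F :: bit list \<Rightarrow> nat \<Rightarrow> bit) (G :: nat \<Rightarrow> bit list \<Rightarrow> bit list \<Rightarrow> nat \<Rightarrow> bit).
      (\<forall>\<eta>\<in>e ` A. seg_of \<eta> (F \<eta>)) \<and>
      (\<forall>(\<eta>, \<nu>)\<in>offdiag (e ` A). \<forall>i<\<iota>.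
         seg_of (cfg_g m i \<eta> \<nu>) (G i \<eta> \<nu>) \<and>
         G i \<eta> \<nu> \<in> branches (T (cfg_h m i \<eta> \<nu>)) \<and>
         F \<eta> + G i \<eta> \<nu> = F \<nu> + G i \<nu> \<eta>)"
    unfolding off
    by (rule exI[of _ "\<lambda>\<eta>. F (inv \<eta>)"], rule exI[of _ "\<lambda>i \<eta> \<nu>. G i (inv \<eta>) (inv \<nu>)"])
      (use Fe g'(3,4) G(2) in \<open>auto simp: inv cyl_def\<close>)
  have "card (e ` A) \<ge> 2" using inj assms(4) by (simp add: card_image)
  with 1 2 3 4 show ?thesis
    unfolding configs_def mem_Collect_eq u l off
    using \<open>0 < n\<close> len_e by (intro conjI) (auto simp del: distinct_append)
qed

lemma extend_node:
  assumes "P \<inter> cyl s \<noteq> {}"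
  shows "\<exists>t. prefix s t \<and> n \<le> length t \<and> P \<inter> cyl t \<noteq> {}"
proof -
  obtain x where x: "x \<in> P" "x \<in> cyl s" using assms by blast
  then show ?thesis
    by (intro exI[of _ "init_seg (max n (length s)) x"]) (auto intro!: prefix_init_seg)
qed

text \<open>
  The pairs are treated one after the other.  Shrinking the nodes for one pair preserves what has
  been achieved for the earlier ones.
\<close>

lemma refine_rectangles:
  assumes P: "closed P" and Q: "finite Q" "\<And>a b. (a, b) \<in> Q \<Longrightarrow> a \<noteq> b"
    and s: "\<And>a. P \<inter> cyl (s a) \<noteq> {}"
    and C: "\<And>a b. (a, b) \<in> Q \<Longrightarrow> countable (C a b)"
      "\<And>a b k. (a, b) \<in> Q \<Longrightarrow> k \<in> C a b \<Longrightarrow> closed (Z k)"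
      "\<And>a b x y. (a, b) \<in> Q \<Longrightarrow> x \<in> P \<inter> cyl (s a) \<Longrightarrow> y \<in> P \<inter> cyl (s b) \<Longrightarrow> \<exists>k\<in>C a b. x + y \<in> Z k"
  shows "\<exists>s' k. (\<forall>a. prefix (s a) (s' a) \<and> P \<inter> cyl (s' a) \<noteq> {}) \<and>
    (\<forall>(a, b)\<in>Q. k a b \<in> C a b \<and> (\<forall>x\<in>P \<inter> cyl (s' a). \<forall>y\<in>P \<inter> cyl (s' b). x + y \<in> Z (k a b)))"
  using Q C
proof (induction Q rule: finite_induct)
  case empty
  then show ?case using s by (intro exI[of _ s]) auto
next
  case (insert ab Q)
  obtain a b where ab: "ab = (a, b)" by (cases ab)
  have "\<exists>s' k. (\<forall>a. prefix (s a) (s' a) \<and> P \<inter> cyl (s' a) \<noteq> {}) \<and>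
    (\<forall>(a, b)\<in>Q. k a b \<in> C a b \<and> (\<forall>x\<in>P \<inter> cyl (s' a). \<forall>y\<in>P \<inter> cyl (s' b). x + y \<in> Z (k a b)))"
    by (rule insert.IH) (use insert.prems in blast)+
  then obtain s' k where IH: "\<forall>a. prefix (s a) (s' a) \<and> P \<inter> cyl (s' a) \<noteq> {}"
    "\<forall>(a, b)\<in>Q. k a b \<in> C a b \<and> (\<forall>x\<in>P \<inter> cyl (s' a). \<forall>y\<in>P \<inter> cyl (s' b). x + y \<in> Z (k a b))"
    by blast
  then have s': "\<And>a. prefix (s a) (s' a)" "\<And>a. P \<inter> cyl (s' a) \<noteq> {}"
    and k: "\<And>a b. (a, b) \<in> Q \<Longrightarrow> k a b \<in> C a b"
      "\<And>a b x y. (a, b) \<in> Q \<Longrightarrow> x \<in> P \<inter> cyl (s' a) \<Longrightarrow> y \<in> P \<inter> cyl (s' b) \<Longrightarrow> x + y \<in> Z (k a b)"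
    by auto
  have "a \<noteq> b" using insert.prems(1) ab by blast
  have "\<exists>k\<in>C a b. \<exists>u v. prefix (s' a) u \<and> prefix (s' b) v \<and> P \<inter> cyl u \<noteq> {} \<and> P \<inter> cyl v \<noteq> {} \<and>
           (\<forall>x\<in>P \<inter> cyl u. \<forall>y\<in>P \<inter> cyl v. x + y \<in> Z k)"
  proof (rule baire_rectangle[OF P s'(2) s'(2)])
    fix x y assume "x \<in> P \<inter> cyl (s' a)" "y \<in> P \<inter> cyl (s' b)"
    then have "x \<in> P \<inter> cyl (s a)" "y \<in> P \<inter> cyl (s b)"
      using cyl_mono[OF s'(1)] by blast+
    then show "\<exists>k\<in>C a b. x + y \<in> Z k" using insert.prems(4) ab by blast
  qed (use insert.prems ab in blast)+
  then obtain k' u v where *: "k' \<in> C a b" "prefix (s' a) u" "prefix (s' b) v"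
    "P \<inter> cyl u \<noteq> {}" "P \<inter> cyl v \<noteq> {}" "\<And>x y. x \<in> P \<inter> cyl u \<Longrightarrow> y \<in> P \<inter> cyl v \<Longrightarrow> x + y \<in> Z k'"
    by blast
  define t where "t = s'(a := u, b := v)"
  define k2 where "k2 c d = (if (c, d) = (a, b) then k' else k c d)" for c d
  have t: "prefix (s' c) (t c)" for c
    using * \<open>a \<noteq> b\<close> by (simp add: t_def)
  have "k2 c d \<in> C c d \<and> (\<forall>x\<in>P \<inter> cyl (t c). \<forall>y\<in>P \<inter> cyl (t d). x + y \<in> Z (k2 c d))"
    if "(c, d) \<in> insert ab Q" for c d
  proof (cases "(c, d) = (a, b)")
    case True
    then show ?thesis using * \<open>a \<noteq> b\<close> by (simp add: t_def k2_def)
  next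
    case False
    then have "(c, d) \<in> Q" using that ab by auto
    then show ?thesis
      using k[of c d] cyl_mono[OF t, of c] cyl_mono[OF t, of d] False unfolding k2_def by auto
  qed
  moreover have "prefix (s c) (t c)" "P \<inter> cyl (t c) \<noteq> {}" for c
    using t[of c] s' * prefix_order.trans by (blast, auto simp: t_def)
  ultimately show ?case by (intro exI[of _ t] exI[of _ k2]) blast
qed

text \<open>
  The situation to be refuted when the rank of \<open>T\<close> is bounded.  The overlap of translates is used
  only in the form given by \<open>overlap_pattern\<close>.
\<close>

locale overlapping_perfect_set =
  fixes T :: "nat \<Rightarrow> bit list set" and \<iota> :: nat and P :: "(nat \<Rightarrow> bit) set"
  assumes P: "closed P" "\<And>x. x \<in> P \<Longrightarrow> x islimpt P" "P \<noteq> {}"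
    and ov: "\<And>x y. x \<in> P \<Longrightarrow> y \<in> P \<Longrightarrow> x \<noteq> y \<Longrightarrow> \<exists>n ps. admissible \<iota> n ps \<and> x + y \<in> realized T ps"
begin

text \<open>
  The piece named \<open>a\<close> contains two points, because \<open>P\<close> has no isolated points; separating them
  gives two nodes, named \<open>a\<close> and \<open>new\<close>, and the map \<open>f\<close> tells from which old node a new one comes.
  The pair of \<open>a\<close> and \<open>new\<close> needs a pattern of its own, whose level \<open>m0\<close> the Baire argument
  dictates.  Only after that can the level \<open>n'\<close> of the new scheme be fixed, and then all patterns are
  refined to this level.
\<close>

lemma scheme_split:
  assumes sch: "scheme T \<iota> P A n s c" and "a \<in> A"
  shows "\<exists>A' n' s' c' f. scheme T \<iota> P A' n' s' c' \<and> n < n' \<and> f ` A' = A \<and>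
    (\<forall>x\<in>A'. prefix (s (f x)) (s' x)) \<and>
    (\<forall>x\<in>A'. \<forall>y\<in>A'. f x \<noteq> f y \<longrightarrow> pattern_refines (c (f x) (f y)) (c' x y)) \<and>
    (\<exists>x\<in>A'. \<exists>y\<in>A'. x \<noteq> y \<and> f x = a \<and> f y = a)"
proof -
  have A: "finite A" and inj: "inj_on (\<lambda>a. take n (s a)) A"
    and sA: "\<And>a. a \<in> A \<Longrightarrow> n \<le> length (s a) \<and> P \<inter> cyl (s a) \<noteq> {}"
    using sch unfolding scheme_def by blast+
  have pair: "admissible \<iota> n (c a b)" "c b a = flip (c a b)"
    "\<And>x y. x \<in> P \<inter> cyl (s a) \<Longrightarrow> y \<in> P \<inter> cyl (s b) \<Longrightarrow> x + y \<in> realized T (c a b)"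
    if "a \<in> A" "b \<in> A" "a \<noteq> b" for a b
    using sch that unfolding scheme_def by blast+
  obtain new where new: "new \<notin> A" using A by (metis ex_new_if_finite infinite_UNIV_nat)
  define A' where "A' = insert new A"
  define f where "f x = (if x = new then a else x)" for x
  have fA: "f x \<in> A" if "x \<in> A'" for x using that \<open>a \<in> A\<close> by (auto simp: A'_def f_def)
  have "a \<noteq> new" using new \<open>a \<in> A\<close> by blast
  obtain p where p: "p \<in> P" "p \<in> cyl (s a)" using sA \<open>a \<in> A\<close> by blast
  obtain q where q: "q \<in> P" "q \<in> cyl (s a)" "q \<noteq> p"
    using P(2)[OF p(1)] open_cyl[of "s a"] p(2) by (metis islimptE)
  obtain j where j: "q j \<noteq> p j" using q(3) by auto
  define N where "N = Suc (j + length (s a))"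
  define t0 where "t0 x = (if x = a then init_seg N p else if x = new then init_seg N q
    else if x \<in> A then s x else [])" for x
  have t0: "P \<inter> cyl (t0 x) \<noteq> {}" for x
    using p q sA[of x] by (auto simp: t0_def mem_cyl_iff[of _ "[]"])
  have t0s: "prefix (s (f x)) (t0 x)" if "x \<in> A'" for x
    using p q that by (auto simp: t0_def f_def A'_def N_def intro!: prefix_init_seg)
  have disj: "x \<noteq> y" if "x \<in> cyl (t0 a)" "y \<in> cyl (t0 new)" for x y
    using that j \<open>a \<noteq> new\<close> by (auto simp: t0_def mem_cyl_iff N_def)
  define K where "K = {ps. \<exists>m. admissible \<iota> m ps}"
  have "\<exists>k\<in>K. \<exists>u v. prefix (t0 a) u \<and> prefix (t0 new) v \<and> P \<inter> cyl u \<noteq> {} \<and> P \<inter> cyl v \<noteq> {} \<and>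
      (\<forall>x\<in>P \<inter> cyl u. \<forall>y\<in>P \<inter> cyl v. x + y \<in> realized T k)"
  proof (rule baire_rectangle[OF P(1) t0 t0])
    fix x y assume "x \<in> P \<inter> cyl (t0 a)" "y \<in> P \<inter> cyl (t0 new)"
    then show "\<exists>k\<in>K. x + y \<in> realized T k"
      using ov[of x y] disj[of x y] unfolding K_def by blast
  qed (auto intro: closed_realized)
  then obtain ps m0 u v where ps: "admissible \<iota> m0 ps" and uv: "prefix (t0 a) u" "prefix (t0 new) v"
    "P \<inter> cyl u \<noteq> {}" "P \<inter> cyl v \<noteq> {}"
    "\<And>x y. x \<in> P \<inter> cyl u \<Longrightarrow> y \<in> P \<inter> cyl v \<Longrightarrow> x + y \<in> realized T ps"
    unfolding K_def by blast
  define t1 where "t1 = t0(a := u, new := v)"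
  have t1: "P \<inter> cyl (t1 x) \<noteq> {}" for x using t0 uv by (simp add: t1_def)
  have t01: "prefix (t0 x) (t1 x)" for x using uv by (simp add: t1_def)
  define n' where "n' = Suc (n + m0 + N)"
  have "\<forall>x. \<exists>t. prefix (t1 x) t \<and> n' \<le> length t \<and> P \<inter> cyl t \<noteq> {}"
    using extend_node[OF t1] by blast
  from choice[OF this] obtain t2 where t2: "\<And>x. prefix (t1 x) (t2 x)" "\<And>x. n' \<le> length (t2 x)"
    "\<And>x. P \<inter> cyl (t2 x) \<noteq> {}" by blast
  \<comment> \<open>the patterns to be refined: inherited from the old scheme, except for the two halves of \<open>a\<close>\<close>
  define base where "base x y = (if x = a \<and> y = new then ps else if x = new \<and> y = a then flip ps
    else c (f x) (f y))" for x y
  have f_ne: "f x \<noteq> f y" if "x \<noteq> y" "\<not> (x = a \<and> y = new)" "\<not> (x = new \<and> y = a)" for x y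
    using that by (auto simp: f_def)
  have base_flip: "base y x = flip (base x y)" if "x \<in> A'" "y \<in> A'" "x \<noteq> y" for x y
    using f_ne[OF that(3)] pair(2)[OF fA fA, OF that(1,2)] \<open>a \<noteq> new\<close> by (auto simp: base_def)
  have base_adm: "\<exists>m\<le>n'. admissible \<iota> m (base x y)" if "x \<in> A'" "y \<in> A'" "x \<noteq> y" for x y
  proof (cases "x = a \<and> y = new \<or> x = new \<and> y = a")
    case True
    then show ?thesis using ps by (intro exI[of _ m0]) (auto simp: base_def n'_def)
  next
    case False
    then show ?thesis using pair(1)[OF fA fA, OF that(1,2)] f_ne[OF that(3)]
      by (intro exI[of _ n]) (auto simp: base_def n'_def)
  qed
  have cyl_t2: "cyl (t2 x) \<subseteq> cyl (t1 x)" for x using cyl_mono[OF t2(1)] .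
  have cyl_s: "cyl (t2 x) \<subseteq> cyl (s (f x))" if "x \<in> A'" for x
    using cyl_mono[OF t2(1)] cyl_mono[OF t01] cyl_mono[OF t0s[OF that]] by blast
  have base_real: "x' + y' \<in> realized T (base x y)"
    if xy: "x \<in> A'" "y \<in> A'" "x \<noteq> y" and x': "x' \<in> P \<inter> cyl (t2 x)" and y': "y' \<in> P \<inter> cyl (t2 y)" for x y x' y'
  proof -
    consider "x = a" "y = new" | "x = new" "y = a" | "\<not> (x = a \<and> y = new)" "\<not> (x = new \<and> y = a)"
      by blast
    then show ?thesis
    proof cases
      case 1
      then have "x' \<in> P \<inter> cyl u" "y' \<in> P \<inter> cyl v"
        using x' y' cyl_t2[of a] cyl_t2[of new] \<open>a \<noteq> new\<close> by (auto simp: t1_def)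
      then show ?thesis using uv(5) 1 by (simp add: base_def)
    next
      case 2
      then have "y' \<in> P \<inter> cyl u" "x' \<in> P \<inter> cyl v"
        using x' y' cyl_t2[of a] cyl_t2[of new] \<open>a \<noteq> new\<close> by (auto simp: t1_def)
      then have "y' + x' \<in> realized T ps" using uv(5) by blast
      then show ?thesis using 2 \<open>a \<noteq> new\<close> by (simp add: base_def add.commute)
    next
      case 3
      have "x' + y' \<in> realized T (c (f x) (f y))"
        by (rule pair(3)[OF fA fA f_ne]) (use xy 3 x' y' cyl_s in blast)+
      then show ?thesis using 3 unfolding base_def by (simp only: if_False)
    qed
  qed
  define C where "C x y = {qs. admissible \<iota> n' qs \<and> pattern_refines (base x y) qs}" for x y
  define Q where "Q = {(x, y). x \<in> A' \<and> y \<in> A' \<and> x < y}"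
  have "finite Q" by (rule finite_subset[of _ "A' \<times> A'"]) (use A in \<open>auto simp: Q_def A'_def\<close>)
  have "\<exists>s' k. (\<forall>a. prefix (t2 a) (s' a) \<and> P \<inter> cyl (s' a) \<noteq> {}) \<and>
    (\<forall>(a, b)\<in>Q. k a b \<in> C a b \<and> (\<forall>x\<in>P \<inter> cyl (s' a). \<forall>y\<in>P \<inter> cyl (s' b). x + y \<in> realized T (k a b)))"
  proof (rule refine_rectangles[OF P(1) \<open>finite Q\<close> _ t2(3)])
    fix a b x y assume "(a, b) \<in> Q" and x: "x \<in> P \<inter> cyl (t2 a)" and y: "y \<in> P \<inter> cyl (t2 b)"
    then have ab: "a \<in> A'" "b \<in> A'" "a \<noteq> b" by (auto simp: Q_def)
    obtain m where "m \<le> n'" "admissible \<iota> m (base a b)" using base_adm[OF ab] by blast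
    then show "\<exists>k\<in>C a b. x + y \<in> realized T k"
      using realized_refine[OF base_real[OF ab x y]] unfolding C_def by blast
  qed (auto intro: closed_realized simp: Q_def)
  then obtain s' k where s': "\<forall>a. prefix (t2 a) (s' a) \<and> P \<inter> cyl (s' a) \<noteq> {}"
    and k: "\<forall>(a, b)\<in>Q. k a b \<in> C a b \<and> (\<forall>x\<in>P \<inter> cyl (s' a). \<forall>y\<in>P \<inter> cyl (s' b). x + y \<in> realized T (k a b))"
    by blast
  define c' where "c' x y = (if x < y then k x y else flip (k y x))" for x y
  have c': "admissible \<iota> n' (c' x y)" "c' y x = flip (c' x y)" "pattern_refines (base x y) (c' x y)"
    "\<And>p q. p \<in> P \<inter> cyl (s' x) \<Longrightarrow> q \<in> P \<inter> cyl (s' y) \<Longrightarrow> p + q \<in> realized T (c' x y)"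
    if xy: "x \<in> A'" "y \<in> A'" "x \<noteq> y" for x y
  proof -
    have *: "admissible \<iota> n' (c' x y) \<and> c' y x = flip (c' x y) \<and> pattern_refines (base x y) (c' x y) \<and>
      (\<forall>p\<in>P \<inter> cyl (s' x). \<forall>q\<in>P \<inter> cyl (s' y). p + q \<in> realized T (c' x y))"
    proof (cases "x < y")
      case True
      then have "(x, y) \<in> Q" using xy by (simp add: Q_def)
      then have "k x y \<in> C x y" "\<forall>p\<in>P \<inter> cyl (s' x). \<forall>q\<in>P \<inter> cyl (s' y). p + q \<in> realized T (k x y)"
        using k by blast+
      then show ?thesis using True by (simp add: c'_def C_def)
    next
      case False
      then have "(y, x) \<in> Q" using xy by (simp add: Q_def)
      then have kyx: "k y x \<in> C y x" "\<forall>p\<in>P \<inter> cyl (s' y). \<forall>q\<in>P \<inter> cyl (s' x). p + q \<in> realized T (k y x)"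
        using k by blast+
      then have "pattern_refines (base x y) (flip (k y x))"
        using pattern_refines_flip[of "base y x" "k y x"] base_flip[OF xy(2,1)] xy(3) by (simp add: C_def)
      moreover have "p + q \<in> realized T (k y x)" if "p \<in> P \<inter> cyl (s' x)" "q \<in> P \<inter> cyl (s' y)" for p q
        using kyx(2) that by (subst add.commute) blast
      ultimately show ?thesis using False kyx xy(3) by (auto simp: c'_def C_def)
    qed
    then show "admissible \<iota> n' (c' x y)" "c' y x = flip (c' x y)" "pattern_refines (base x y) (c' x y)"
      "\<And>p q. p \<in> P \<inter> cyl (s' x) \<Longrightarrow> q \<in> P \<inter> cyl (s' y) \<Longrightarrow> p + q \<in> realized T (c' x y)"
      by blast+
  qed
  have long: "n' \<le> length (s' x)" for x
    using s' t2(2)[of x] prefix_length_le[of "t2 x" "s' x"] by fastforce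
  have ts: "prefix (t0 x) (s' x)" for x
    using s' t01 t2(1) by (metis prefix_order.trans)
  have "inj_on (\<lambda>x. take n' (s' x)) A'"
  proof (rule inj_onI, rule ccontr)
    fix x y assume xy: "x \<in> A'" "y \<in> A'" "take n' (s' x) = take n' (s' y)" "x \<noteq> y"
    have eq: "s' x ! i = s' y ! i" if "i < n'" for i
      using that xy(3) by (metis nth_take)
    show False
    proof (cases "f x = f y")
      case True
      then have "{x, y} = {a, new}" using xy by (auto simp: f_def A'_def split: if_splits)
      then have "s' a ! j = s' new ! j" using eq[of j] by (auto simp: n'_def N_def doubleton_eq_iff)
      moreover have "s' a ! j = p j" "s' new ! j = q j"
        using prefix_nthD[OF ts, of j a] prefix_nthD[OF ts, of j new] \<open>a \<noteq> new\<close>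
        by (auto simp: t0_def N_def)
      ultimately show False using j by simp
    next
      case False
      have "take n (s (f x)) = take n (s (f y))"
      proof (rule nth_equalityI)
        show "length (take n (s (f x))) = length (take n (s (f y)))"
          using sA[OF fA[OF xy(1)]] sA[OF fA[OF xy(2)]] by simp
        fix i assume "i < length (take n (s (f x)))"
        then have i: "i < n" by simp
        have "prefix (s (f x)) (s' x)" "prefix (s (f y)) (s' y)"
          using t0s ts xy prefix_order.trans by blast+
        from this[THEN prefix_nthD, of i] show "take n (s (f x)) ! i = take n (s (f y)) ! i"
          using eq[of i] i sA[OF fA[OF xy(1)]] sA[OF fA[OF xy(2)]] by (simp add: n'_def)
      qed
      then show False using inj fA xy(1,2) False by (auto dest: inj_onD)
    qed
  qed
  moreover have "finite A'" "A' \<noteq> {}" using A by (auto simp: A'_def)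
  ultimately have "scheme T \<iota> P A' n' s' c'"
    unfolding scheme_def
    by (intro conjI ballI impI) (use s' long c'(4) in \<open>blast intro: c'(1,2)\<close>)+
  moreover have "pattern_refines (c (f x) (f y)) (c' x y)" if "x \<in> A'" "y \<in> A'" "f x \<noteq> f y" for x y
  proof -
    have "f a = f new" by (simp add: f_def)
    then have ne: "\<not> (x = a \<and> y = new)" "\<not> (x = new \<and> y = a)" "x \<noteq> y" using that(3) by auto
    then have "base x y = c (f x) (f y)" unfolding base_def by (simp only: if_False)
    then show ?thesis using c'(3)[OF that(1,2) ne(3)] by (simp only:)
  qed
  moreover have "prefix (s (f x)) (s' x)" if "x \<in> A'" for x
    using t0s[OF that] ts prefix_order.trans by blast
  moreover have "f ` A' = A" using \<open>a \<in> A\<close> new by (auto simp: f_def A'_def)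
  moreover have "f a = a" "f new = a" "a \<in> A'" "new \<in> A'" "n < n'"
    using \<open>a \<in> A\<close> by (auto simp: f_def A'_def n'_def)
  ultimately show ?thesis using \<open>a \<noteq> new\<close>
    by (intro exI[of _ A'] exI[of _ n'] exI[of _ s'] exI[of _ c'] exI[of _ f]) blast
qed
end

lemma take_prefix_eq: "prefix a b \<Longrightarrow> n \<le> length a \<Longrightarrow> take n b = take n a"
  by (auto simp: prefix_def)

lemma scheme_extends:
  assumes sch: "scheme T \<iota> P A n s c" and rep: "represents \<iota> m A n s c"
    and sch': "scheme T \<iota> P A' n' s' c'" and rep': "represents \<iota> m' A' n' s' c'"
    and "n < n'" and f: "f ` A' = A" "\<And>x. x \<in> A' \<Longrightarrow> prefix (s (f x)) (s' x)"
    and ref: "\<And>x y. x \<in> A' \<Longrightarrow> y \<in> A' \<Longrightarrow> f x \<noteq> f y \<Longrightarrow> pattern_refines (c (f x) (f y)) (c' x y)"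
  shows "cfg_extends \<iota> m m'"
    and "x \<in> A' \<Longrightarrow> y \<in> A' \<Longrightarrow> x \<noteq> y \<Longrightarrow> f x = f y \<Longrightarrow>
      2 \<le> card {\<eta> \<in> cfg_u m'. strict_prefix (take n (s (f x))) \<eta>}"
proof -
  have len: "n \<le> length (s a)" if "a \<in> A" for a using sch that unfolding scheme_def by blast
  have len': "n' \<le> length (s' a)" if "a \<in> A'" for a using sch' that unfolding scheme_def by blast
  have inj': "inj_on (\<lambda>a. take n' (s' a)) A'" and fin: "finite A'"
    using sch' unfolding scheme_def by blast+
  have fA: "f x \<in> A" if "x \<in> A'" for x using f(1) that by blast
  have tk: "take n (take n' (s' x)) = take n (s (f x))" if "x \<in> A'" for x
    using take_prefix_eq[OF f(2)[OF that] len[OF fA[OF that]]] \<open>n < n'\<close> by (simp add: min_def)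
  have l: "cfg_l m = n" "cfg_l m' = n'" and u: "cfg_u m = (\<lambda>a. take n (s a)) ` A"
    "cfg_u m' = (\<lambda>a. take n' (s' a)) ` A'"
    using rep rep' unfolding represents_def by blast+
  have u': "cfg_u m = take n ` cfg_u m'"
    unfolding u image_image f(1)[symmetric] using tk by (auto simp: image_iff)
  have "cfg_h m i (take n \<eta>) (take n \<nu>) = cfg_h m' i \<eta> \<nu> \<and>
      cfg_g m i (take n \<eta>) (take n \<nu>) = take n (cfg_g m' i \<eta> \<nu>)"
    if mem: "\<eta> \<in> cfg_u m'" "\<nu> \<in> cfg_u m'" and dif: "take n \<eta> \<noteq> take n \<nu>" and i\<iota>: "i < \<iota>" for \<eta> \<nu> i
  proof -
    obtain x y where x: "x \<in> A'" "\<eta> = take n' (s' x)" and y: "y \<in> A'" "\<nu> = take n' (s' y)"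
      using mem unfolding u by blast
    have t: "take n \<eta> = take n (s (f x))" "take n \<nu> = take n (s (f y))"
      using tk x y by blast+
    then have ne: "f x \<noteq> f y" "x \<noteq> y" using dif by auto
    have adm: "admissible \<iota> n (c (f x) (f y))"
      using sch fA[OF x(1)] fA[OF y(1)] ne(1) unfolding scheme_def by blast
    have "pattern_refines (c (f x) (f y)) (c' x y)" by (rule ref[OF x(1) y(1) ne(1)])
    moreover have i: "i < length (c (f x) (f y))" using adm i\<iota> by (simp add: admissible_def)
    ultimately have r: "fst (fst (c' x y ! i)) = fst (fst (c (f x) (f y) ! i))"
      "prefix (snd (fst (c (f x) (f y) ! i))) (snd (fst (c' x y ! i)))"
      unfolding pattern_refines_def by (auto dest: list_all2_nthD)
    have "length (snd (fst (c (f x) (f y) ! i))) = n"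
      using adm nth_mem[OF i] unfolding admissible_def by blast
    then have "take n (snd (fst (c' x y ! i))) = snd (fst (c (f x) (f y) ! i))"
      using take_prefix_eq[OF r(2), of n] by simp
    moreover have "cfg_h m' i \<eta> \<nu> = fst (fst (c' x y ! i))" "cfg_g m' i \<eta> \<nu> = snd (fst (c' x y ! i))"
      using rep' x y ne(2) i\<iota> unfolding represents_def by blast+
    moreover have "cfg_h m i (take n \<eta>) (take n \<nu>) = fst (fst (c (f x) (f y) ! i))"
      "cfg_g m i (take n \<eta>) (take n \<nu>) = snd (fst (c (f x) (f y) ! i))"
      using rep fA[OF x(1)] fA[OF y(1)] ne(1) i\<iota> unfolding t represents_def by blast+
    ultimately show ?thesis using r(1) by simp
  qed
  then show "cfg_extends \<iota> m m'"
    unfolding cfg_extends_def l offdiag_def using u' \<open>n < n'\<close> by auto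
  assume xy: "x \<in> A'" "y \<in> A'" "x \<noteq> y" "f x = f y"
  have sp: "strict_prefix (take n (s (f z))) (take n' (s' z))" if "z \<in> A'" for z
  proof -
    have "take n (s (f z)) = take n (take n' (s' z))" using tk[OF that] by simp
    moreover have "length (take n (s (f z))) \<noteq> length (take n' (s' z))"
      using len[OF fA[OF that]] len'[OF that] \<open>n < n'\<close> by simp
    ultimately show ?thesis by (metis strict_prefixI take_is_prefix)
  qed
  have "{take n' (s' x), take n' (s' y)} \<subseteq> {\<eta> \<in> cfg_u m'. strict_prefix (take n (s (f x))) \<eta>}"
    using sp[OF xy(1)] sp[OF xy(2)] xy unfolding u by auto
  moreover have "finite {\<eta> \<in> cfg_u m'. strict_prefix (take n (s (f x))) \<eta>}"
    unfolding u using fin by simp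
  moreover have "card {take n' (s' x), take n' (s' y)} = 2"
    using inj' xy by (auto simp: inj_on_def card_insert_if)
  ultimately show "2 \<le> card {\<eta> \<in> cfg_u m'. strict_prefix (take n (s (f x))) \<eta>}"
    by (metis card_mono)
qed

lemma less_ord_suc: "\<alpha> < ord_suc \<alpha>"
  unfolding ord_suc_def using LeastI_ex[OF ex_greater_ordinal] .

context overlapping_perfect_set
begin

text \<open>
  By induction on \<open>\<alpha>\<close> for all schemes at once: at a successor, \<open>scheme_split\<close> splits the given node,
  and the configuration obtained is again represented by a scheme.
\<close>

lemma scheme_ndrk_ge:
  assumes "scheme T \<iota> P A n s c" "represents \<iota> m A n s c"
  shows "ndrk_ge \<iota> T m \<alpha>"
  using assms
proof (induction \<alpha> arbitrary: A n s c m rule: less_induct)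
  case (less \<alpha>)
  consider "\<alpha> = ord_zero" | "ord_limit \<alpha>" | \<beta> where "\<alpha> = ord_suc \<beta>"
    unfolding ord_limit_def by blast
  then show ?case
  proof cases
    case 1
    then show ?thesis using ndrk_ge.zero by simp
  next
    case 2
    then show ?thesis using less by (blast intro: ndrk_ge.limit)
  next
    case 3
    show ?thesis
      unfolding 3
    proof (rule ndrk_ge.suc)
      fix \<nu> assume "\<nu> \<in> cfg_u m"
      then obtain a where a: "a \<in> A" "\<nu> = take n (s a)"
        using less.prems(2) unfolding represents_def by blast
      obtain A' n' s' c' f where *: "scheme T \<iota> P A' n' s' c'" "n < n'" "f ` A' = A"
        "\<And>x. x \<in> A' \<Longrightarrow> prefix (s (f x)) (s' x)"
        "\<And>x y. x \<in> A' \<Longrightarrow> y \<in> A' \<Longrightarrow> f x \<noteq> f y \<Longrightarrow> pattern_refines (c (f x) (f y)) (c' x y)"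
        and xy: "\<exists>x\<in>A'. \<exists>y\<in>A'. x \<noteq> y \<and> f x = a \<and> f y = a"
        using scheme_split[OF less.prems(1) a(1)] by blast
      obtain x y where xy: "x \<in> A'" "y \<in> A'" "x \<noteq> y" "f x = a" "f y = a" using xy by blast
      have inj: "inj_on (\<lambda>a. take n' (s' a)) A'" and fin: "finite A'"
        using *(1) unfolding scheme_def by blast+
      obtain m' where m': "represents \<iota> m' A' n' s' c'" using ex_represents[OF inj] by blast
      have "card {x, y} \<le> card A'" using fin xy by (intro card_mono) auto
      then have "m' \<in> configs \<iota> T"
        using scheme_config[OF *(1) m'] \<open>n < n'\<close> xy(3) by simp
      moreover have "cfg_l m < cfg_l m'"
        using m' less.prems(2) \<open>n < n'\<close> unfolding represents_def by simp
      moreover have "ndrk_ge \<iota> T m' \<beta>"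
        using less.IH[OF _ *(1) m'] 3 less_ord_suc by blast
      moreover have "cfg_extends \<iota> m m'"
        by (rule scheme_extends(1)[OF less.prems *(1) m' *(2,3)]) (use *(4,5) in blast)+
      moreover have "2 \<le> card {\<eta> \<in> cfg_u m'. strict_prefix (take n (s (f x))) \<eta>}"
        by (rule scheme_extends(2)[OF less.prems *(1) m' *(2,3) _ _ xy(1-3)]) (use *(4,5) xy(4,5) in auto)
      ultimately show "\<exists>n\<in>configs \<iota> T. cfg_l n > cfg_l m \<and> cfg_extends \<iota> m n \<and> ndrk_ge \<iota> T n \<beta> \<and>
             card {\<eta> \<in> cfg_u n. strict_prefix \<nu> \<eta>} \<ge> 2"
        using xy(4) a(2) by auto
    qed
  qed
qed

text \<open>
  The scheme with a single node of length \<open>0\<close> does not represent a configuration, but splitting its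
  node once leads to one that does.
\<close>

lemma ndrk_sup_infinite: "ndrk_sup \<iota> T = Infty"
proof -
  have sch0: "scheme T \<iota> P {0} 0 (\<lambda>_. []) (\<lambda>_ _. [])"
    using P(3) by (auto simp: scheme_def mem_cyl_iff)
  have "\<exists>A n s c. scheme T \<iota> P A n s c \<and> 0 < n \<and> (\<exists>x\<in>A. \<exists>y\<in>A. x \<noteq> y)"
    using scheme_split[OF sch0 singletonI] by (elim exE conjE) blast
  then obtain A n s c where sch: "scheme T \<iota> P A n s c" and "0 < n"
    and xy: "\<exists>x\<in>A. \<exists>y\<in>A. x \<noteq> y" by blast
  obtain x y where xy: "x \<in> A" "y \<in> A" "x \<noteq> y" using xy by blast
  have inj: "inj_on (\<lambda>a. take n (s a)) A" and fin: "finite A"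
    using sch unfolding scheme_def by blast+
  obtain m where m: "represents \<iota> m A n s c" using ex_represents[OF inj] by blast
  have "card {x, y} \<le> card A" using fin xy by (intro card_mono) auto
  then have "m \<in> configs \<iota> T" using scheme_config[OF sch m \<open>0 < n\<close>] xy(3) by simp
  moreover have "ndrk \<iota> T m = Infty" using scheme_ndrk_ge[OF sch m] by (simp add: ndrk_def)
  moreover have "\<forall>m\<in>configs \<iota> T. ndrk \<iota> T m \<le> ndrk_sup \<iota> T"
    unfolding ndrk_sup_def by (rule LeastI[of _ Infty]) (simp add: less_eq_xordinal_def)
  ultimately have "Infty \<le> ndrk_sup \<iota> T" by metis
  then show ?thesis by (simp add: less_eq_xordinal_def)
qed

end

theorem bounded_rank_no_perfect_overlap:
  assumes "ndrk_sup \<iota> T \<noteq> Infty" "perfect_set P" and B: "B = (\<Union>m. branches (T m))"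
  shows "\<exists>\<eta>\<in>P. \<exists>\<nu>\<in>P. |translate \<eta> B \<inter> translate \<nu> B| <o |{..<2 * \<iota>}|"
proof (rule ccontr)
  assume "\<not> ?thesis"
  then have big: "|{..<2 * \<iota>}| \<le>o |translate \<eta> B \<inter> translate \<nu> B|" if "\<eta> \<in> P" "\<nu> \<in> P" for \<eta> \<nu>
    using that not_ordLess_iff_ordLeq[OF card_of_Well_order card_of_Well_order] by blast
  interpret overlapping_perfect_set T \<iota> P
  proof
    fix x y assume "x \<in> P" "y \<in> P" "x \<noteq> y"
    then show "\<exists>n ps. admissible \<iota> n ps \<and> x + y \<in> realized T ps"
      using overlap_pattern[OF _ B big] by blast
  qed (use assms(2) in \<open>auto simp: perfect_set_def\<close>)
  show False using ndrk_sup_infinite assms(1) by simp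
qed

section \<open>A YZR-system on an infinite cardinal\<close>

text \<open>
  A form of YZR-systems that does not mention any order on \<open>X\<close>: colors and the choice of the element
  to be exchanged are functions of lists without repetitions, and an exchange is an update of the list.
  In this form a system can be pulled back along an arbitrary injection, so that it
  suffices to construct one on each cardinal although the initial segments of that cardinal, with
  their own order, are not cardinals.
\<close>

definition rank_coloring ::
  "ordinal set \<Rightarrow> (ordinal set \<Rightarrow> ordinal) \<Rightarrow> (ordinal list \<Rightarrow> nat) \<Rightarrow> (ordinal list \<Rightarrow> nat) \<Rightarrow> bool" where
  "rank_coloring X r J E \<longleftrightarrow>
     (\<forall>u w. u \<noteq> {} \<and> u \<subseteq> w \<and> finite w \<and> w \<subseteq> X \<longrightarrow> r w \<le> r u) \<and>
     (\<forall>xs. xs \<noteq> [] \<and> distinct xs \<and> set xs \<subseteq> X \<longrightarrow> E xs < length xs \<and>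
        (\<forall>b\<in>X - set xs. J (xs[E xs := b]) = J xs \<longrightarrow> r (insert b (set xs)) \<noteq> r (set xs)))"

text \<open>
  During the induction on cardinals the ranks are infinite cardinals themselves, so that the bound is
  the cardinal for which the system is constructed.  They are renumbered by ordinals at the end.
\<close>

definition cardinal_ranked :: "ordinal \<Rightarrow> ordinal set \<Rightarrow> (ordinal set \<Rightarrow> ordinal) \<Rightarrow> bool" where
  "cardinal_ranked \<mu> X r \<longleftrightarrow>
     (\<forall>w. finite w \<and> w \<noteq> {} \<and> w \<subseteq> X \<longrightarrow> infinite_cardinal (r w) \<and> r w \<le> \<mu>) \<and>
     (\<forall>a\<in>X. r {a} = \<mu>)"

lemma rank_coloring_pullback:
  assumes g: "inj_on g X" "g ` X \<subseteq> Y" and sys: "rank_coloring Y r J E" "cardinal_ranked \<mu> Y r"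
  shows "rank_coloring X (\<lambda>w. r (g ` w)) (\<lambda>xs. J (map g xs)) (\<lambda>xs. E (map g xs))"
    and "cardinal_ranked \<mu> X (\<lambda>w. r (g ` w))"
proof -
  have mono: "r w \<le> r u" if "u \<noteq> {}" "u \<subseteq> w" "finite w" "w \<subseteq> Y" for u w
    using sys(1) that unfolding rank_coloring_def by blast
  have col: "E xs < length xs"
    "\<And>b. b \<in> Y - set xs \<Longrightarrow> J (xs[E xs := b]) = J xs \<Longrightarrow> r (insert b (set xs)) \<noteq> r (set xs)"
    if "xs \<noteq> []" "distinct xs" "set xs \<subseteq> Y" for xs
    using sys(1) that unfolding rank_coloring_def by blast+
  show "rank_coloring X (\<lambda>w. r (g ` w)) (\<lambda>xs. J (map g xs)) (\<lambda>xs. E (map g xs))"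
    unfolding rank_coloring_def
  proof (intro conjI allI impI; elim conjE)
    fix u w assume "u \<noteq> {}" "u \<subseteq> w" "finite w" "w \<subseteq> X"
    then show "r (g ` w) \<le> r (g ` u)"
      using g(2) by (intro mono) auto
  next
    fix xs assume xs: "xs \<noteq> []" "distinct xs" "set xs \<subseteq> X"
    have gxs: "map g xs \<noteq> []" "distinct (map g xs)" "set (map g xs) \<subseteq> Y"
      using xs g by (auto simp: distinct_map intro: inj_on_subset)
    show "E (map g xs) < length xs" using col(1)[OF gxs] by simp
    show "\<forall>b\<in>X - set xs. J (map g (xs[E (map g xs) := b])) = J (map g xs) \<longrightarrow>
        r (g ` insert b (set xs)) \<noteq> r (g ` set xs)"
    proof (intro ballI impI)
      fix b assume b: "b \<in> X - set xs" "J (map g (xs[E (map g xs) := b])) = J (map g xs)"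
      have "g b \<in> Y - set (map g xs)"
        using b(1) xs(3) g by (auto dest: inj_onD)
      then show "r (g ` insert b (set xs)) \<noteq> r (g ` set xs)"
        using col(2)[OF gxs, of "g b"] b(2) by (simp add: map_update)
    qed
  qed
  show "cardinal_ranked \<mu> X (\<lambda>w. r (g ` w))"
    unfolding cardinal_ranked_def
  proof (intro conjI allI impI ballI; (elim conjE)?)
    fix w assume "finite w" "w \<noteq> {}" "w \<subseteq> X"
    then have "finite (g ` w)" "g ` w \<noteq> {}" "g ` w \<subseteq> Y" using g(2) by auto
    then show "infinite_cardinal (r (g ` w))" "r (g ` w) \<le> \<mu>"
      using sys(2) unfolding cardinal_ranked_def by blast+
  next
    fix a assume "a \<in> X"
    then have "g a \<in> Y" using g(2) by blast
    then show "r (g ` {a}) = \<mu>" using sys(2) unfolding cardinal_ranked_def by simp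
  qed
qed

text \<open>
  Below \<open>\<omega>\<close> an element is determined by the number of its predecessors, so the color can identify the
  last element of a list, and no exchange of it goes unnoticed.
\<close>

lemma rank_coloring_omega:
  assumes fin: "\<And>\<gamma>. \<gamma> < \<mu> \<Longrightarrow> finite {..<\<gamma> :: ordinal}"
  shows "rank_coloring {..<\<mu>} (\<lambda>_. \<mu>) (\<lambda>xs. card {..<last xs}) (\<lambda>xs. length xs - 1)"
  unfolding rank_coloring_def
proof (intro conjI allI impI; (elim conjE)?)
  fix xs assume xs: "xs \<noteq> []" "distinct xs" "set xs \<subseteq> {..<\<mu>}"
  show "length xs - 1 < length xs" using xs by simp
  show "\<forall>b\<in>{..<\<mu>} - set xs. card {..<last (xs[length xs - 1 := b])} = card {..<last xs} \<longrightarrow> \<mu> \<noteq> \<mu>"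
  proof (intro ballI impI)
    fix b assume b: "b \<in> {..<\<mu>} - set xs"
      and eq: "card {..<last (xs[length xs - 1 := b])} = card {..<last xs}"
    have "last (xs[length xs - 1 := b]) = b" using xs(1) by (simp add: last_conv_nth)
    moreover have "last xs \<in> set xs" using xs(1) by simp
    then have "last xs \<noteq> b" "last xs < \<mu>" "b < \<mu>" using b xs(3) by auto
    moreover have "card {..<x} < card {..<y}" if "x < y" "y < \<mu>" for x y
      using that fin by (intro psubset_card_mono) auto
    ultimately show "\<mu> \<noteq> \<mu>" using eq by (metis less_irrefl linorder_neqE)
  qed
qed simp

text \<open>
  The least \<open>\<nu>\<close> for which \<open>{..<\<nu>}\<close> is infinite and at least as large as \<open>{..<\<gamma>}\<close> is a cardinal, and
  it is at most the maximum of \<open>\<gamma>\<close> and \<open>\<delta>\<close>.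
\<close>

lemma ex_cardinal_above:
  assumes "\<gamma> < \<mu>" "\<delta> < \<mu>" "infinite {..<\<delta> :: ordinal}"
  shows "\<exists>\<nu><\<mu>. infinite_cardinal \<nu> \<and> |{..<\<gamma>}| \<le>o |{..<\<nu>}|"
proof -
  define Q where "Q \<nu> \<longleftrightarrow> infinite {..<\<nu>} \<and> |{..<\<gamma>}| \<le>o |{..<\<nu>}|" for \<nu> :: ordinal
  define \<nu> where "\<nu> = (LEAST \<nu>. Q \<nu>)"
  have Qmax: "Q (max \<gamma> \<delta>)"
  proof -
    have sub: "{..<\<gamma>} \<subseteq> {..<max \<gamma> \<delta>}" "{..<\<delta>} \<subseteq> {..<max \<gamma> \<delta>}" by auto
    show ?thesis unfolding Q_def
      using card_of_mono1[OF sub(1)] finite_subset[OF sub(2)] assms(3) by blast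
  qed
  have Q\<nu>: "Q \<nu>" unfolding \<nu>_def using Qmax by (rule LeastI)
  have "\<nu> \<le> max \<gamma> \<delta>" unfolding \<nu>_def using Qmax by (rule Least_le)
  moreover have "max \<gamma> \<delta> < \<mu>" using assms by simp
  ultimately have "\<nu> < \<mu>" by (rule le_less_trans)
  moreover have "infinite_cardinal \<nu>"
    unfolding infinite_cardinal_def
  proof (intro conjI allI impI)
    show "infinite {..<\<nu>}" using Q\<nu> by (simp add: Q_def)
    fix \<beta> assume "\<beta> < \<nu>"
    show "|{..<\<beta>}| <o |{..<\<nu>}|"
    proof (rule ccontr)
      assume "\<not> |{..<\<beta>}| <o |{..<\<nu>}|"
      then have le: "|{..<\<nu>}| \<le>o |{..<\<beta>}|"
        using not_ordLess_iff_ordLeq[OF card_of_Well_order card_of_Well_order] by blast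
      then have "infinite {..<\<beta>}" using Q\<nu> card_of_ordLeq_finite unfolding Q_def by blast
      then have "Q \<beta>" using le Q\<nu> ordLeq_transitive unfolding Q_def by blast
      then have "\<nu> \<le> \<beta>" unfolding \<nu>_def by (rule Least_le)
      with \<open>\<beta> < \<nu>\<close> show False by simp
    qed
  qed
  ultimately show ?thesis using Q\<nu> unfolding Q_def by blast
qed

text \<open>
  Each element \<open>\<gamma>\<close> of a finite set \<open>w\<close> other than its minimum assigns to \<open>w\<close> the rank of
  \<open>w \<inter> {..<\<gamma>}\<close> in the system on \<open>{..<\<gamma>}\<close>, and the new rank of \<open>w\<close> is the least of these values.  For
  a list, fix a pivot \<open>\<gamma>\<close> that attains this minimum, and exchange the element below \<open>\<gamma>\<close>
  that the system of \<open>\<gamma>\<close> selects.  The color records the position of the pivot, the positions of the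
  elements below it and their color in the system of \<open>\<gamma>\<close>.  Hence an exchange with an element \<open>b\<close> that
  keeps the color keeps the pivot and satisfies \<open>b < \<gamma>\<close>.  If adding \<open>b\<close> also kept the
  rank, then it would keep the rank in the system of \<open>\<gamma>\<close>, since the new rank is at most the value
  that \<open>\<gamma>\<close> assigns.  That is impossible by the choice of the element exchanged.
\<close>

lemma rank_coloring_step:
  fixes r :: "ordinal \<Rightarrow> ordinal set \<Rightarrow> ordinal" and J E :: "ordinal \<Rightarrow> ordinal list \<Rightarrow> nat"
  assumes sys: "\<And>\<gamma>. \<gamma> < \<mu> \<Longrightarrow> rank_coloring {..<\<gamma>} (r \<gamma>) (J \<gamma>) (E \<gamma>)"
    and \<nu>: "\<And>\<gamma>. \<gamma> < \<mu> \<Longrightarrow> \<nu> \<gamma> < \<mu>" "\<And>\<gamma>. \<gamma> < \<mu> \<Longrightarrow> cardinal_ranked (\<nu> \<gamma>) {..<\<gamma>} (r \<gamma>)"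
    and \<mu>: "infinite_cardinal \<mu>"
  shows "\<exists>R F G. rank_coloring {..<\<mu>} R F G \<and> cardinal_ranked \<mu> {..<\<mu>} R"
proof -
  \<comment> \<open>no element of \<open>w\<close> lies below the minimum, so the minimum has nothing to assign\<close>
  define cand where "cand w = w - {Min w}" for w :: "ordinal set"
  define val where "val w \<gamma> = r \<gamma> (w \<inter> {..<\<gamma>})" for w \<gamma>
  define R where "R w = (if cand w = {} then \<mu> else Min (val w ` cand w))" for w
  have cand: "w \<inter> {..<\<gamma>} \<noteq> {}" "w \<inter> {..<\<gamma>} \<subseteq> {..<\<gamma>}" if "finite w" "\<gamma> \<in> cand w" for w \<gamma>
  proof -
    have "Min w \<in> w" "Min w \<le> \<gamma>" "Min w \<noteq> \<gamma>" using that by (auto simp: cand_def intro: Min_in)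
    then show "w \<inter> {..<\<gamma>} \<noteq> {}" by (metis IntI empty_iff lessThan_iff order_le_neq_trans)
  qed auto
  have cand_mono: "cand u \<subseteq> cand w" if "u \<noteq> {}" "u \<subseteq> w" "finite w" for u w
  proof
    fix \<gamma> assume \<gamma>: "\<gamma> \<in> cand u"
    have "finite u" using that finite_subset by blast
    then have "Min u \<le> \<gamma>" "Min u \<noteq> \<gamma>" "Min w \<le> Min u"
      using \<gamma> that by (auto simp: cand_def intro: Min_antimono)
    then have "Min w \<noteq> \<gamma>" by auto
    then show "\<gamma> \<in> cand w" using \<gamma> that(2) by (auto simp: cand_def)
  qed
  have mono: "r \<gamma> w \<le> r \<gamma> u" if "\<gamma> < \<mu>" "u \<noteq> {}" "u \<subseteq> w" "finite w" "w \<subseteq> {..<\<gamma>}" for \<gamma> u w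
    using sys[OF that(1)] that(2-) unfolding rank_coloring_def by blast
  have val: "infinite_cardinal (val w \<gamma>)" "val w \<gamma> < \<mu>"
    if "finite w" "w \<subseteq> {..<\<mu>}" "\<gamma> \<in> cand w" for w \<gamma>
  proof -
    have "\<gamma> < \<mu>" using that by (auto simp: cand_def)
    then have "infinite_cardinal (val w \<gamma>) \<and> val w \<gamma> \<le> \<nu> \<gamma>"
      using \<nu>(2)[of \<gamma>] cand[OF that(1,3)] that(1) unfolding cardinal_ranked_def val_def by blast
    then show "infinite_cardinal (val w \<gamma>)" "val w \<gamma> < \<mu>"
      using \<nu>(1)[OF \<open>\<gamma> < \<mu>\<close>] by auto
  qed
  have fin_cand: "finite (cand w)" if "finite w" for w using that by (simp add: cand_def)
  have R_le: "R w \<le> val w \<gamma>" if "finite w" "\<gamma> \<in> cand w" for w \<gamma>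
    using that fin_cand by (auto simp: R_def)
  have R_ex: "\<exists>\<gamma>\<in>cand w. R w = val w \<gamma>" if "finite w" "cand w \<noteq> {}" for w
  proof -
    have "Min (val w ` cand w) \<in> val w ` cand w"
      using that fin_cand by (intro Min_in) auto
    then obtain \<gamma> where "\<gamma> \<in> cand w" "Min (val w ` cand w) = val w \<gamma>" by blast
    then show ?thesis using that(2) by (auto simp: R_def)
  qed
  have R_single: "R {a} = \<mu>" for a by (simp add: R_def cand_def)
  have R_card: "infinite_cardinal (R w) \<and> R w \<le> \<mu>" if "finite w" "w \<noteq> {}" "w \<subseteq> {..<\<mu>}" for w
  proof (cases "cand w = {}")
    case False
    then show ?thesis using R_ex[OF that(1)] val[OF that(1,3)] by fastforce
  qed (use \<mu> in \<open>simp add: R_def\<close>)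
  have R_mono: "R w \<le> R u" if uw: "u \<noteq> {}" "u \<subseteq> w" "finite w" "w \<subseteq> {..<\<mu>}" for u w
  proof (cases "cand u = {}")
    case True
    have "w \<noteq> {}" using uw by blast
    then have "R w \<le> \<mu>" using R_card uw by blast
    then show ?thesis using True by (simp add: R_def)
  next
    case False
    have fu: "finite u" using uw finite_subset by blast
    then obtain \<gamma> where \<gamma>: "\<gamma> \<in> cand u" "R u = val u \<gamma>" using R_ex False by blast
    then have "\<gamma> \<in> cand w" using cand_mono[OF uw(1-3)] by blast
    then have "R w \<le> val w \<gamma>" using R_le uw(3) by blast
    also have "\<dots> \<le> val u \<gamma>"
    proof -
      have "\<gamma> < \<mu>" using \<gamma>(1) uw by (auto simp: cand_def)
      then show ?thesis unfolding val_def
        using cand[OF fu \<gamma>(1)] uw by (intro mono) auto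
    qed
    finally show ?thesis using \<gamma>(2) by simp
  qed
  define piv where "piv xs = (SOME i. i < length xs \<and> xs ! i \<in> cand (set xs) \<and>
    R (set xs) = val (set xs) (xs ! i))" for xs
  define low where "low xs = filter (\<lambda>i. xs ! i < xs ! piv xs) [0..<length xs]" for xs
  define ys where "ys xs = map ((!) xs) (low xs)" for xs
  define G where "G xs = (if length xs = 1 then 0 else low xs ! E (xs ! piv xs) (ys xs))" for xs
  define F where "F xs = to_nat (piv xs, low xs, J (xs ! piv xs) (ys xs))" for xs
  have "rank_coloring {..<\<mu>} R F G"
    unfolding rank_coloring_def
  proof (intro conjI allI impI; (elim conjE)?)
    fix u w assume "u \<noteq> {}" "u \<subseteq> w" "finite w" "w \<subseteq> {..<\<mu>}"
    then show "R w \<le> R u" by (rule R_mono)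
  next
    fix xs assume xs: "xs \<noteq> []" "distinct xs" "set xs \<subseteq> {..<\<mu>}"
    show "G xs < length xs"
      and "\<forall>b\<in>{..<\<mu>} - set xs. F (xs[G xs := b]) = F xs \<longrightarrow> R (insert b (set xs)) \<noteq> R (set xs)"
    proof (atomize (full), cases "length xs = 1")
      case True
      \<comment> \<open>the rank \<open>\<mu>\<close> of a single element drops whenever another one is added\<close>
      then obtain a where a: "xs = [a]" by (auto simp: length_Suc_conv)
      have "R {b, a} < \<mu>" if b: "b \<in> {..<\<mu>} - {a}" for b
      proof -
        have "cand {b, a} \<noteq> {}" using b by (auto simp: cand_def min_def)
        then obtain \<gamma> where "\<gamma> \<in> cand {b, a}" "R {b, a} = val {b, a} \<gamma>"
          using R_ex[of "{b, a}"] by auto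
        moreover have "{b, a} \<subseteq> {..<\<mu>}" using b xs(3) a by auto
        ultimately show ?thesis using val(2) by simp
      qed
      then show "G xs < length xs \<and> (\<forall>b\<in>{..<\<mu>} - set xs. F (xs[G xs := b]) = F xs \<longrightarrow>
          R (insert b (set xs)) \<noteq> R (set xs))"
        using True R_single by (auto simp: G_def a)
    next
      case False
      have "cand (set xs) \<noteq> {}"
      proof
        assume "cand (set xs) = {}"
        then have "set xs \<subseteq> {Min (set xs)}" by (auto simp: cand_def)
        then have "card (set xs) \<le> 1" 
          using card_mono[of "{Min (set xs)}" "set xs"] by simp
        then show False using distinct_card[OF xs(2)] False xs(1) by (cases xs) auto
      qed
      then obtain \<gamma> where "\<gamma> \<in> cand (set xs)" "R (set xs) = val (set xs) \<gamma>"
        using R_ex[of "set xs"] by auto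
      moreover from this(1) obtain i where "i < length xs" "xs ! i = \<gamma>"
        by (auto simp: cand_def in_set_conv_nth)
      ultimately have "\<exists>i. i < length xs \<and> xs ! i \<in> cand (set xs) \<and> R (set xs) = val (set xs) (xs ! i)"
        by blast
      from someI_ex[OF this] have p: "piv xs < length xs" "xs ! piv xs \<in> cand (set xs)"
        "R (set xs) = val (set xs) (xs ! piv xs)" unfolding piv_def by blast+
      define \<gamma> where "\<gamma> = xs ! piv xs"
      have \<gamma>\<mu>: "\<gamma> < \<mu>" using p(1) xs(3) nth_mem unfolding \<gamma>_def by blast
      have set_low: "set (low xs) = {i. i < length xs \<and> xs ! i < \<gamma>}" by (auto simp: low_def \<gamma>_def)
      have set_ys: "set (ys xs) = set xs \<inter> {..<\<gamma>}"
      proof -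
        have "set (ys xs) = (!) xs ` {i. i < length xs \<and> xs ! i < \<gamma>}"
          unfolding ys_def using set_low by simp
        also have "\<dots> = set xs \<inter> {..<\<gamma>}" by (auto simp: in_set_conv_nth)
        finally show ?thesis .
      qed
      have dlow: "distinct (low xs)" by (simp add: low_def)
      have "distinct (ys xs)"
        unfolding ys_def distinct_map set_low using dlow xs(2) by (auto simp: inj_on_def nth_eq_iff_index_eq)
      moreover have "ys xs \<noteq> []" using cand(1)[OF _ p(2)] set_ys unfolding \<gamma>_def by (metis List.finite_set set_empty)
      ultimately have ysp: "ys xs \<noteq> []" "distinct (ys xs)" "set (ys xs) \<subseteq> {..<\<gamma>}"
        using set_ys by auto
      define j where "j = E \<gamma> (ys xs)"
      have "j < length (ys xs)"
        and no: "\<And>b. b \<in> {..<\<gamma>} - set (ys xs) \<Longrightarrow> J \<gamma> ((ys xs)[j := b]) = J \<gamma> (ys xs) \<Longrightarrow>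
          r \<gamma> (insert b (set (ys xs))) \<noteq> r \<gamma> (set (ys xs))"
        using sys[OF \<gamma>\<mu>] ysp unfolding rank_coloring_def j_def by blast+
      then have j: "j < length (low xs)" by (simp add: ys_def)
      have G: "G xs = low xs ! j" using False by (simp add: G_def j_def \<gamma>_def)
      have "low xs ! j \<in> set (low xs)" using j by simp
      then have k: "G xs < length xs" "xs ! G xs < \<gamma>" unfolding set_low G[symmetric] by simp_all
      have "R (insert b (set xs)) \<noteq> R (set xs)"
        if b: "b \<in> {..<\<mu>} - set xs" "F (xs[G xs := b]) = F xs" for b
      proof
        assume eq: "R (insert b (set xs)) = R (set xs)"
        define zs where "zs = xs[G xs := b]"
        have F: "piv zs = piv xs" "low zs = low xs" "J (zs ! piv zs) (ys zs) = J \<gamma> (ys xs)"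
          using injD[OF inj_to_nat b(2)[unfolded F_def]] unfolding zs_def \<gamma>_def prod.inject
          by blast+
        have "G xs \<noteq> piv xs" using k(2) by (auto simp: \<gamma>_def)
        then have piv: "zs ! piv zs = \<gamma>" using F(1) by (simp add: zs_def \<gamma>_def)
        have "low xs ! j \<in> set (low zs)" using F(2) j by simp
        then have "zs ! G xs < \<gamma>" using G piv by (simp add: low_def)
        then have b\<gamma>: "b < \<gamma>" using k(1) by (simp add: zs_def)
        have "ys zs = (ys xs)[j := b]"
        proof (rule nth_equalityI)
          fix i assume "i < length (ys zs)"
          then have i: "i < length (low xs)" using F(2) by (simp add: ys_def)
          have "low xs ! i = low xs ! j \<longleftrightarrow> i = j" using dlow i j by (simp add: nth_eq_iff_index_eq)
          then show "ys zs ! i = (ys xs)[j := b] ! i"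
            using i F(2) k(1) by (auto simp: ys_def zs_def G nth_list_update)
        qed (simp add: ys_def F(2))
        then have "J \<gamma> ((ys xs)[j := b]) = J \<gamma> (ys xs)" using F(3) piv by simp
        then have ne: "r \<gamma> (insert b (set (ys xs))) \<noteq> r \<gamma> (set (ys xs))"
          using no b\<gamma> b(1) set_ys by blast
        have "R (insert b (set xs)) \<le> val (insert b (set xs)) \<gamma>"
          using cand_mono[of "set xs" "insert b (set xs)"] p(2) xs(1) unfolding \<gamma>_def
          by (intro R_le) auto
        also have "\<dots> = r \<gamma> (insert b (set (ys xs)))"
          using b\<gamma> by (simp add: val_def set_ys)
        finally have "r \<gamma> (set (ys xs)) \<le> r \<gamma> (insert b (set (ys xs)))"
          using eq p(3) by (simp add: val_def set_ys \<gamma>_def)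
        moreover have "r \<gamma> (insert b (set (ys xs))) \<le> r \<gamma> (set (ys xs))"
          using ysp b\<gamma> \<gamma>\<mu> by (intro mono) auto
        ultimately show False using ne by simp
      qed
      then show "G xs < length xs \<and> (\<forall>b\<in>{..<\<mu>} - set xs. F (xs[G xs := b]) = F xs \<longrightarrow>
          R (insert b (set xs)) \<noteq> R (set xs))"
        using k(1) by blast
    qed
  qed
  moreover have "cardinal_ranked \<mu> {..<\<mu>} R"
    unfolding cardinal_ranked_def using R_card R_single by blast
  ultimately show ?thesis by blast
qed

theorem ex_rank_coloring:
  "infinite_cardinal \<mu> \<Longrightarrow> \<exists>r J E. rank_coloring {..<\<mu>} r J E \<and> cardinal_ranked \<mu> {..<\<mu>} r"
proof (induction \<mu> rule: less_induct)
  case (less \<mu>)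
  show ?case
  proof (cases "\<exists>\<delta><\<mu>. infinite {..<\<delta>}")
    case False
    then have "rank_coloring {..<\<mu>} (\<lambda>_. \<mu>) (\<lambda>xs. card {..<last xs}) (\<lambda>xs. length xs - 1)"
      by (intro rank_coloring_omega) auto
    moreover have "cardinal_ranked \<mu> {..<\<mu>} (\<lambda>_. \<mu>)"
      using less.prems by (simp add: cardinal_ranked_def)
    ultimately show ?thesis by blast
  next
    case True
    have "\<exists>\<nu> r J E. \<nu> < \<mu> \<and> rank_coloring {..<\<gamma>} r J E \<and> cardinal_ranked \<nu> {..<\<gamma>} r"
      if \<gamma>: "\<gamma> < \<mu>" for \<gamma>
    proof -
      obtain \<nu> where \<nu>: "\<nu> < \<mu>" "infinite_cardinal \<nu>" "|{..<\<gamma>}| \<le>o |{..<\<nu>}|"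
        using ex_cardinal_above[OF \<gamma>] True by blast
      obtain g where g: "inj_on g {..<\<gamma>}" "g ` {..<\<gamma>} \<subseteq> {..<\<nu>}"
        using \<nu>(3) card_of_ordLeq[of "{..<\<gamma>}" "{..<\<nu>}"] by blast
      obtain r J E where "rank_coloring {..<\<nu>} r J E" "cardinal_ranked \<nu> {..<\<nu>} r"
        using less.IH[OF \<nu>(1,2)] by blast
      from rank_coloring_pullback[OF g this] show ?thesis using \<nu>(1) by blast
    qed
    then obtain \<nu> r J E where
      "\<And>\<gamma>. \<gamma> < \<mu> \<Longrightarrow> \<nu> \<gamma> < \<mu> \<and> rank_coloring {..<\<gamma>} (r \<gamma>) (J \<gamma>) (E \<gamma>) \<and> cardinal_ranked (\<nu> \<gamma>) {..<\<gamma>} (r \<gamma>)"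
      by metis
    then show ?thesis using rank_coloring_step[of \<mu> r J E \<nu>] less.prems by blast
  qed
qed

lemma card_less_sorted_list_nth:
  fixes w :: "'a :: linorder set"
  assumes "finite w" "i < card w"
  shows "card (w \<inter> {..<sorted_list_of_set w ! i}) = i"
proof -
  define xs where "xs = sorted_list_of_set w"
  have xs: "sorted xs" "distinct xs" "set xs = w" "length xs = card w"
    using assms(1) by (auto simp: xs_def)
  have less: "xs ! j < xs ! i \<longleftrightarrow> j < i" if "j < length xs" for j
    using sorted_nth_mono[OF xs(1), of i j] sorted_nth_mono[OF xs(1), of j i]
      nth_eq_iff_index_eq[OF xs(2) that, of i] that assms(2) xs(4)
    by (cases j i rule: linorder_cases) (auto simp: less_le)
  have "w \<inter> {..<xs ! i} = (!) xs ` {j. j < length xs \<and> xs ! j < xs ! i}"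
    using xs(3) by (auto simp: in_set_conv_nth)
  also have "{j. j < length xs \<and> xs ! j < xs ! i} = {..<i}" using less assms(2) xs(4) by auto
  finally have "card (w \<inter> {..<xs ! i}) = card ((!) xs ` {..<i})" by simp
  also have "\<dots> = i"
    using xs(2,4) assms(2) by (subst card_image) (auto simp: inj_on_def nth_eq_iff_index_eq)
  finally show ?thesis by (simp add: xs_def)
qed

text \<open>
  The element \<open>b\<close> lies below the \<open>k\<close>-th element of \<open>w\<close> and above its predecessors, so it takes over
  the position \<open>k\<close>.  This identifies the exchange in the axioms of YZR-systems with a list update.
\<close>

lemma sorted_list_of_set_exchange:
  fixes w :: "'a :: linorder set"
  assumes w: "finite w" "b \<notin> w" and k: "card (w \<inter> {..<b}) = k" "k < card w"
  shows "sorted_list_of_set ((w - {sorted_list_of_set w ! k}) \<union> {b}) = (sorted_list_of_set w)[k := b]"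
proof -
  define xs where "xs = sorted_list_of_set w"
  have xs: "sorted xs" "distinct xs" "set xs = w" "length xs = card w"
    using w(1) by (auto simp: xs_def)
  have below: "card (w \<inter> {..<xs ! i}) = i" if "i < length xs" for i
    using card_less_sorted_list_nth[OF w(1), of i] that xs(4) by (simp add: xs_def)
  have lo: "xs ! i < b" if i: "i < k" for i
  proof (rule ccontr)
    assume "\<not> xs ! i < b"
    then have "card (w \<inter> {..<b}) \<le> card (w \<inter> {..<xs ! i})"
      using w(1) by (intro card_mono) auto
    then show False using below[of i] k i xs(4) by simp
  qed
  have hi: "b < xs ! i" if i: "k \<le> i" "i < length xs" for i
  proof (rule ccontr)
    assume "\<not> b < xs ! i"
    moreover have mem: "xs ! i \<in> w" using i xs(3) nth_mem by metis
    ultimately have "xs ! i < b" using w(2) by (metis linorder_neqE)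
    then have "insert (xs ! i) (w \<inter> {..<xs ! i}) \<subseteq> w \<inter> {..<b}" using mem by auto
    then have "card (insert (xs ! i) (w \<inter> {..<xs ! i})) \<le> k"
      using k(1) w(1) by (metis card_mono finite_Int)
    then show False using below[OF i(2)] w(1) i(1) by simp
  qed
  have kl: "k < length xs" using k xs by simp
  have sorted: "sorted (xs[k := b])"
    unfolding sorted_wrt_iff_nth_less
  proof (intro allI impI)
    fix i j assume "i < j" "j < length (xs[k := b])"
    then show "xs[k := b] ! i \<le> xs[k := b] ! j"
      using sorted_nth_mono[OF xs(1), of i j] lo[of i] hi[of j]
      by (cases "i = k"; cases "j = k") (auto simp: less_imp_le)
  qed
  have dist: "distinct (xs[k := b])" using xs w(2) by (simp add: distinct_list_update)
  have set: "set (xs[k := b]) = (w - {xs ! k}) \<union> {b}"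
    using set_update_distinct[OF xs(2) kl] xs(3) by auto
  show ?thesis
    unfolding xs_def[symmetric] set[symmetric]
    using sorted dist by (simp add: sorted_list_of_set.idem_if_sorted_distinct)
qed

text \<open>
  The infinite cardinals below \<open>\<kappa>\<close> have order type \<open>\<epsilon>\<close>, and \<open>\<kappa>\<close> itself is put on top.
\<close>

lemma is_aleph_ordIso:
  assumes "is_aleph \<epsilon> \<kappa>" and "|{..<\<kappa>}| \<le>o |UNIV :: nat set set|"
  shows "\<exists>e. inj_on e {\<mu>. infinite_cardinal \<mu> \<and> \<mu> \<le> \<kappa>} \<and>
    mono_on {\<mu>. infinite_cardinal \<mu> \<and> \<mu> \<le> \<kappa>} e \<and> (\<forall>\<mu>\<le>\<kappa>. infinite_cardinal \<mu> \<longrightarrow> e \<mu> \<le> \<epsilon>) \<and> e \<kappa> = \<epsilon>"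
proof -
  define R where "R = {(x, y). x \<le> y \<and> y < \<kappa> \<and> infinite_cardinal x \<and> infinite_cardinal y}"
  have F: "Field R = {\<mu>. infinite_cardinal \<mu> \<and> \<mu> < \<kappa>}"
    by (auto simp: R_def Field_def)
  have "wf (R - Id)" by (rule wf_subset[OF wf]) (auto simp: R_def)
  then have R: "Well_order R"
    unfolding well_order_on_def linear_order_on_def partial_order_on_def preorder_on_def
      total_on_def F
    by (auto simp: R_def refl_on_def trans_def antisym_def)
  have "|Field R| \<le>o |{..<\<kappa>}|" by (rule card_of_mono1) (auto simp: F)
  then have "|Field R| \<le>o |UNIV :: nat set set|" using assms(2) ordLeq_transitive by blast
  then obtain \<alpha> where \<alpha>: "R =o below \<alpha>" using ex_below[OF R] by blast
  have "otype R = \<epsilon>" using assms(1) by (simp add: is_aleph_def R_def)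
  then have "R =o below \<epsilon>" using \<alpha> otype_eqI by blast
  then obtain f where f: "iso R (below \<epsilon>) f" by (auto simp: ordIso_def)
  then have bij: "bij_betw f (Field R) {..<\<epsilon>}" by (simp add: iso_def Field_below)
  define e where "e \<mu> = (if \<mu> = \<kappa> then \<epsilon> else f \<mu>)" for \<mu>
  have lt: "f \<mu> < \<epsilon>" if "infinite_cardinal \<mu>" "\<mu> < \<kappa>" for \<mu>
    using bij that F by (auto simp: bij_betw_def)
  have mono: "f \<mu> \<le> f \<nu>" if "infinite_cardinal \<mu>" "infinite_cardinal \<nu>" "\<mu> \<le> \<nu>" "\<nu> < \<kappa>" for \<mu> \<nu>
  proof -
    have "(\<mu>, \<nu>) \<in> R" using that by (simp add: R_def)
    then have "(f \<mu>, f \<nu>) \<in> below \<epsilon>" using f iso_forward by metis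
    then show ?thesis by (simp add: below_def)
  qed
  have "inj_on e {\<mu>. infinite_cardinal \<mu> \<and> \<mu> \<le> \<kappa>}"
  proof (rule inj_onI)
    fix \<mu> \<nu> assume "\<mu> \<in> {\<mu>. infinite_cardinal \<mu> \<and> \<mu> \<le> \<kappa>}" "\<nu> \<in> {\<mu>. infinite_cardinal \<mu> \<and> \<mu> \<le> \<kappa>}" "e \<mu> = e \<nu>"
    then show "\<mu> = \<nu>"
      using lt[of \<mu>] lt[of \<nu>] bij unfolding F bij_betw_def inj_on_def e_def
      by (auto split: if_splits)
  qed
  moreover have "mono_on {\<mu>. infinite_cardinal \<mu> \<and> \<mu> \<le> \<kappa>} e"
  proof (rule mono_onI)
    fix \<mu> \<nu> assume *: "\<mu> \<in> {\<mu>. infinite_cardinal \<mu> \<and> \<mu> \<le> \<kappa>}" "\<nu> \<in> {\<mu>. infinite_cardinal \<mu> \<and> \<mu> \<le> \<kappa>}" "\<mu> \<le> \<nu>"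
    then show "e \<mu> \<le> e \<nu>"
      using lt[of \<mu>] mono[of \<mu> \<nu>] by (auto simp: e_def less_imp_le)
  qed
  moreover have "e \<mu> \<le> \<epsilon>" if "\<mu> \<le> \<kappa>" "infinite_cardinal \<mu>" for \<mu>
    using lt[OF that(2)] that(1) by (auto simp: e_def less_imp_le)
  ultimately show ?thesis by (intro exI[of _ e]) (auto simp: e_def)
qed

theorem ex_yzr_system:
  assumes "ord_zero < \<epsilon>" "is_aleph \<epsilon> \<kappa>" "|{..<\<kappa>}| \<le>o |UNIV :: nat set set|"
  shows "\<exists>s. yzr_system \<epsilon> s \<and> ypts s = {..<\<kappa>}"
proof -
  have \<kappa>: "infinite_cardinal \<kappa>" using assms(2) by (simp add: is_aleph_def)
  obtain r J E where col: "rank_coloring {..<\<kappa>} r J E" and rk: "cardinal_ranked \<kappa> {..<\<kappa>} r"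
    using ex_rank_coloring[OF \<kappa>] by blast
  define C where "C = {\<mu>. infinite_cardinal \<mu> \<and> \<mu> \<le> \<kappa>}"
  obtain e where e: "inj_on e C" "mono_on C e" "\<And>\<mu>. \<mu> \<in> C \<Longrightarrow> e \<mu> \<le> \<epsilon>" "e \<kappa> = \<epsilon>"
    using is_aleph_ordIso[OF assms(2,3)] unfolding C_def by blast
  have rC: "r w \<in> C" if "finite w" "w \<noteq> {}" "w \<subseteq> {..<\<kappa>}" for w
    using rk that unfolding cardinal_ranked_def C_def by blast
  define s where "s = \<lparr>ypts = {..<\<kappa>}, yr = (\<lambda>w. e (r w)),
    yj = (\<lambda>w. J (sorted_list_of_set w)), yk = (\<lambda>w. E (sorted_list_of_set w))\<rparr>"
  have sl: "sorted_list_of_set w \<noteq> []" "distinct (sorted_list_of_set w)"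
    "set (sorted_list_of_set w) = w" "length (sorted_list_of_set w) = card w"
    if "finite w" "w \<noteq> {}" for w :: "ordinal set"
    using that by (auto simp: sorted_list_of_set_eq_Nil_iff)
  have "infinite {..<\<kappa>}" using \<kappa> by (simp add: infinite_cardinal_def)
  then have "{..<\<kappa>} \<noteq> {}" by (metis finite.emptyI)
  moreover have "e (r w) \<le> e (r u)" if "u \<noteq> {}" "u \<subseteq> w" "finite w" "w \<subseteq> {..<\<kappa>}" for u w
  proof -
    have "r w \<le> r u" using col that unfolding rank_coloring_def by blast
    moreover have "finite u" "w \<noteq> {}" "u \<subseteq> {..<\<kappa>}" using that finite_subset by blast+
    ultimately show ?thesis using e(2) rC that by (meson mono_onD)
  qed
  moreover have "E (sorted_list_of_set w) < card w \<and>
      \<not> (\<exists>b\<in>{..<\<kappa>} - w. card (w \<inter> {..<b}) = E (sorted_list_of_set w) \<and>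
        J (sorted_list_of_set ((w - {sorted_list_of_set w ! E (sorted_list_of_set w)}) \<union> {b})) =
          J (sorted_list_of_set w) \<and>
        e (r (w \<union> {b})) = e (r w))"
    if w: "finite w" "w \<noteq> {}" "w \<subseteq> {..<\<kappa>}" for w
  proof -
    let ?xs = "sorted_list_of_set w"
    have sub: "set ?xs \<subseteq> {..<\<kappa>}" using sl(3)[OF w(1,2)] w(3) by simp
    then have c: "E ?xs < card w" "\<And>b. b \<in> {..<\<kappa>} - w \<Longrightarrow> J (?xs[E ?xs := b]) = J ?xs \<Longrightarrow>
        r (insert b w) \<noteq> r w"
      using col sl[OF w(1,2)] unfolding rank_coloring_def by metis+
    have "e (r (w \<union> {b})) \<noteq> e (r w)"
      if b: "b \<in> {..<\<kappa>} - w" "card (w \<inter> {..<b}) = E ?xs"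
        "J (sorted_list_of_set ((w - {?xs ! E ?xs}) \<union> {b})) = J ?xs" for b
    proof -
      have "r (insert b w) \<noteq> r w"
        using c(2)[OF b(1)] b(3) sorted_list_of_set_exchange[OF w(1) _ b(2) c(1)] b(1) by auto
      moreover have "r (insert b w) \<in> C" "r w \<in> C" using rC w b(1) by auto
      ultimately show ?thesis using e(1) by (auto simp: inj_on_def)
    qed
    then show ?thesis using c(1) by blast
  qed
  moreover have "e (r w) \<le> \<epsilon>" if "finite w" "w \<noteq> {}" "w \<subseteq> {..<\<kappa>}" for w
    using e(3) rC that by blast
  moreover have "e (r {a}) > ord_zero" if "a < \<kappa>" for a
    using rk that e(4) assms(1) by (simp add: cardinal_ranked_def)
  ultimately have "yzr_system \<epsilon> s"
    unfolding yzr_system_def s_def by (simp only: yzr.simps) blast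
  then show ?thesis by (intro exI[of _ s]) (simp add: s_def)
qed

section \<open>Martin's Axiom and Delta-systems\<close>

text \<open>
  The axiom speaks about orders on sets of sets of natural numbers; an order of size at most the
  continuum has an isomorphic copy there.
\<close>

lemma martins_axiom_transfer:
  fixes P :: "'p set" and le :: "'p rel"
  assumes ma: "martins_axiom" and "P \<noteq> {}" and small: "|P| \<le>o |UNIV :: nat set set|"
    and pre: "preorder_on P le" and ccc: "ccc P le"
    and \<D>: "|\<D>| <o |UNIV :: nat set set|" "\<And>D. D \<in> \<D> \<Longrightarrow> dense_in P le D"
  shows "\<exists>G. filter_in P le G \<and> (\<forall>D\<in>\<D>. G \<inter> D \<noteq> {})"
proof -
  obtain f :: "'p \<Rightarrow> nat set" where f: "inj_on f P"
    using small card_of_ordLeq[of P "UNIV :: nat set set"] by auto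
  define le' where "le' = {(f p, f q) | p q. p \<in> P \<and> q \<in> P \<and> (p, q) \<in> le}"
  have le': "(f p, f q) \<in> le' \<longleftrightarrow> (p, q) \<in> le" if "p \<in> P" "q \<in> P" for p q
    using f that unfolding le'_def by (auto dest: inj_onD)
  have refl: "(p, p) \<in> le" if "p \<in> P" for p
    using pre that by (auto simp: preorder_on_def refl_on_def)
  have trans: "(p, r) \<in> le" if "(p, q) \<in> le" "(q, r) \<in> le" for p q r
    using pre that unfolding preorder_on_def by (meson transE)
  have "preorder_on (f ` P) le'"
    unfolding preorder_on_def
  proof (intro conjI)
    show "le' \<subseteq> f ` P \<times> f ` P" by (auto simp: le'_def)
    show "refl_on (f ` P) le'" unfolding refl_on_def using refl by (auto simp: le'_def)
    show "trans le'"
    proof (rule transI)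
      fix x y z assume "(x, y) \<in> le'" "(y, z) \<in> le'"
      then obtain p q q' r where *: "x = f p" "y = f q" "y = f q'" "z = f r"
        "p \<in> P" "q \<in> P" "q' \<in> P" "r \<in> P" "(p, q) \<in> le" "(q', r) \<in> le"
        unfolding le'_def by blast
      then have "q = q'" using f by (auto dest: inj_onD)
      then show "(x, z) \<in> le'" using * trans[of p q r] by (auto simp: le'_def)
    qed
  qed
  moreover have "ccc (f ` P) le'"
    unfolding ccc_def
  proof (intro allI impI)
    fix A' assume A': "A' \<subseteq> f ` P"
      and anti: "\<forall>p\<in>A'. \<forall>q\<in>A'. p \<noteq> q \<longrightarrow> \<not> compatible_in (f ` P) le' p q"
    define A where "A = {p \<in> P. f p \<in> A'}"
    have "\<not> compatible_in P le p q" if "p \<in> A" "q \<in> A" "p \<noteq> q" for p q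
    proof
      assume "compatible_in P le p q"
      then obtain s where "s \<in> P" "(s, p) \<in> le" "(s, q) \<in> le" by (auto simp: compatible_in_def)
      then have "compatible_in (f ` P) le' (f p) (f q)"
        using that le' unfolding compatible_in_def A_def by blast
      moreover have "f p \<noteq> f q" using that f by (auto simp: A_def dest: inj_onD)
      ultimately show False using anti that by (auto simp: A_def)
    qed
    moreover have "A \<subseteq> P" by (auto simp: A_def)
    ultimately have "countable A" using ccc[unfolded ccc_def, rule_format, of A] by simp
    moreover have "A' = f ` A" using A' by (auto simp: A_def)
    ultimately show "countable A'" by simp
  qed
  moreover have "|(`) f ` \<D>| <o |UNIV :: nat set set|"
    using \<D>(1) card_of_image ordLeq_ordLess_trans by blast
  moreover have "\<forall>D'\<in>(`) f ` \<D>. dense_in (f ` P) le' D'"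
  proof
    fix D' assume "D' \<in> (`) f ` \<D>"
    then obtain D where D: "D' = f ` D" "dense_in P le D" using \<D>(2) by blast
    show "dense_in (f ` P) le' D'"
      unfolding dense_in_def
    proof (intro conjI ballI)
      show "D' \<subseteq> f ` P" using D by (auto simp: dense_in_def)
      fix x assume "x \<in> f ` P"
      then obtain p where p: "p \<in> P" "x = f p" by blast
      then obtain d where "d \<in> D" "(d, p) \<in> le" using D(2) by (auto simp: dense_in_def)
      then show "\<exists>d\<in>D'. (d, x) \<in> le'"
        using D p le' by (intro bexI[of _ "f d"]) (auto simp: dense_in_def)
    qed
  qed
  moreover have "f ` P \<noteq> {}" using \<open>P \<noteq> {}\<close> by simp
  ultimately obtain G' where G': "filter_in (f ` P) le' G'" "\<forall>D\<in>(`) f ` \<D>. G' \<inter> D \<noteq> {}"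
    using ma unfolding martins_axiom_def by meson
  define G where "G = {p \<in> P. f p \<in> G'}"
  have G'G: "G' = f ` G" using G'(1) by (auto simp: G_def filter_in_def)
  have "filter_in P le G"
    unfolding filter_in_def
  proof (intro conjI ballI impI)
    show "G \<subseteq> P" by (auto simp: G_def)
    show "G \<noteq> {}" using G'(1) G'G by (auto simp: filter_in_def)
  next
    fix p q assume "p \<in> G" "q \<in> P" "(p, q) \<in> le"
    then show "q \<in> G" using G'(1) le' unfolding filter_in_def G_def by blast
  next
    fix p q assume pq: "p \<in> G" "q \<in> G"
    then obtain s' where "s' \<in> G'" "(s', f p) \<in> le'" "(s', f q) \<in> le'"
      using G'(1) unfolding filter_in_def G_def by blast
    moreover from this(1) obtain s where "s \<in> G" "s' = f s" using G'G by blast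
    ultimately show "\<exists>s\<in>G. (s, p) \<in> le \<and> (s, q) \<in> le"
      using pq le' unfolding G_def by blast
  qed
  moreover have "G \<inter> D \<noteq> {}" if "D \<in> \<D>" for D
  proof -
    obtain x where "x \<in> G'" "x \<in> f ` D" using G'(2) \<open>D \<in> \<D>\<close> by blast
    then obtain d where d: "d \<in> D" "f d \<in> G'" by blast
    then have "d \<in> P" using \<D>(2)[OF that] by (auto simp: dense_in_def)
    then show ?thesis using d by (auto simp: G_def)
  qed
  ultimately show ?thesis by blast
qed

lemma uncountable_fibre:
  assumes "uncountable A" "countable (f ` A)"
  shows "\<exists>y. uncountable {a \<in> A. f a = y}"
proof (rule ccontr)
  assume "\<not> ?thesis"
  then have "countable (\<Union>y\<in>f ` A. {a \<in> A. f a = y})" using assms(2) by blast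
  moreover have "(\<Union>y\<in>f ` A. {a \<in> A. f a = y}) = A" by blast
  ultimately show False using assms(1) by simp
qed

text \<open>
  Two members of a Delta-system of functions are enough for the chain condition, and they can be found
  directly.  Let \<open>u \<subseteq> w\<close> be maximal such that uncountably many of the functions agree on \<open>u\<close>.
  Among these, each value at a point outside \<open>u\<close> is taken only countably often, so that all but
  countably many of them avoid the values of a given one.
\<close>

lemma delta_system_pair:
  fixes \<tau> :: "'p \<Rightarrow> 'a \<Rightarrow> 'b"
  assumes A: "uncountable A" and w: "finite w"
  shows "\<exists>p\<in>A. \<exists>q\<in>A. p \<noteq> q \<and> (\<exists>u\<subseteq>w. (\<forall>x\<in>u. \<tau> p x = \<tau> q x) \<and> \<tau> p ` (w - u) \<inter> \<tau> q ` (w - u) = {})"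
proof -
  define fib where "fib u t = {p \<in> A. \<forall>x\<in>u. \<tau> p x = t x}" for u t
  define U where "U = {u. u \<subseteq> w \<and> (\<exists>t. uncountable (fib u t))}"
  have "finite U" by (rule finite_subset[of _ "Pow w"]) (use w in \<open>auto simp: U_def\<close>)
  moreover have "{} \<in> U" using A by (auto simp: U_def fib_def)
  ultimately obtain u where u: "u \<in> U" and max: "\<And>v. v \<in> U \<Longrightarrow> u \<subseteq> v \<Longrightarrow> u = v"
    using finite_has_maximal[of U] by blast
  obtain t where t: "u \<subseteq> w" "uncountable (fib u t)" using u by (auto simp: U_def)
  have thin: "countable {p \<in> fib u t. \<tau> p a = y}" if a: "a \<in> w - u" for a y
  proof (rule ccontr)
    assume unc: "uncountable {p \<in> fib u t. \<tau> p a = y}"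
    have "{p \<in> fib u t. \<tau> p a = y} = fib (insert a u) (t(a := y))"
      using a unfolding fib_def by auto
    then have "insert a u \<in> U" using unc t(1) a unfolding U_def by auto
    then have "u = insert a u" using max by blast
    then show False using a by blast
  qed
  have "fib u t \<noteq> {}" using t(2) by auto
  then obtain p where p: "p \<in> fib u t" by blast
  define bad where "bad = insert p (\<Union>a\<in>w - u. \<Union>b\<in>w - u. {q \<in> fib u t. \<tau> q a = \<tau> p b})"
  have "countable bad"
    unfolding bad_def
  proof (intro countable_insert countable_UN)
    show "countable (w - u)" "countable (w - u)" using w by (simp_all add: countable_finite)
  qed (rule thin)
  then have "\<not> fib u t \<subseteq> bad" using t(2) countable_subset by blast
  then obtain q where q: "q \<in> fib u t" "q \<notin> bad" by blast
  have "\<tau> q b \<noteq> \<tau> p a" if "a \<in> w - u" "b \<in> w - u" for a b using q that by (auto simp: bad_def)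
  then have "\<tau> p ` (w - u) \<inter> \<tau> q ` (w - u) = {}" by force
  moreover have "\<forall>x\<in>u. \<tau> p x = \<tau> q x" "p \<noteq> q" "p \<in> A" "q \<in> A"
    using p q by (auto simp: fib_def bad_def)
  ultimately show ?thesis using t(1) by blast
qed

section \<open>Quasi-embeddings between YZR-systems\<close>

lemma quasi_embedding_cong:
  assumes "quasi_embedding q s \<phi>" "\<And>a. a \<in> ypts q \<Longrightarrow> \<psi> a = \<phi> a"
  shows "quasi_embedding q s \<psi>"
proof -
  have im: "\<psi> ` v = \<phi> ` v" if "v \<subseteq> ypts q" for v
    using assms(2) that by (intro image_cong) auto
  show ?thesis
    using assms unfolding quasi_embedding_def strict_mono_on_def by (simp add: im)
qed

lemma quasi_embedding_trans:
  assumes "quasi_embedding q (s\<lparr>ypts := Y\<rparr>) \<phi>" "quasi_embedding (s\<lparr>ypts := Y\<rparr>) t \<psi>"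
  shows "quasi_embedding q t (\<psi> \<circ> \<phi>)"
  unfolding quasi_embedding_def
proof (intro conjI allI impI; (elim conjE)?)
  have Y: "\<phi> ` ypts q \<subseteq> Y" using assms(1) by (simp add: quasi_embedding_def)
  show "strict_mono_on (ypts q) (\<psi> \<circ> \<phi>)"
    using assms Y unfolding quasi_embedding_def strict_mono_on_def by (simp add: image_subset_iff)
  show "(\<psi> \<circ> \<phi>) ` ypts q \<subseteq> ypts t"
    using assms(2) Y by (force simp: quasi_embedding_def)
  fix v assume v: "finite v" "v \<noteq> {}" "v \<subseteq> ypts q"
  have v': "finite (\<phi> ` v)" "\<phi> ` v \<noteq> {}" "\<phi> ` v \<subseteq> Y" using v Y by auto
  have 1: "yr s (\<phi> ` v) = yr q v" "yk s (\<phi> ` v) = yk q v" "ord_zero < yr q v \<Longrightarrow> yj s (\<phi> ` v) = yj q v"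
    using assms(1) v by (simp_all add: quasi_embedding_def)
  have 2: "yr t (\<psi> ` \<phi> ` v) = yr s (\<phi> ` v)" "yk t (\<psi> ` \<phi> ` v) = yk s (\<phi> ` v)"
    "ord_zero < yr s (\<phi> ` v) \<Longrightarrow> yj t (\<psi> ` \<phi> ` v) = yj s (\<phi> ` v)"
    using assms(2) v' by (simp_all add: quasi_embedding_def)
  show "yr t ((\<psi> \<circ> \<phi>) ` v) = yr q v" "yk t ((\<psi> \<circ> \<phi>) ` v) = yk q v"
    using 1 2 by (simp_all add: image_comp)
  assume "ord_zero < yr q v"
  then show "yj t ((\<psi> \<circ> \<phi>) ` v) = yj q v" using 1 2 by (simp add: image_comp)
qed

lemma quasi_embedding_inj: "quasi_embedding q s \<phi> \<Longrightarrow> inj_on \<phi> (ypts q)"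
  by (simp add: quasi_embedding_def strict_mono_on_imp_inj_on)

text \<open>
  Colors need to agree only where the rank is positive, and the rank is the same on both sides.  So
  being a quasi-embedding is inherited by the inverse.
\<close>

lemma quasi_embedding_inv:
  assumes "quasi_embedding (s\<lparr>ypts := u\<rparr>) t \<chi>"
  shows "quasi_embedding (t\<lparr>ypts := \<chi> ` u\<rparr>) (s\<lparr>ypts := u\<rparr>) (inv_into u \<chi>)"
  unfolding quasi_embedding_def
proof (intro conjI allI impI; (elim conjE)?)
  let ?\<tau> = "inv_into u \<chi>"
  have inj: "inj_on \<chi> u" using quasi_embedding_inj[OF assms] by simp
  have sm: "\<chi> a < \<chi> b \<longleftrightarrow> a < b" if "a \<in> u" "b \<in> u" for a b
    using assms that unfolding quasi_embedding_def strict_mono_on_def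
    by simp (metis less_asym linorder_neqE)
  show "strict_mono_on (ypts (t\<lparr>ypts := \<chi> ` u\<rparr>)) ?\<tau>"
    unfolding strict_mono_on_def using sm inj by auto
  show "?\<tau> ` ypts (t\<lparr>ypts := \<chi> ` u\<rparr>) \<subseteq> ypts (s\<lparr>ypts := u\<rparr>)"
    using inj by auto
  fix v assume v: "finite v" "v \<noteq> {}" "v \<subseteq> ypts (t\<lparr>ypts := \<chi> ` u\<rparr>)"
  then have v': "finite (?\<tau> ` v)" "?\<tau> ` v \<noteq> {}" "?\<tau> ` v \<subseteq> u" "\<chi> ` ?\<tau> ` v = v"
    using image_inv_into_cancel[of \<chi> u "\<chi> ` u" v] inj by auto
  have *: "yr t (\<chi> ` ?\<tau> ` v) = yr s (?\<tau> ` v)" "yk t (\<chi> ` ?\<tau> ` v) = yk s (?\<tau> ` v)"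
    "ord_zero < yr s (?\<tau> ` v) \<Longrightarrow> yj t (\<chi> ` ?\<tau> ` v) = yj s (?\<tau> ` v)"
    using assms v'(1-3) by (simp_all add: quasi_embedding_def)
  show "yr (s\<lparr>ypts := u\<rparr>) (?\<tau> ` v) = yr (t\<lparr>ypts := \<chi> ` u\<rparr>) v"
    "yk (s\<lparr>ypts := u\<rparr>) (?\<tau> ` v) = yk (t\<lparr>ypts := \<chi> ` u\<rparr>) v"
    using * unfolding v'(4) by simp_all
  assume "ord_zero < yr (t\<lparr>ypts := \<chi> ` u\<rparr>) v"
  then show "yj (s\<lparr>ypts := u\<rparr>) (?\<tau> ` v) = yj (t\<lparr>ypts := \<chi> ` u\<rparr>) v"
    using * unfolding v'(4) by simp
qed

lemma quasi_embedding_mono: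
  assumes "quasi_embedding q (s\<lparr>ypts := Y\<rparr>) \<phi>" "Y \<subseteq> Z"
  shows "quasi_embedding q (s\<lparr>ypts := Z\<rparr>) \<phi>"
  using assms unfolding quasi_embedding_def by simp blast

lemma yzr_systemD:
  assumes "yzr_system \<epsilon> s"
  shows "finite w \<Longrightarrow> w \<noteq> {} \<Longrightarrow> w \<subseteq> ypts s \<Longrightarrow> yr s w \<le> \<epsilon>"
    and "u \<noteq> {} \<Longrightarrow> u \<subseteq> w \<Longrightarrow> finite w \<Longrightarrow> w \<subseteq> ypts s \<Longrightarrow> yr s w \<le> yr s u"
    and "a \<in> ypts s \<Longrightarrow> ord_zero < yr s {a}"
    and "finite w \<Longrightarrow> w \<noteq> {} \<Longrightarrow> w \<subseteq> ypts s \<Longrightarrow> yk s w < card w"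
    and "finite w \<Longrightarrow> w \<noteq> {} \<Longrightarrow> w \<subseteq> ypts s \<Longrightarrow> b \<in> ypts s - w \<Longrightarrow> card (w \<inter> {..<b}) = yk s w \<Longrightarrow>
      yj s ((w - {sorted_list_of_set w ! yk s w}) \<union> {b}) = yj s w \<Longrightarrow> yr s (w \<union> {b}) \<noteq> yr s w"
  using assms unfolding yzr_system_def by simp_all

lemma yzr_system_restrict:
  assumes "yzr_system \<epsilon> s" "u \<subseteq> ypts s" "u \<noteq> {}"
  shows "yzr_system \<epsilon> (s\<lparr>ypts := u\<rparr>)"
proof -
  have sub: "w \<subseteq> ypts s" if "w \<subseteq> u" for w using that assms(2) by blast
  note s = yzr_systemD[OF assms(1)]
  show ?thesis
    unfolding yzr_system_def
  proof (intro conjI allI impI ballI; (elim conjE)?)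
    show "ypts (s\<lparr>ypts := u\<rparr>) \<noteq> {}" using assms(3) by simp
  next
    fix w assume w: "finite w" "w \<noteq> {}" "w \<subseteq> ypts (s\<lparr>ypts := u\<rparr>)"
    then have w': "w \<subseteq> ypts s" using sub by simp
    show "yr (s\<lparr>ypts := u\<rparr>) w \<le> \<epsilon>" "yk (s\<lparr>ypts := u\<rparr>) w < card w"
      using s(1,4)[OF w(1,2) w'] by simp_all
    show "\<not> (\<exists>b\<in>ypts (s\<lparr>ypts := u\<rparr>) - w.
             card (w \<inter> {..<b}) = yk (s\<lparr>ypts := u\<rparr>) w \<and>
             yj (s\<lparr>ypts := u\<rparr>) ((w - {sorted_list_of_set w ! yk (s\<lparr>ypts := u\<rparr>) w}) \<union> {b}) =
               yj (s\<lparr>ypts := u\<rparr>) w \<and>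
             yr (s\<lparr>ypts := u\<rparr>) (w \<union> {b}) = yr (s\<lparr>ypts := u\<rparr>) w)"
      using s(5)[OF w(1,2) w'] assms(2) by auto
  next
    fix v w assume "v \<noteq> {}" "v \<subseteq> w" "finite w" "w \<subseteq> ypts (s\<lparr>ypts := u\<rparr>)"
    then show "yr (s\<lparr>ypts := u\<rparr>) w \<le> yr (s\<lparr>ypts := u\<rparr>) v"
      using s(2)[of v w] sub[of w] by simp
  next
    fix a assume "a \<in> ypts (s\<lparr>ypts := u\<rparr>)"
    then show "ord_zero < yr (s\<lparr>ypts := u\<rparr>) {a}" using s(3) assms(2) by auto
  qed
qed

lemma sorted_list_of_set_nth_card:
  fixes w :: "'a :: linorder set"
  assumes "finite w" "x \<in> w"
  shows "sorted_list_of_set w ! card (w \<inter> {..<x}) = x"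
proof -
  obtain i where "i < card w" "sorted_list_of_set w ! i = x"
    using assms by (metis in_set_conv_nth sorted_list_of_set.length_sorted_key_list_of_set set_sorted_list_of_set)
  then show ?thesis using card_less_sorted_list_nth[OF assms(1), of i] by simp
qed

lemma ord_zero_le: "ord_zero \<le> \<alpha>"
  unfolding ord_zero_def by (rule Least_le) simp

text \<open>
  The exchange of \<open>x\<close> for \<open>y\<close> keeps the color, and the rank of \<open>V \<union> {x}\<close> cannot drop below \<open>0\<close>
  when \<open>y\<close> is added.  As \<open>y < x\<close> has the same elements of \<open>V\<close> below it, the last axiom of YZR-systems
  is violated.
\<close>

lemma yzr_no_twins:
  assumes s: "yzr_system \<epsilon> s" and V: "finite V" "V \<subseteq> ypts s" "x \<in> ypts s" "y \<in> ypts s" "y < x" "x \<notin> V" "y \<notin> V"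
    and zero: "yr s (V \<union> {x}) = ord_zero"
    and k: "yk s (V \<union> {x}) = card (V \<inter> {..<x})" "card (V \<inter> {..<x}) = card (V \<inter> {..<y})"
    and j: "yj s (V \<union> {y}) = yj s (V \<union> {x})"
  shows False
proof -
  let ?w = "V \<union> {x}"
  have w: "finite ?w" "?w \<noteq> {}" "?w \<subseteq> ypts s" using V by auto
  have int: "?w \<inter> {..<x} = V \<inter> {..<x}" "?w \<inter> {..<y} = V \<inter> {..<y}" using V(5) by auto
  have "sorted_list_of_set ?w ! yk s ?w = x"
    using sorted_list_of_set_nth_card[OF w(1), of x] k(1) int(1) by simp
  then have "(?w - {sorted_list_of_set ?w ! yk s ?w}) \<union> {y} = V \<union> {y}" using V(6) by auto
  then have "yr s (?w \<union> {y}) \<noteq> yr s ?w"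
    using V k j int by (intro yzr_systemD(5)[OF s w]) auto
  moreover have "yr s (?w \<union> {y}) \<le> yr s ?w"
    using V by (intro yzr_systemD(2)[OF s]) auto
  ultimately show False using zero ord_zero_le by (metis order_antisym)
qed

section \<open>Forcing with finite pieces of bricks\<close>

lemma brick_leD:
  assumes "brick_le \<iota> b b'"
  shows "bk_w b \<subseteq> bk_w b'" "bk_n b \<le> bk_n b'" "\<And>x. x \<in> bk_w b \<Longrightarrow> prefix (bk_eta b x) (bk_eta b' x)"
    "\<And>x y i. x \<in> bk_w b \<Longrightarrow> y \<in> bk_w b \<Longrightarrow> x \<noteq> y \<Longrightarrow> i < \<iota> \<Longrightarrow> bk_h b' i x y = bk_h b i x y"
    "\<And>x y i. x \<in> bk_w b \<Longrightarrow> y \<in> bk_w b \<Longrightarrow> x \<noteq> y \<Longrightarrow> i < \<iota> \<Longrightarrow> prefix (bk_g b i x y) (bk_g b' i x y)"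
  using assms unfolding brick_le_def offdiag_def by auto

lemma brick_le_trans:
  assumes 1: "brick_le \<iota> b b'" and 2: "brick_le \<iota> b' b''"
  shows "brick_le \<iota> b b''"
proof -
  have sub: "x \<in> bk_w b'" if "x \<in> bk_w b" for x using brick_leD(1)[OF 1] that by blast
  have "prefix (bk_eta b x) (bk_eta b'' x)" if "x \<in> bk_w b" for x
    using brick_leD(3)[OF 1 that] brick_leD(3)[OF 2 sub[OF that]] by (rule prefix_order.trans)
  moreover have "bk_h b'' i x y = bk_h b i x y \<and> prefix (bk_g b i x y) (bk_g b'' i x y)"
    if *: "x \<in> bk_w b" "y \<in> bk_w b" "x \<noteq> y" "i < \<iota>" for x y i
    using brick_leD(4,5)[OF 1 *] brick_leD(4,5)[OF 2 sub[OF *(1)] sub[OF *(2)] *(3,4)]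
    by (auto intro: prefix_order.trans)
  moreover have "bk_w b \<subseteq> bk_w b''" "bk_n b \<le> bk_n b''"
    using brick_leD(1,2)[OF 1] brick_leD(1,2)[OF 2] by auto
  ultimately show ?thesis unfolding brick_le_def offdiag_def by simp
qed

type_synonym condition = "nat \<times> ordinal set \<times> (ordinal \<Rightarrow> nat)"

text \<open>
  A sequence of bricks as provided by controlled amalgamation, and a YZR-system on \<open>\<kappa>\<close>: the finite
  pieces of \<open>s\<close> embed into \<open>S\<close> by cuteness, and from there into the bricks.
\<close>

locale amalgamating_bricks =
  fixes \<epsilon> \<kappa> :: ordinal and \<iota> :: nat and S :: "nat yzr" and T :: "nat \<Rightarrow> bit list set"
    and c :: "nat \<Rightarrow> nat" and B :: "nat \<Rightarrow> brick" and s :: "ordinal yzr"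
  assumes cute: "cute \<epsilon> S"
    and s: "yzr_system \<epsilon> s" "ypts s = {..<\<kappa>}"
    and infinite: "infinite {..<\<kappa>}"
    and brick: "\<And>n. is_brick S \<iota> T c (B n)"
    and chain: "\<And>n. brick_le \<iota> (B n) (B (Suc n))"
    and cover: "(\<Union>n. bk_w (B n)) = UNIV"
    and long: "filterlim (\<lambda>n. bk_n (B n)) at_top sequentially"
    and amalgamate: "\<forall>n u w \<pi>\<^sub>0 \<pi>\<^sub>1.
           u \<subseteq> w \<and> w \<subseteq> bk_w (B n) \<and> card w \<ge> 3 \<and>
           (\<forall>v \<delta>. v \<subseteq> u \<and> \<delta> \<in> w - u \<and> yr S (v \<union> {\<delta>}) = ord_zero \<longrightarrow>
              yk S (v \<union> {\<delta>}) \<noteq> card (v \<inter> {..<\<delta>})) \<and>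
           quasi_embedding_on S w \<pi>\<^sub>0 \<and> quasi_embedding_on S w \<pi>\<^sub>1 \<and>
           (\<forall>a\<in>u. \<pi>\<^sub>0 a = \<pi>\<^sub>1 a) \<and> \<pi>\<^sub>0 ` (w - u) \<inter> \<pi>\<^sub>1 ` (w - u) = {} \<longrightarrow>
           (\<exists>K \<pi>. quasi_embedding_on S (\<pi>\<^sub>0 ` w \<union> \<pi>\<^sub>1 ` w) \<pi> \<and>
              \<pi> ` (\<pi>\<^sub>0 ` w \<union> \<pi>\<^sub>1 ` w) \<subseteq> bk_w (B K) \<and>
              brick_le \<iota> (brick_image (\<pi> \<circ> \<pi>\<^sub>0) (brick_restrict \<iota> T c (B n) w))
                         (brick_restrict \<iota> T c (B K) ((\<pi> \<circ> \<pi>\<^sub>0) ` w)) \<and>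
              brick_le \<iota> (brick_image (\<pi> \<circ> \<pi>\<^sub>1) (brick_restrict \<iota> T c (B n) w))
                         (brick_restrict \<iota> T c (B K) ((\<pi> \<circ> \<pi>\<^sub>1) ` w)))"
    and extend: "\<forall>n w u \<pi>\<^sub>0.
           w \<subseteq> bk_w (B n) \<and> card w \<ge> 3 \<and> quasi_embedding_on S w \<pi>\<^sub>0 \<and>
           finite u \<and> \<pi>\<^sub>0 ` w \<subseteq> u \<longrightarrow>
           (\<exists>K \<pi>. quasi_embedding_on S u \<pi> \<and> \<pi> ` u \<subseteq> bk_w (B K) \<and>
              brick_le \<iota> (brick_image (\<pi> \<circ> \<pi>\<^sub>0) (brick_restrict \<iota> T c (B n) w))
                         (brick_restrict \<iota> T c (B K) ((\<pi> \<circ> \<pi>\<^sub>0) ` w)))"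
begin

lemma S: "yzr_system \<epsilon> S" "ypts S = UNIV"
  using cute by (simp_all add: cute_def)

lemma brick_mono: "m \<le> n \<Longrightarrow> brick_le \<iota> (B m) (B n)"
proof (induction rule: dec_induct)
  case base
  show ?case by (auto simp: brick_le_def)
next
  case (step n)
  show ?case by (rule brick_le_trans[OF step.IH chain])
qed

text \<open>
  The condition \<open>(K, u, \<chi>)\<close> stands for the copy on \<open>u\<close> of the brick \<open>B K\<close>, restricted to the range of
  \<open>\<chi>\<close>.  At least three points are required because the amalgamation properties concern sets of at
  least three points.  The value \<open>0\<close> outside \<open>u\<close> makes \<open>\<chi>\<close> a finite object, which keeps the number
  of conditions small.
\<close>

definition conds :: "condition set" where
  "conds = {(K, u, \<chi>). finite u \<and> 3 \<le> card u \<and> u \<subseteq> {..<\<kappa>} \<and>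
     quasi_embedding (s\<lparr>ypts := u\<rparr>) S \<chi> \<and> \<chi> ` u \<subseteq> bk_w (B K) \<and> (\<forall>\<alpha>. \<alpha> \<notin> u \<longrightarrow> \<chi> \<alpha> = 0)}"

text \<open>
  The stronger condition comes first.  What grows is the brick copied to the domain; the embedding into
  \<open>S\<close> may be a completely different one.
\<close>

definition ext :: "condition rel" where
  "ext = {((K', u', \<chi>'), (K, u, \<chi>)). (K', u', \<chi>') \<in> conds \<and> (K, u, \<chi>) \<in> conds \<and>
     u \<subseteq> u' \<and> bk_n (B K) \<le> bk_n (B K') \<and>
     (\<forall>\<alpha>\<in>u. prefix (bk_eta (B K) (\<chi> \<alpha>)) (bk_eta (B K') (\<chi>' \<alpha>))) \<and>
     (\<forall>\<alpha>\<in>u. \<forall>\<beta>\<in>u. \<alpha> \<noteq> \<beta> \<longrightarrow> (\<forall>i<\<iota>.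
        bk_h (B K') i (\<chi>' \<alpha>) (\<chi>' \<beta>) = bk_h (B K) i (\<chi> \<alpha>) (\<chi> \<beta>) \<and>
        prefix (bk_g (B K) i (\<chi> \<alpha>) (\<chi> \<beta>)) (bk_g (B K') i (\<chi>' \<alpha>) (\<chi>' \<beta>))))}"

lemma condsD:
  assumes "(K, u, \<chi>) \<in> conds"
  shows "finite u" "3 \<le> card u" "u \<subseteq> {..<\<kappa>}" "quasi_embedding (s\<lparr>ypts := u\<rparr>) S \<chi>"
    "\<chi> ` u \<subseteq> bk_w (B K)" "\<And>\<alpha>. \<alpha> \<notin> u \<Longrightarrow> \<chi> \<alpha> = 0" "inj_on \<chi> u"
  using assms quasi_embedding_inj[of "s\<lparr>ypts := u\<rparr>" S \<chi>] by (auto simp: conds_def)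

lemma extD:
  assumes "((K', u', \<chi>'), (K, u, \<chi>)) \<in> ext"
  shows "(K', u', \<chi>') \<in> conds" "(K, u, \<chi>) \<in> conds" "u \<subseteq> u'" "bk_n (B K) \<le> bk_n (B K')"
    "\<And>\<alpha>. \<alpha> \<in> u \<Longrightarrow> prefix (bk_eta (B K) (\<chi> \<alpha>)) (bk_eta (B K') (\<chi>' \<alpha>))"
    "\<And>\<alpha> \<beta> i. \<alpha> \<in> u \<Longrightarrow> \<beta> \<in> u \<Longrightarrow> \<alpha> \<noteq> \<beta> \<Longrightarrow> i < \<iota> \<Longrightarrow>
       bk_h (B K') i (\<chi>' \<alpha>) (\<chi>' \<beta>) = bk_h (B K) i (\<chi> \<alpha>) (\<chi> \<beta>)"
    "\<And>\<alpha> \<beta> i. \<alpha> \<in> u \<Longrightarrow> \<beta> \<in> u \<Longrightarrow> \<alpha> \<noteq> \<beta> \<Longrightarrow> i < \<iota> \<Longrightarrow>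
       prefix (bk_g (B K) i (\<chi> \<alpha>) (\<chi> \<beta>)) (bk_g (B K') i (\<chi>' \<alpha>) (\<chi>' \<beta>))"
  using assms unfolding ext_def by blast+

lemma preorder_ext: "preorder_on conds ext"
  unfolding preorder_on_def
proof (intro conjI)
  show "ext \<subseteq> conds \<times> conds" by (auto simp: ext_def)
  show "refl_on conds ext" unfolding refl_on_def ext_def by auto
  show "trans ext"
  proof (rule transI)
    fix p q r assume "(p, q) \<in> ext" "(q, r) \<in> ext"
    moreover obtain K u \<chi> where p: "p = (K, u, \<chi>)" by (cases p)
    moreover obtain K' u' \<chi>' where q: "q = (K', u', \<chi>')" by (cases q)
    moreover obtain K'' u'' \<chi>'' where r: "r = (K'', u'', \<chi>'')" by (cases r)
    ultimately have 1: "((K, u, \<chi>), (K', u', \<chi>')) \<in> ext" and 2: "((K', u', \<chi>'), (K'', u'', \<chi>'')) \<in> ext"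
      by simp_all
    have sub: "\<alpha> \<in> u'" if "\<alpha> \<in> u''" for \<alpha> using extD(3)[OF 2] that by blast
    show "(p, r) \<in> ext"
      unfolding p r ext_def mem_Collect_eq prod.case
    proof (intro conjI ballI impI allI)
      show "(K, u, \<chi>) \<in> conds" "(K'', u'', \<chi>'') \<in> conds" using extD(1)[OF 1] extD(2)[OF 2] .
      show "u'' \<subseteq> u" "bk_n (B K'') \<le> bk_n (B K)"
        using extD(3,4)[OF 1] extD(3,4)[OF 2] by auto
    next
      fix \<alpha> assume "\<alpha> \<in> u''"
      then show "prefix (bk_eta (B K'') (\<chi>'' \<alpha>)) (bk_eta (B K) (\<chi> \<alpha>))"
        using extD(5)[OF 1] extD(5)[OF 2] sub prefix_order.trans by blast
    next
      fix \<alpha> \<beta> i assume *: "\<alpha> \<in> u''" "\<beta> \<in> u''" "\<alpha> \<noteq> \<beta>" "i < \<iota>"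
      show "bk_h (B K) i (\<chi> \<alpha>) (\<chi> \<beta>) = bk_h (B K'') i (\<chi>'' \<alpha>) (\<chi>'' \<beta>)"
        using extD(6)[OF 2 *] extD(6)[OF 1 sub[OF *(1)] sub[OF *(2)] *(3,4)] by simp
      show "prefix (bk_g (B K'') i (\<chi>'' \<alpha>) (\<chi>'' \<beta>)) (bk_g (B K) i (\<chi> \<alpha>) (\<chi> \<beta>))"
        using extD(7)[OF 2 *] extD(7)[OF 1 sub[OF *(1)] sub[OF *(2)] *(3,4)] by (rule prefix_order.trans)
    qed
  qed
qed

lemma ex_embedding:
  assumes "finite u" "u \<noteq> {}" "u \<subseteq> {..<\<kappa>}"
  shows "\<exists>\<psi>. quasi_embedding (s\<lparr>ypts := u\<rparr>) S \<psi>"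
proof -
  have "yzr_system \<epsilon> (s\<lparr>ypts := u\<rparr>)" using yzr_system_restrict[OF s(1), of u] assms s(2) by simp
  moreover have "finite (ypts (s\<lparr>ypts := u\<rparr>))" using assms(1) by simp
  ultimately show ?thesis using cute unfolding cute_def by blast
qed

lemma make_cond:
  assumes "quasi_embedding (s\<lparr>ypts := u\<rparr>) S \<chi>" "finite u" "3 \<le> card u" "u \<subseteq> {..<\<kappa>}" "\<chi> ` u \<subseteq> bk_w (B K)"
  shows "(K, u, \<lambda>\<alpha>. if \<alpha> \<in> u then \<chi> \<alpha> else 0) \<in> conds"
  using assms quasi_embedding_cong[OF assms(1), of "\<lambda>\<alpha>. if \<alpha> \<in> u then \<chi> \<alpha> else 0"]
  by (auto simp: conds_def)

text \<open>
  The amalgamation properties compare images of bricks on subsets of \<open>\<omega>\<close>.  Read through the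
  embeddings \<open>\<chi>\<close> and \<open>\<chi>'\<close>, this comparison is the extension relation.
\<close>

lemma ext_copy:
  assumes p: "(N, u, \<chi>) \<in> conds" and q: "(K, u', \<chi>') \<in> conds" and "u \<subseteq> u'"
    and \<theta>: "\<And>\<alpha>. \<alpha> \<in> u \<Longrightarrow> \<theta> (\<chi> \<alpha>) = \<chi>' \<alpha>"
    and le: "brick_le \<iota> (brick_image \<theta> (brick_restrict \<iota> T c (B N) (\<chi> ` u)))
      (brick_restrict \<iota> T c (B K) (\<theta> ` \<chi> ` u))"
  shows "((K, u', \<chi>'), (N, u, \<chi>)) \<in> ext"
proof -
  have inj: "inj_on \<theta> (\<chi> ` u)"
  proof (rule inj_onI)
    fix x y assume "x \<in> \<chi> ` u" "y \<in> \<chi> ` u" "\<theta> x = \<theta> y"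
    then obtain \<alpha> \<beta> where *: "\<alpha> \<in> u" "\<beta> \<in> u" "x = \<chi> \<alpha>" "y = \<chi> \<beta>" "\<chi>' \<alpha> = \<chi>' \<beta>"
      using \<theta> by auto
    then have "\<alpha> = \<beta>" using condsD(7)[OF q] \<open>u \<subseteq> u'\<close> by (auto dest: inj_onD)
    then show "x = y" using * by simp
  qed
  have inv: "inv_into (\<chi> ` u) \<theta> (\<chi>' \<alpha>) = \<chi> \<alpha>" if "\<alpha> \<in> u" for \<alpha>
    using inv_into_f_f[OF inj, of "\<chi> \<alpha>"] \<theta> that by simp
  have ne: "\<chi>' \<alpha> \<noteq> \<chi>' \<beta>" if "\<alpha> \<in> u" "\<beta> \<in> u" "\<alpha> \<noteq> \<beta>" for \<alpha> \<beta>
    using condsD(7)[OF q] \<open>u \<subseteq> u'\<close> that by (auto dest: inj_onD)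
  have mem: "\<chi>' \<alpha> \<in> \<theta> ` \<chi> ` u" if "\<alpha> \<in> u" for \<alpha> using \<theta>[OF that] that by (metis imageI)
  let ?R = "brick_restrict \<iota> T c (B N) (\<chi> ` u)" and ?\<phi> = "inv_into (\<chi> ` u) \<theta>"
  have image: "bk_w (brick_image \<theta> ?R) = \<theta> ` \<chi> ` u" "bk_n (brick_image \<theta> ?R) = bk_n (B N)"
    "bk_eta (brick_image \<theta> ?R) x = bk_eta (B N) (?\<phi> x)"
    "bk_h (brick_image \<theta> ?R) i x y = bk_h (B N) i (?\<phi> x) (?\<phi> y)"
    "bk_g (brick_image \<theta> ?R) i x y = bk_g (B N) i (?\<phi> x) (?\<phi> y)" for i x y
    by (simp_all add: brick_image_def brick_restrict_def Let_def)
  have restrict: "bk_n (brick_restrict \<iota> T c (B K) W) = bk_n (B K)"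
    "bk_eta (brick_restrict \<iota> T c (B K) W) = bk_eta (B K)"
    "bk_h (brick_restrict \<iota> T c (B K) W) = bk_h (B K)"
    "bk_g (brick_restrict \<iota> T c (B K) W) = bk_g (B K)" for W
    by (simp_all add: brick_restrict_def)
  note le = brick_leD[OF le, unfolded image restrict]
  show ?thesis
    unfolding ext_def mem_Collect_eq prod.case
  proof (intro conjI ballI impI allI)
    fix \<alpha> assume "\<alpha> \<in> u"
    then show "prefix (bk_eta (B N) (\<chi> \<alpha>)) (bk_eta (B K) (\<chi>' \<alpha>))"
      using le(3)[OF mem] inv by metis
  next
    fix \<alpha> \<beta> i assume *: "\<alpha> \<in> u" "\<beta> \<in> u" "\<alpha> \<noteq> \<beta>" "i < \<iota>"
    from le(4,5)[OF mem[OF *(1)] mem[OF *(2)] ne[OF *(1-3)] *(4)]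
    show "bk_h (B K) i (\<chi>' \<alpha>) (\<chi>' \<beta>) = bk_h (B N) i (\<chi> \<alpha>) (\<chi> \<beta>)"
      "prefix (bk_g (B N) i (\<chi> \<alpha>) (\<chi> \<beta>)) (bk_g (B K) i (\<chi>' \<alpha>) (\<chi>' \<beta>))"
      using inv * by simp_all
  qed (use p q \<open>u \<subseteq> u'\<close> le(2) in auto)
qed

lemma ex_high_brick: "\<exists>N\<ge>m. n \<le> bk_n (B N)"
proof -
  have "eventually (\<lambda>N. n \<le> bk_n (B N)) sequentially"
    using long by (simp add: filterlim_at_top)
  then obtain M where M: "\<forall>N\<ge>M. n \<le> bk_n (B N)" by (auto simp: eventually_sequentially)
  then show ?thesis by (intro exI[of _ "max m M"]) simp
qed

lemma dense_length: "dense_in conds ext {(K, u, \<chi>) \<in> conds. n \<le> bk_n (B K)}"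
  unfolding dense_in_def
proof (intro conjI ballI)
  fix p assume "p \<in> conds"
  moreover obtain K u \<chi> where p: "p = (K, u, \<chi>)" by (cases p)
  ultimately have pc: "(K, u, \<chi>) \<in> conds" by simp
  obtain N where N: "K \<le> N" "n \<le> bk_n (B N)" using ex_high_brick by blast
  have le: "brick_le \<iota> (B K) (B N)" by (rule brick_mono[OF N(1)])
  then have sub: "bk_w (B K) \<subseteq> bk_w (B N)" by (simp add: brick_le_def)
  have qc: "(N, u, \<chi>) \<in> conds" using condsD[OF pc] sub by (auto simp: conds_def)
  have mem: "\<chi> \<alpha> \<in> bk_w (B K)" if "\<alpha> \<in> u" for \<alpha> using condsD(5)[OF pc] that by blast
  have ne: "\<chi> \<alpha> \<noteq> \<chi> \<beta>" if "\<alpha> \<in> u" "\<beta> \<in> u" "\<alpha> \<noteq> \<beta>" for \<alpha> \<beta>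
    using that condsD(7)[OF pc] by (auto dest: inj_onD)
  have "((N, u, \<chi>), p) \<in> ext"
    unfolding p ext_def mem_Collect_eq prod.case
    using pc qc brick_leD[OF le] mem ne by simp
  then show "\<exists>d\<in>{(K, u, \<chi>) \<in> conds. n \<le> bk_n (B K)}. (d, p) \<in> ext"
    using qc N(2) by blast
qed auto

lemma quasi_embedding_on_S: "quasi_embedding_on S w \<pi> \<longleftrightarrow> quasi_embedding (S\<lparr>ypts := w\<rparr>) S \<pi>"
  by (simp add: quasi_embedding_on_def S)

lemma quasi_embedding_to_S: "quasi_embedding q S \<psi> \<Longrightarrow> \<psi> ` ypts q \<subseteq> Y \<Longrightarrow> quasi_embedding q (S\<lparr>ypts := Y\<rparr>) \<psi>"
  by (simp add: quasi_embedding_def)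

text \<open>
  By cuteness the enlarged domain embeds into \<open>S\<close>, and the property \<open>extend\<close> moves its image into
  some brick that prolongs a copy of the given one.
\<close>

lemma dense_point: "\<alpha> < \<kappa> \<Longrightarrow> dense_in conds ext {(K, u, \<chi>) \<in> conds. \<alpha> \<in> u}"
  unfolding dense_in_def
proof (intro conjI ballI)
  fix p assume "\<alpha> < \<kappa>" "p \<in> conds"
  moreover obtain N u \<chi> where p: "p = (N, u, \<chi>)" by (cases p)
  ultimately have pc: "(N, u, \<chi>) \<in> conds" by simp
  note u = condsD[OF pc]
  define u' where "u' = insert \<alpha> u"
  have u': "finite u'" "u' \<noteq> {}" "u' \<subseteq> {..<\<kappa>}" "u \<subseteq> u'" "3 \<le> card u'"
    using u(1-3) \<open>\<alpha> < \<kappa>\<close> card_insert_le[of u \<alpha>] by (auto simp: u'_def)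
  obtain \<psi> where \<psi>: "quasi_embedding (s\<lparr>ypts := u'\<rparr>) S \<psi>" using ex_embedding[OF u'(1-3)] by blast
  define \<tau> where "\<tau> = inv_into u \<chi>"
  have \<tau>: "\<tau> (\<chi> \<beta>) = \<beta>" if "\<beta> \<in> u" for \<beta> using inv_into_f_f[OF u(7) that] by (simp add: \<tau>_def)
  define w where "w = \<chi> ` u"
  have "quasi_embedding (S\<lparr>ypts := w\<rparr>) (s\<lparr>ypts := u'\<rparr>) \<tau>"
    unfolding w_def \<tau>_def by (rule quasi_embedding_mono[OF quasi_embedding_inv[OF u(4)] u'(4)])
  from quasi_embedding_trans[OF this \<psi>]
  have \<pi>0: "quasi_embedding_on S w (\<psi> \<circ> \<tau>)" by (simp add: quasi_embedding_on_S)
  have "card w = card u" unfolding w_def by (rule card_image[OF u(7)])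
  moreover have "(\<psi> \<circ> \<tau>) ` w \<subseteq> \<psi> ` u'" using \<tau> u'(4) by (auto simp: w_def)
  ultimately obtain K \<pi> where K: "quasi_embedding_on S (\<psi> ` u') \<pi>" "\<pi> ` \<psi> ` u' \<subseteq> bk_w (B K)"
    "brick_le \<iota> (brick_image (\<pi> \<circ> (\<psi> \<circ> \<tau>)) (brick_restrict \<iota> T c (B N) w))
                (brick_restrict \<iota> T c (B K) ((\<pi> \<circ> (\<psi> \<circ> \<tau>)) ` w))"
    using extend[rule_format, of w N "\<psi> \<circ> \<tau>" "\<psi> ` u'"] u(2,5) u'(1) \<pi>0 unfolding w_def by auto
  have "quasi_embedding (s\<lparr>ypts := u'\<rparr>) S (\<pi> \<circ> \<psi>)"
    using quasi_embedding_trans[OF quasi_embedding_to_S[OF \<psi>, of "\<psi> ` u'"]] K(1)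
    by (simp add: quasi_embedding_on_S)
  moreover have "(\<pi> \<circ> \<psi>) ` u' \<subseteq> bk_w (B K)" using K(2) by auto
  ultimately have qc: "(K, u', \<lambda>\<beta>. if \<beta> \<in> u' then (\<pi> \<circ> \<psi>) \<beta> else 0) \<in> conds"
    by (rule make_cond[OF _ u'(1,5,3)])
  have "((K, u', \<lambda>\<beta>. if \<beta> \<in> u' then (\<pi> \<circ> \<psi>) \<beta> else 0), (N, u, \<chi>)) \<in> ext"
    by (rule ext_copy[OF pc qc u'(4) _ K(3)[unfolded w_def]]) (use \<tau> u'(4) in auto)
  then show "\<exists>d\<in>{(K, u, \<chi>) \<in> conds. \<alpha> \<in> u}. (d, p) \<in> ext"
    using qc by (intro bexI[of _ "(K, u', \<lambda>\<beta>. if \<beta> \<in> u' then (\<pi> \<circ> \<psi>) \<beta> else 0)"]) (auto simp: p u'_def)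
qed auto

lemma conds_nonempty: "conds \<noteq> {}"
proof -
  obtain u where u: "finite u" "card u = 3" "u \<subseteq> {..<\<kappa>}"
    using infinite_arbitrarily_large[OF infinite] by blast
  then have "u \<noteq> {}" by auto
  then obtain \<psi> where \<psi>: "quasi_embedding (s\<lparr>ypts := u\<rparr>) S \<psi>" using ex_embedding u by blast
  have "\<forall>a. \<exists>n. a \<in> bk_w (B n)" using cover by blast
  then obtain f where f: "\<And>a. a \<in> bk_w (B (f a))" by metis
  define K where "K = Max (f ` \<psi> ` u)"
  have "\<psi> ` u \<subseteq> bk_w (B K)"
  proof
    fix a assume "a \<in> \<psi> ` u"
    then have "f a \<le> K" using u(1) by (simp add: K_def)
    then show "a \<in> bk_w (B K)" using f brick_mono unfolding brick_le_def by blast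
  qed
  then have "(K, u, \<lambda>\<alpha>. if \<alpha> \<in> u then \<psi> \<alpha> else 0) \<in> conds"
    using make_cond[OF \<psi>] u by simp
  then show ?thesis by blast
qed

text \<open>
  With elements of \<open>\<kappa>\<close> coded by sets of natural numbers, a condition becomes a set of pairs: the
  elements of the code of \<open>\<alpha>\<close> are listed under the index \<open>\<chi> \<alpha>\<close>, shifted by one so that the second
  entry \<open>0\<close> can mark the range of \<open>\<chi>\<close> even where the code is empty, and the index \<open>0\<close> is
  reserved for \<open>K\<close>.
\<close>

lemma card_conds:
  assumes "|{..<\<kappa>}| \<le>o |UNIV :: nat set set|"
  shows "|conds| \<le>o |UNIV :: nat set set|"
proof -
  obtain f :: "ordinal \<Rightarrow> nat set" where f: "inj_on f {..<\<kappa>}"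
    using assms card_of_ordLeq[of "{..<\<kappa>}" "UNIV :: nat set set"] by auto
  define code where "code = (\<lambda>(K :: nat, u, \<chi> :: ordinal \<Rightarrow> nat). insert (prod_encode (0, K))
    ((\<lambda>\<alpha>. prod_encode (Suc (\<chi> \<alpha>), 0)) ` u \<union> {prod_encode (Suc (\<chi> \<alpha>), Suc m) | \<alpha> m. \<alpha> \<in> u \<and> m \<in> f \<alpha>}))"
  have K: "prod_encode (0, n) \<in> code (K, u, \<chi>) \<longleftrightarrow> n = K" for n K u \<chi>
    by (auto simp: code_def)
  have u: "prod_encode (Suc a, 0) \<in> code (K, u, \<chi>) \<longleftrightarrow> a \<in> \<chi> ` u" for a K u \<chi>
    by (auto simp: code_def)
  have m: "prod_encode (Suc a, Suc m) \<in> code (K, u, \<chi>) \<longleftrightarrow> (\<exists>\<alpha>\<in>u. a = \<chi> \<alpha> \<and> m \<in> f \<alpha>)" for a m K u \<chi>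
    by (auto simp: code_def)
  have sub: "K = K' \<and> u \<subseteq> u' \<and> (\<forall>\<alpha>\<in>u. \<chi> \<alpha> = \<chi>' \<alpha>)"
    if p: "(K, u, \<chi>) \<in> conds" and q: "(K', u', \<chi>') \<in> conds" and eq: "code (K, u, \<chi>) = code (K', u', \<chi>')"
    for K u \<chi> K' u' \<chi>'
  proof -
    have "K = K'" using K[of K K u \<chi>] K[of K K' u' \<chi>'] eq by simp
    moreover have "\<alpha> \<in> u' \<and> \<chi> \<alpha> = \<chi>' \<alpha>" if "\<alpha> \<in> u" for \<alpha>
    proof -
      have "\<chi> \<alpha> \<in> \<chi>' ` u'" using u[of "\<chi> \<alpha>" K u \<chi>] u[of "\<chi> \<alpha>" K' u' \<chi>'] eq that by simp
      then obtain \<beta> where \<beta>: "\<beta> \<in> u'" "\<chi> \<alpha> = \<chi>' \<beta>" by blast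
      have "m \<in> f \<alpha> \<longleftrightarrow> m \<in> f \<beta>" for m
      proof -
        have "m \<in> f \<alpha> \<longleftrightarrow> prod_encode (Suc (\<chi> \<alpha>), Suc m) \<in> code (K, u, \<chi>)"
          unfolding m using that inj_onD[OF condsD(7)[OF p]] by metis
        also have "\<dots> \<longleftrightarrow> prod_encode (Suc (\<chi>' \<beta>), Suc m) \<in> code (K', u', \<chi>')"
          using eq \<beta>(2) by simp
        also have "\<dots> \<longleftrightarrow> m \<in> f \<beta>"
          unfolding m using \<beta>(1) inj_onD[OF condsD(7)[OF q]] by metis
        finally show ?thesis .
      qed
      then have "f \<alpha> = f \<beta>" by blast
      then have "\<alpha> = \<beta>"
        using inj_onD[OF f, of \<alpha> \<beta>] condsD(3)[OF p] condsD(3)[OF q] that \<beta>(1) by blast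
      then show ?thesis using \<beta> by simp
    qed
    ultimately show ?thesis by blast
  qed
  have "inj_on code conds"
  proof (rule inj_onI)
    fix p q assume "p \<in> conds" "q \<in> conds" "code p = code q"
    moreover obtain K u \<chi> where p: "p = (K, u, \<chi>)" by (cases p)
    moreover obtain K' u' \<chi>' where q: "q = (K', u', \<chi>')" by (cases q)
    ultimately have pq: "(K, u, \<chi>) \<in> conds" "(K', u', \<chi>') \<in> conds" "code (K, u, \<chi>) = code (K', u', \<chi>')"
      by simp_all
    have "K = K'" "u = u'" using sub[OF pq] sub[OF pq(2,1) pq(3)[symmetric]] by auto
    moreover have "\<chi> \<alpha> = \<chi>' \<alpha>" for \<alpha>
      using sub[OF pq] condsD(6)[OF pq(1)] condsD(6)[OF pq(2)] \<open>u = u'\<close> by (cases "\<alpha> \<in> u") auto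
    then have "\<chi> = \<chi>'" by blast
    ultimately show "p = q" by (simp add: p q)
  qed
  then show ?thesis using card_of_ordLeqI[of code conds UNIV] by simp
qed

text \<open>
  Among uncountably many conditions there are two, with inverse embeddings \<open>\<tau>0\<close> and \<open>\<tau>1\<close>, that have
  the same brick, the same range \<open>w\<close> and the same colors of the copies of subsets of \<open>w\<close>, and such
  that \<open>\<tau>0\<close> and \<open>\<tau>1\<close> agree on some \<open>U \<subseteq> w\<close> and have disjoint images outside \<open>U\<close>.  Embedding the
  union of the two domains into \<open>S\<close> brings them into the form required by \<open>amalgamate\<close>, and the brick
  obtained is a common extension.
\<close>

lemma ccc_conds: "ccc conds ext"
  unfolding ccc_def
proof (intro allI impI, rule ccontr)
  fix A assume A: "A \<subseteq> conds"
    and anti: "\<forall>p\<in>A. \<forall>q\<in>A. p \<noteq> q \<longrightarrow> \<not> compatible_in conds ext p q" and unc: "uncountable A"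
  define \<tau> where "\<tau> = (\<lambda>(K :: nat, u, \<chi> :: ordinal \<Rightarrow> nat). inv_into u \<chi>)"
  define dom where "dom = (\<lambda>(K :: nat, u :: ordinal set, \<chi> :: ordinal \<Rightarrow> nat). \<chi> ` u)"
  define key where "key p = (fst p, dom p, (\<lambda>v. (v, yj s (\<tau> p ` v))) ` Pow (dom p))" for p
  define FS where "FS = {v :: nat set. finite v}"
  have FS: "countable FS" unfolding FS_def by (rule countable_Collect_finite)
  have keys: "key ` A \<subseteq> UNIV \<times> FS \<times> {X. finite X \<and> X \<subseteq> FS \<times> UNIV}"
  proof
    fix k assume "k \<in> key ` A"
    then obtain p where p: "p \<in> A" "k = key p" by blast
    obtain K u \<chi> where "p = (K, u, \<chi>)" by (cases p)
    then have "finite (dom p)" using A p condsD(1) by (auto simp: dom_def)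
    then show "k \<in> UNIV \<times> FS \<times> {X. finite X \<and> X \<subseteq> FS \<times> UNIV}"
      unfolding p(2) key_def FS_def by (auto intro: finite_subset)
  qed
  have "countable ((UNIV :: nat set) \<times> FS \<times> {X. finite X \<and> X \<subseteq> FS \<times> (UNIV :: nat set)})"
    using FS by (intro countable_SIGMA countable_Collect_finite_subset) auto
  then have "countable (key ` A)" by (rule countable_subset[OF keys])
  then obtain k where k: "uncountable {p \<in> A. key p = k}" using uncountable_fibre[OF unc] by blast
  then have "{p \<in> A. key p = k} \<noteq> {}" by (metis countable_empty)
  then have "k \<in> UNIV \<times> FS \<times> {X. finite X \<and> X \<subseteq> FS \<times> UNIV}" using keys by blast
  then obtain N w J where Nw: "k = (N, w, J)" "w \<in> FS" by blast
  then have "finite w" by (simp add: FS_def)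
  then obtain p q U where pq: "p \<in> A" "q \<in> A" "key p = k" "key q = k" "p \<noteq> q" and U: "U \<subseteq> w"
    "\<And>x. x \<in> U \<Longrightarrow> \<tau> p x = \<tau> q x" "\<tau> p ` (w - U) \<inter> \<tau> q ` (w - U) = {}"
    using delta_system_pair[OF k, of w \<tau>] by blast
  have key: "J = (\<lambda>v. (v, yj s (\<tau> p ` v))) ` Pow (dom p)" "J = (\<lambda>v. (v, yj s (\<tau> q ` v))) ` Pow (dom q)"
    "dom p = w" "dom q = w"
    using pq(3,4) unfolding key_def Nw(1) prod.inject by blast+
  obtain u0 \<chi>0 where p: "p = (N, u0, \<chi>0)" using pq(3) Nw(1) by (cases p) (auto simp: key_def)
  obtain u1 \<chi>1 where q: "q = (N, u1, \<chi>1)" using pq(4) Nw(1) by (cases q) (auto simp: key_def)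
  define \<tau>0 \<tau>1 where "\<tau>0 = inv_into u0 \<chi>0" and "\<tau>1 = inv_into u1 \<chi>1"
  have \<tau>: "\<tau> p = \<tau>0" "\<tau> q = \<tau>1" by (simp_all add: \<tau>_def p q \<tau>0_def \<tau>1_def)
  have w: "w = \<chi>0 ` u0" "w = \<chi>1 ` u1" using pq(3,4) Nw(1) by (simp_all add: key_def dom_def p q)
  have pc: "(N, u0, \<chi>0) \<in> conds" and qc: "(N, u1, \<chi>1) \<in> conds" using A pq p q by auto
  have j_eq: "yj s (\<tau>0 ` v) = yj s (\<tau>1 ` v)" if "v \<subseteq> w" for v
  proof -
    have "J = (\<lambda>v. (v, yj s (\<tau>0 ` v))) ` Pow w" "J = (\<lambda>v. (v, yj s (\<tau>1 ` v))) ` Pow w"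
      using key(1,2) unfolding \<tau> key(3,4) .
    then have "(v, yj s (\<tau>0 ` v)) \<in> (\<lambda>v. (v, yj s (\<tau>1 ` v))) ` Pow w" using that by blast
    then show ?thesis by auto
  qed
  define u where "u = u0 \<union> u1"
  have fin: "finite u" "u \<noteq> {}" "u \<subseteq> {..<\<kappa>}" "u0 \<subseteq> u" "u1 \<subseteq> u" "3 \<le> card u"
  proof -
    show "finite u" "u \<subseteq> {..<\<kappa>}" "u0 \<subseteq> u" "u1 \<subseteq> u" using condsD(1,3)[OF pc] condsD(1,3)[OF qc] by (auto simp: u_def)
    then have "card u0 \<le> card u" by (intro card_mono)
    then show "3 \<le> card u" using condsD(2)[OF pc] by simp
    then show "u \<noteq> {}" by auto
  qed
  obtain \<psi> where \<psi>: "quasi_embedding (s\<lparr>ypts := u\<rparr>) S \<psi>" using ex_embedding[OF fin(1-3)] by blast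
  have \<tau>q: "quasi_embedding (S\<lparr>ypts := w\<rparr>) (s\<lparr>ypts := u\<rparr>) \<tau>0"
    "quasi_embedding (S\<lparr>ypts := w\<rparr>) (s\<lparr>ypts := u\<rparr>) \<tau>1"
    using quasi_embedding_mono[OF quasi_embedding_inv[OF condsD(4)[OF pc]] fin(4)]
      quasi_embedding_mono[OF quasi_embedding_inv[OF condsD(4)[OF qc]] fin(5)]
    by (simp_all add: w(1)[symmetric] w(2)[symmetric] \<tau>0_def \<tau>1_def)
  have \<tau>inv: "\<And>\<alpha>. \<alpha> \<in> u0 \<Longrightarrow> \<tau>0 (\<chi>0 \<alpha>) = \<alpha>" "\<And>\<alpha>. \<alpha> \<in> u1 \<Longrightarrow> \<tau>1 (\<chi>1 \<alpha>) = \<alpha>"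
    using inv_into_f_f[OF condsD(7)[OF pc]] inv_into_f_f[OF condsD(7)[OF qc]] by (simp_all add: \<tau>0_def \<tau>1_def)
  have \<tau>w0: "\<tau>0 ` w = u0" unfolding w(1) image_image using \<tau>inv(1) by simp
  have \<tau>w1: "\<tau>1 ` w = u1" unfolding w(2) image_image using \<tau>inv(2) by simp
  have \<psi>inj: "inj_on \<psi> u" using quasi_embedding_inj[OF \<psi>] by simp
  have qe: "quasi_embedding_on S w (\<psi> \<circ> \<tau>0)" "quasi_embedding_on S w (\<psi> \<circ> \<tau>1)"
    using quasi_embedding_trans[OF \<tau>q(1) \<psi>] quasi_embedding_trans[OF \<tau>q(2) \<psi>]
    by (simp_all add: quasi_embedding_on_S)
  \<comment> \<open>Quasi-embeddings need not respect colors at rank \<open>0\<close>, but \<open>s\<close> has colors of its own.  The two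
    copies of \<open>\<delta>\<close> over the common copy \<open>V\<close> of \<open>v\<close> agree in them, so they would be twins.\<close>
  have no: "yk S (v \<union> {\<delta>}) \<noteq> card (v \<inter> {..<\<delta>})"
    if v: "v \<subseteq> U" "\<delta> \<in> w - U" "yr S (v \<union> {\<delta>}) = ord_zero" for v \<delta>
  proof
    assume k: "yk S (v \<union> {\<delta>}) = card (v \<inter> {..<\<delta>})"
    have vw: "insert \<delta> v \<subseteq> w" "finite (insert \<delta> v)" "\<delta> \<notin> v"
    proof -
      show sub: "insert \<delta> v \<subseteq> w" and "\<delta> \<notin> v" using v U(1) by auto
      show "finite (insert \<delta> v)" by (rule finite_subset[OF sub \<open>finite w\<close>])
    qed
    define V where "V = \<tau>0 ` v"
    have V1: "V = \<tau>1 ` v" unfolding V_def using U(2) v(1) \<tau> by (intro image_cong) auto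
    have facts: "yr s (t ` v \<union> {t \<delta>}) = ord_zero" "yk s (t ` v \<union> {t \<delta>}) = card (t ` v \<inter> {..<t \<delta>})"
      "card (t ` v \<inter> {..<t \<delta>}) = card (v \<inter> {..<\<delta>})" "t \<delta> \<notin> t ` v" "t ` v \<subseteq> ypts s" "t \<delta> \<in> ypts s"
      if t: "quasi_embedding (S\<lparr>ypts := w\<rparr>) (s\<lparr>ypts := u\<rparr>) t" for t
    proof -
      have mono: "t x < t y \<longleftrightarrow> x < y" if "x \<in> w" "y \<in> w" for x y
        using t that unfolding quasi_embedding_def strict_mono_on_def
        by simp (metis less_asym linorder_neqE)
      have inj: "inj_on t w" using quasi_embedding_inj[OF t] by simp
      have "yr s (t ` insert \<delta> v) = yr S (insert \<delta> v)" "yk s (t ` insert \<delta> v) = yk S (insert \<delta> v)"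
        using t vw unfolding quasi_embedding_def by auto
      moreover have "t ` v \<inter> {..<t \<delta>} = t ` (v \<inter> {..<\<delta>})"
        using mono vw(1) by auto
      moreover have "inj_on t (v \<inter> {..<\<delta>})" by (rule inj_on_subset[OF inj]) (use vw(1) in auto)
      ultimately show "yr s (t ` v \<union> {t \<delta>}) = ord_zero" "yk s (t ` v \<union> {t \<delta>}) = card (t ` v \<inter> {..<t \<delta>})"
        "card (t ` v \<inter> {..<t \<delta>}) = card (v \<inter> {..<\<delta>})"
        using v(3) k by (simp_all add: card_image)
      show "t \<delta> \<notin> t ` v" using inj vw(1,3) by (auto dest: inj_onD)
      have "t ` w \<subseteq> u" using t by (simp add: quasi_embedding_def)
      then have "t ` w \<subseteq> ypts s" using fin(3) s(2) by simp
      then show "t ` v \<subseteq> ypts s" "t \<delta> \<in> ypts s" using vw(1) by blast+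
    qed
    note 0 = facts[OF \<tau>q(1), folded V_def] and 1 = facts[OF \<tau>q(2), folded V1]
    have j: "yj s (V \<union> {\<tau>0 \<delta>}) = yj s (V \<union> {\<tau>1 \<delta>})"
      using j_eq[OF vw(1)] V_def V1 by simp
    have "finite V" using vw(2) by (simp add: V_def)
    have "\<tau>0 \<delta> \<noteq> \<tau>1 \<delta>" using U(3) v(2) \<tau> by auto
    moreover have "False" if "\<tau>1 \<delta> < \<tau>0 \<delta>"
      by (rule yzr_no_twins[OF s(1) \<open>finite V\<close> 0(5,6) 1(6) that 0(4) 1(4) 0(1,2)])
        (use 0(3) 1(3) j in simp_all)
    moreover have "False" if "\<tau>0 \<delta> < \<tau>1 \<delta>"
      by (rule yzr_no_twins[OF s(1) \<open>finite V\<close> 1(5,6) 0(6) that 1(4) 0(4) 1(1,2)])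
        (use 0(3) 1(3) j in simp_all)
    ultimately show False by (metis linorder_neqE)
  qed
  have agree: "(\<psi> \<circ> \<tau>0) a = (\<psi> \<circ> \<tau>1) a" if "a \<in> U" for a using U(2)[OF that] \<tau> by simp
  have disj: "(\<psi> \<circ> \<tau>0) ` (w - U) \<inter> (\<psi> \<circ> \<tau>1) ` (w - U) = {}"
  proof -
    have "\<tau>0 ` (w - U) \<subseteq> u" "\<tau>1 ` (w - U) \<subseteq> u" using \<tau>w0 \<tau>w1 fin(4,5) by auto
    then have "\<psi> ` (\<tau>0 ` (w - U)) \<inter> \<psi> ` (\<tau>1 ` (w - U)) = \<psi> ` (\<tau>0 ` (w - U) \<inter> \<tau>1 ` (w - U))"
      using \<psi>inj by (simp add: inj_on_image_Int)
    then show ?thesis using U(3) \<tau> by (simp add: image_comp)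
  qed
  have "card w = card u0" unfolding w(1) by (rule card_image[OF condsD(7)[OF pc]])
  then have w3: "3 \<le> card w" using condsD(2)[OF pc] by simp
  have wB: "w \<subseteq> bk_w (B N)" using condsD(5)[OF pc] unfolding w(1) .
  obtain K \<pi> where K: "quasi_embedding_on S ((\<psi> \<circ> \<tau>0) ` w \<union> (\<psi> \<circ> \<tau>1) ` w) \<pi>"
    "\<pi> ` ((\<psi> \<circ> \<tau>0) ` w \<union> (\<psi> \<circ> \<tau>1) ` w) \<subseteq> bk_w (B K)"
    "brick_le \<iota> (brick_image (\<pi> \<circ> (\<psi> \<circ> \<tau>0)) (brick_restrict \<iota> T c (B N) w))
                (brick_restrict \<iota> T c (B K) ((\<pi> \<circ> (\<psi> \<circ> \<tau>0)) ` w))"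
    "brick_le \<iota> (brick_image (\<pi> \<circ> (\<psi> \<circ> \<tau>1)) (brick_restrict \<iota> T c (B N) w))
                (brick_restrict \<iota> T c (B K) ((\<pi> \<circ> (\<psi> \<circ> \<tau>1)) ` w))"
    using amalgamate[rule_format, of U w N "\<psi> \<circ> \<tau>0" "\<psi> \<circ> \<tau>1"] U(1) wB w3 no qe agree disj by blast
  have range: "(\<psi> \<circ> \<tau>0) ` w \<union> (\<psi> \<circ> \<tau>1) ` w = \<psi> ` u"
    unfolding image_comp[symmetric] \<tau>w0 \<tau>w1 u_def by blast
  have "quasi_embedding (s\<lparr>ypts := u\<rparr>) S (\<pi> \<circ> \<psi>)"
    using quasi_embedding_trans[OF quasi_embedding_to_S[OF \<psi>, of "\<psi> ` u"]] K(1)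
    unfolding range by (simp add: quasi_embedding_on_S)
  moreover have "(\<pi> \<circ> \<psi>) ` u \<subseteq> bk_w (B K)" using K(2) unfolding range by auto
  ultimately have rc: "(K, u, \<lambda>\<alpha>. if \<alpha> \<in> u then (\<pi> \<circ> \<psi>) \<alpha> else 0) \<in> conds"
    by (rule make_cond[OF _ fin(1,6,3)])
  have "((K, u, \<lambda>\<alpha>. if \<alpha> \<in> u then (\<pi> \<circ> \<psi>) \<alpha> else 0), (N, u0, \<chi>0)) \<in> ext"
    by (rule ext_copy[OF pc rc fin(4) _ K(3)[unfolded w(1)]]) (use \<tau>inv(1) fin(4) in auto)
  moreover have "((K, u, \<lambda>\<alpha>. if \<alpha> \<in> u then (\<pi> \<circ> \<psi>) \<alpha> else 0), (N, u1, \<chi>1)) \<in> ext"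
    by (rule ext_copy[OF qc rc fin(5) _ K(4)[unfolded w(2)]]) (use \<tau>inv(2) fin(5) in auto)
  ultimately have "compatible_in conds ext p q" using rc p q unfolding compatible_in_def by blast
  then show False using anti pq by blast
qed

end

section \<open>The generic family of translates\<close>

text \<open>
  The configuration that a brick represents lives at the full length \<open>bk_n b\<close>, where all truncations
  are trivial.
\<close>

lemma is_brickD:
  assumes b: "is_brick S \<iota> T c b"
  shows "x \<in> bk_w b \<Longrightarrow> length (bk_eta b x) = bk_n b"
    and "inj_on (bk_eta b) (bk_w b)"
    and "x \<in> bk_w b \<Longrightarrow> y \<in> bk_w b \<Longrightarrow> x \<noteq> y \<Longrightarrow> i < \<iota> \<Longrightarrow> length (bk_g b i x y) = bk_n b"
    and "x \<in> bk_w b \<Longrightarrow> y \<in> bk_w b \<Longrightarrow> x \<noteq> y \<Longrightarrow> i < \<iota> \<Longrightarrow> bk_g b i x y \<in> T (bk_h b i x y)"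
    and "x \<in> bk_w b \<Longrightarrow> y \<in> bk_w b \<Longrightarrow> x \<noteq> y \<Longrightarrow> i < \<iota> \<Longrightarrow>
      ladd (bk_eta b x) (bk_g b i x y) = ladd (bk_eta b y) (bk_g b i y x)"
    and "x \<in> bk_w b \<Longrightarrow> y \<in> bk_w b \<Longrightarrow> x \<noteq> y \<Longrightarrow>
      distinct (map (\<lambda>i. bk_g b i x y) [0..<\<iota>] @ map (\<lambda>i. bk_g b i y x) [0..<\<iota>])"
proof -
  have "\<forall>x\<in>bk_w b. length (bk_eta b x) = bk_n b" using b unfolding is_brick_def by (elim conjE)
  then have len: "length (bk_eta b x) = bk_n b" if "x \<in> bk_w b" for x using that by blast
  have off: "\<forall>(x, y)\<in>offdiag (bk_w b). \<forall>i<\<iota>.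
      c (bk_h b i x y) \<le> bk_n b \<and> bk_g b i x y \<in> (\<Union>m. T m) \<and> length (bk_g b i x y) = bk_n b"
    using b unfolding is_brick_def by (elim conjE)
  have leng: "length (bk_g b i x y) = bk_n b" if "x \<in> bk_w b" "y \<in> bk_w b" "x \<noteq> y" "i < \<iota>" for x y i
  proof -
    have "(x, y) \<in> offdiag (bk_w b)" using that by (simp add: offdiag_def)
    then show ?thesis using off that(4) by blast
  qed
  have "\<exists>m\<in>configs \<iota> T. cfg_at \<iota> b (bk_n b) (bk_w b) m"
    using b unfolding is_brick_def by (elim conjE)
  then obtain m where m: "m \<in> configs \<iota> T" "cfg_at \<iota> b (bk_n b) (bk_w b) m" by blast
  have e: "take (bk_n b) (bk_eta b x) = bk_eta b x" if "x \<in> bk_w b" for x using len[OF that] by simp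
  have u: "cfg_u m = bk_eta b ` bk_w b" and inj: "inj_on (bk_eta b) (bk_w b)"
    using m(2) e unfolding cfg_at_def by (auto simp: inj_on_def)
  have hg: "cfg_h m i (bk_eta b x) (bk_eta b y) = bk_h b i x y"
    "cfg_g m i (bk_eta b x) (bk_eta b y) = bk_g b i x y"
    if "x \<in> bk_w b" "y \<in> bk_w b" "x \<noteq> y" "i < \<iota>" for x y i
  proof -
    have "(x, y) \<in> offdiag (bk_w b)" using that by (simp add: offdiag_def)
    then have "cfg_h m i (take (bk_n b) (bk_eta b x)) (take (bk_n b) (bk_eta b y)) = bk_h b i x y \<and>
      cfg_g m i (take (bk_n b) (bk_eta b x)) (take (bk_n b) (bk_eta b y)) = take (bk_n b) (bk_g b i x y)"
      using m(2) that(4) unfolding cfg_at_def by blast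
    then show "cfg_h m i (bk_eta b x) (bk_eta b y) = bk_h b i x y"
      "cfg_g m i (bk_eta b x) (bk_eta b y) = bk_g b i x y"
      using e that leng by simp_all
  qed
  have mem: "(bk_eta b x, bk_eta b y) \<in> offdiag (cfg_u m)" if "x \<in> bk_w b" "y \<in> bk_w b" "x \<noteq> y" for x y
    using that inj unfolding u offdiag_def by (auto dest: inj_onD)
  have cfg: "\<forall>(\<eta>, \<nu>)\<in>offdiag (cfg_u m). \<forall>i<\<iota>.
        cfg_g m i \<eta> \<nu> \<in> T (cfg_h m i \<eta> \<nu>) \<and> length (cfg_g m i \<eta> \<nu>) = cfg_l m"
    "\<forall>(\<eta>, \<nu>)\<in>offdiag (cfg_u m). \<forall>i<\<iota>. ladd \<eta> (cfg_g m i \<eta> \<nu>) = ladd \<nu> (cfg_g m i \<nu> \<eta>)"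
    "\<forall>(\<eta>, \<nu>)\<in>offdiag (cfg_u m).
        distinct (map (\<lambda>i. cfg_g m i \<eta> \<nu>) [0..<\<iota>] @ map (\<lambda>i. cfg_g m i \<nu> \<eta>) [0..<\<iota>])"
    using m(1) unfolding configs_def mem_Collect_eq by - (elim conjE, assumption)+
  show "x \<in> bk_w b \<Longrightarrow> length (bk_eta b x) = bk_n b" by (rule len)
  show "inj_on (bk_eta b) (bk_w b)" by (rule inj)
  show "x \<in> bk_w b \<Longrightarrow> y \<in> bk_w b \<Longrightarrow> x \<noteq> y \<Longrightarrow> i < \<iota> \<Longrightarrow> length (bk_g b i x y) = bk_n b"
    by (rule leng)
  assume xy: "x \<in> bk_w b" "y \<in> bk_w b" "x \<noteq> y"
  have yx: "y \<in> bk_w b" "x \<in> bk_w b" "y \<noteq> x" using xy by auto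
  show "bk_g b i x y \<in> T (bk_h b i x y)" if "i < \<iota>"
    using cfg(1) mem[OF xy] hg[OF xy that] that by fastforce
  show "ladd (bk_eta b x) (bk_g b i x y) = ladd (bk_eta b y) (bk_g b i y x)" if "i < \<iota>"
    using cfg(2) mem[OF xy] hg(2)[OF xy that] hg(2)[OF yx that] that by fastforce
  have "distinct (map (\<lambda>i. cfg_g m i (bk_eta b x) (bk_eta b y)) [0..<\<iota>] @
      map (\<lambda>i. cfg_g m i (bk_eta b y) (bk_eta b x)) [0..<\<iota>])"
    using cfg(3) mem[OF xy] by blast
  moreover have "map (\<lambda>i. cfg_g m i (bk_eta b x) (bk_eta b y)) [0..<\<iota>] = map (\<lambda>i. bk_g b i x y) [0..<\<iota>]"
    "map (\<lambda>i. cfg_g m i (bk_eta b y) (bk_eta b x)) [0..<\<iota>] = map (\<lambda>i. bk_g b i y x) [0..<\<iota>]"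
    using hg(2)[OF xy] hg(2)[OF yx] by simp_all
  ultimately show "distinct (map (\<lambda>i. bk_g b i x y) [0..<\<iota>] @ map (\<lambda>i. bk_g b i y x) [0..<\<iota>])"
    by (simp only:)
qed

lemma tree_prefix:
  assumes "tree A" "t \<in> A" "prefix s t"
  shows "s \<in> A"
proof (cases "s = t")
  case False
  then have "strict_prefix s t" using assms(3) by (simp add: strict_prefix_def)
  then show ?thesis using assms(1,2) by (simp add: tree_def)
qed (use assms(2) in simp)

lemma ex_limit:
  assumes comp: "\<And>l l'. l \<in> L \<Longrightarrow> l' \<in> L \<Longrightarrow> prefix l l' \<or> prefix l' l"
    and long: "\<And>n. \<exists>l\<in>L. n \<le> length l"
  shows "\<exists>x. \<forall>l\<in>L. x \<in> cyl l"
proof -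
  obtain l where l: "\<And>n. l n \<in> L \<and> n \<le> length (l n)" using long by metis
  define x where "x i = l (Suc i) ! i" for i
  have "x \<in> cyl k" if k: "k \<in> L" for k
    unfolding mem_cyl_iff
  proof (intro allI impI)
    fix i assume i: "i < length k"
    have "i < length (l (Suc i))" using l[of "Suc i"] by simp
    then show "k ! i = x i"
      using comp[OF k, of "l (Suc i)"] l[of "Suc i"] i prefix_nthD unfolding x_def by metis
  qed
  then show ?thesis by blast
qed

lemma card_of_distinct_list:
  assumes "distinct zs" "set zs \<subseteq> X"
  shows "|{..<length zs}| \<le>o |X|"
  by (rule card_of_ordLeqI[of "(!) zs"]) (use assms in \<open>auto simp: inj_on_def nth_eq_iff_index_eq\<close>)

context amalgamating_bricks
begin

lemma ex_generic_filter:
  assumes "martins_axiom" and "|{..<\<kappa>}| <o |UNIV :: nat set set|"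
  shows "\<exists>G. filter_in conds ext G \<and> (\<forall>\<alpha><\<kappa>. \<exists>K u \<chi>. (K, u, \<chi>) \<in> G \<and> \<alpha> \<in> u) \<and>
    (\<forall>n. \<exists>K u \<chi>. (K, u, \<chi>) \<in> G \<and> n \<le> bk_n (B K))"
proof -
  define D where "D \<alpha> = {(K, u, \<chi>) \<in> conds. \<alpha> \<in> u}" for \<alpha>
  define E where "E n = {(K, u, \<chi>) \<in> conds. n \<le> bk_n (B K)}" for n
  have "|D ` {..<\<kappa>}| \<le>o |{..<\<kappa>}|" by (rule card_of_image)
  then have "|D ` {..<\<kappa>}| <o |UNIV :: nat set set|" using assms(2) by (rule ordLeq_ordLess_trans)
  moreover have "|range E| \<le>o |{..<\<kappa>}|"
    using card_of_image[of E UNIV] infinite_iff_card_of_nat[of "{..<\<kappa>}"] infinite ordLeq_transitive by blast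
  then have "|range E| <o |UNIV :: nat set set|" using assms(2) by (rule ordLeq_ordLess_trans)
  moreover have "infinite (UNIV :: nat set set)"
    using infinite card_of_ordLeq_finite ordLess_imp_ordLeq[OF assms(2)] by blast
  ultimately have "|D ` {..<\<kappa>} \<union> range E| <o |UNIV :: nat set set|"
    by (intro card_of_Un_ordLess_infinite)
  moreover have "dense_in conds ext X" if "X \<in> D ` {..<\<kappa>} \<union> range E" for X
    using that dense_point dense_length unfolding D_def E_def by auto
  ultimately obtain G where G: "filter_in conds ext G" "\<forall>X\<in>D ` {..<\<kappa>} \<union> range E. G \<inter> X \<noteq> {}"
    using martins_axiom_transfer[OF assms(1) conds_nonempty card_conds preorder_ext ccc_conds]
      ordLess_imp_ordLeq[OF assms(2)] by meson
  have "\<exists>K u \<chi>. (K, u, \<chi>) \<in> G \<and> \<alpha> \<in> u" if "\<alpha> < \<kappa>" for \<alpha>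
  proof -
    have "G \<inter> D \<alpha> \<noteq> {}" using G(2) that by blast
    then show ?thesis unfolding D_def by blast
  qed
  moreover have "\<exists>K u \<chi>. (K, u, \<chi>) \<in> G \<and> n \<le> bk_n (B K)" for n
  proof -
    have "G \<inter> E n \<noteq> {}" using G(2) by blast
    then show ?thesis unfolding E_def by blast
  qed
  ultimately show ?thesis using G(1) by blast
qed

text \<open>
  Any two conditions in the filter have a common extension, so the nodes that they assign to \<open>\<alpha>\<close> form
  a chain with a limit \<open>\<rho> \<alpha>\<close>, and those assigned to \<open>(\<alpha>, \<beta>)\<close> have limits \<open>\<Gamma> \<alpha> \<beta> i\<close>, which are
  branches of a fixed tree because the values of \<open>bk_h\<close> do not change.  The sum
  \<open>\<rho> \<alpha> + \<Gamma> \<alpha> \<beta> i\<close> is symmetric in \<open>\<alpha>\<close> and \<open>\<beta>\<close>, hence so is \<open>\<rho> \<alpha> + \<Gamma> \<beta> \<alpha> i\<close>, and these are \<open>2 * \<iota>\<close>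
  common points of the two translates.
\<close>

theorem ex_overlapping_family:
  assumes ma: "martins_axiom" and small: "|{..<\<kappa>}| <o |UNIV :: nat set set|"
    and tree: "\<And>m. tree (T m)"
  shows "\<exists>\<rho> :: ordinal \<Rightarrow> nat \<Rightarrow> bit. inj_on \<rho> {..<\<kappa>} \<and>
    (\<forall>\<alpha><\<kappa>. \<forall>\<beta><\<kappa>. |{..<2 * \<iota>}| \<le>o
       |translate (\<rho> \<alpha>) (\<Union>m. branches (T m)) \<inter> translate (\<rho> \<beta>) (\<Union>m. branches (T m))| )"
proof -
  define Br where "Br = (\<Union>m. branches (T m))"
  obtain G where G: "filter_in conds ext G"
    and point: "\<And>\<alpha>. \<alpha> < \<kappa> \<Longrightarrow> \<exists>K u \<chi>. (K, u, \<chi>) \<in> G \<and> \<alpha> \<in> u"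
    and high: "\<And>n. \<exists>K u \<chi>. (K, u, \<chi>) \<in> G \<and> n \<le> bk_n (B K)"
    using ex_generic_filter[OF ma small] by blast
  have Gc: "p \<in> conds" if "p \<in> G" for p using G that by (auto simp: filter_in_def)
  have dir: "\<exists>K u \<chi>. (K, u, \<chi>) \<in> G \<and> ((K, u, \<chi>), p) \<in> ext \<and> ((K, u, \<chi>), q) \<in> ext"
    if pq: "p \<in> G" "q \<in> G" for p q
  proof -
    have "\<exists>r\<in>G. (r, p) \<in> ext \<and> (r, q) \<in> ext" using G pq unfolding filter_in_def by blast
    then obtain r where "r \<in> G" "(r, p) \<in> ext" "(r, q) \<in> ext" by blast
    then show ?thesis by (cases r) blast
  qed
  have reach: "\<exists>K u \<chi>. (K, u, \<chi>) \<in> G \<and> \<alpha> \<in> u \<and> \<beta> \<in> u \<and> n \<le> bk_n (B K)"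
    if ab: "\<alpha> < \<kappa>" "\<beta> < \<kappa>" for \<alpha> \<beta> n
  proof -
    obtain K0 u0 \<chi>0 where p0: "(K0, u0, \<chi>0) \<in> G" "\<alpha> \<in> u0" using point ab(1) by blast
    obtain K1 u1 \<chi>1 where p1: "(K1, u1, \<chi>1) \<in> G" "\<beta> \<in> u1" using point ab(2) by blast
    obtain K2 u2 \<chi>2 where p2: "(K2, u2, \<chi>2) \<in> G" "n \<le> bk_n (B K2)" using high by blast
    obtain K3 u3 \<chi>3 where p3: "(K3, u3, \<chi>3) \<in> G" "((K3, u3, \<chi>3), (K0, u0, \<chi>0)) \<in> ext"
      "((K3, u3, \<chi>3), (K1, u1, \<chi>1)) \<in> ext" using dir[OF p0(1) p1(1)] by blast
    obtain K u \<chi> where p: "(K, u, \<chi>) \<in> G" "((K, u, \<chi>), (K3, u3, \<chi>3)) \<in> ext"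
      "((K, u, \<chi>), (K2, u2, \<chi>2)) \<in> ext" using dir[OF p3(1) p2(1)] by blast
    have "\<alpha> \<in> u" "\<beta> \<in> u"
      using p0(2) p1(2) extD(3)[OF p3(2)] extD(3)[OF p3(3)] extD(3)[OF p(2)] by blast+
    moreover have "n \<le> bk_n (B K)" using p2(2) extD(4)[OF p(3)] by simp
    ultimately show ?thesis using p(1) by blast
  qed
  have at: "\<chi> \<alpha> \<in> bk_w (B K)" "length (bk_eta (B K) (\<chi> \<alpha>)) = bk_n (B K)"
    if "(K, u, \<chi>) \<in> G" "\<alpha> \<in> u" for K u \<chi> \<alpha>
  proof -
    show "\<chi> \<alpha> \<in> bk_w (B K)" using condsD(5)[OF Gc[OF that(1)]] that(2) by blast
    then show "length (bk_eta (B K) (\<chi> \<alpha>)) = bk_n (B K)" by (rule is_brickD(1)[OF brick])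
  qed
  have ne: "\<chi> \<alpha> \<noteq> \<chi> \<beta>" if "(K, u, \<chi>) \<in> G" "\<alpha> \<in> u" "\<beta> \<in> u" "\<alpha> \<noteq> \<beta>" for K u \<chi> \<alpha> \<beta>
    using inj_onD[OF condsD(7)[OF Gc[OF that(1)]] _ that(2,3)] that(4) by blast
  have limit: "\<exists>x. \<forall>K u \<chi>. (K, u, \<chi>) \<in> G \<and> \<alpha> \<in> u \<and> \<beta> \<in> u \<longrightarrow> x \<in> cyl (N K \<chi>)"
    if ab: "\<alpha> < \<kappa>" "\<beta> < \<kappa>"
      and mono: "\<And>K u \<chi> K' u' \<chi>'. ((K', u', \<chi>'), (K, u, \<chi>)) \<in> ext \<Longrightarrow> \<alpha> \<in> u \<Longrightarrow> \<beta> \<in> u \<Longrightarrow>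
        prefix (N K \<chi>) (N K' \<chi>')"
      and len: "\<And>K u \<chi>. (K, u, \<chi>) \<in> G \<Longrightarrow> \<alpha> \<in> u \<Longrightarrow> \<beta> \<in> u \<Longrightarrow> length (N K \<chi>) = bk_n (B K)"
    for \<alpha> \<beta> and N :: "nat \<Rightarrow> (ordinal \<Rightarrow> nat) \<Rightarrow> bit list"
  proof -
    define L where "L = {N K \<chi> | K u \<chi>. (K, u, \<chi>) \<in> G \<and> \<alpha> \<in> u \<and> \<beta> \<in> u}"
    have "\<exists>x. \<forall>l\<in>L. x \<in> cyl l"
    proof (rule ex_limit)
      fix l l' assume "l \<in> L" "l' \<in> L"
      then obtain K u \<chi> K' u' \<chi>' where l: "l = N K \<chi>" "(K, u, \<chi>) \<in> G" "\<alpha> \<in> u" "\<beta> \<in> u"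
        and l': "l' = N K' \<chi>'" "(K', u', \<chi>') \<in> G" "\<alpha> \<in> u'" "\<beta> \<in> u'"
        unfolding L_def by blast
      obtain K2 u2 \<chi>2 where r: "((K2, u2, \<chi>2), (K, u, \<chi>)) \<in> ext" "((K2, u2, \<chi>2), (K', u', \<chi>')) \<in> ext"
        using dir[OF l(2) l'(2)] by blast
      show "prefix l l' \<or> prefix l' l"
        using mono[OF r(1) l(3,4)] mono[OF r(2) l'(3,4)] unfolding l(1) l'(1)
        by (rule prefix_same_cases)
    next
      fix n
      obtain K u \<chi> where p: "(K, u, \<chi>) \<in> G" "\<alpha> \<in> u" "\<beta> \<in> u" "n \<le> bk_n (B K)" using reach[OF ab] by blast
      then show "\<exists>l\<in>L. n \<le> length l" using len[OF p(1-3)] unfolding L_def by force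
    qed
    then show ?thesis unfolding L_def by blast
  qed
  have "\<exists>x. \<forall>K u \<chi>. (K, u, \<chi>) \<in> G \<and> \<alpha> \<in> u \<and> \<alpha> \<in> u \<longrightarrow> x \<in> cyl (bk_eta (B K) (\<chi> \<alpha>))"
    if "\<alpha> < \<kappa>" for \<alpha>
    by (rule limit[OF that that]) (auto intro: extD(5) at(2))
  then obtain \<rho> where \<rho>: "\<And>\<alpha> K u \<chi>. (K, u, \<chi>) \<in> G \<Longrightarrow> \<alpha> \<in> u \<Longrightarrow> \<alpha> < \<kappa> \<Longrightarrow> \<rho> \<alpha> \<in> cyl (bk_eta (B K) (\<chi> \<alpha>))"
    by metis
  have "\<exists>x. \<forall>K u \<chi>. (K, u, \<chi>) \<in> G \<and> \<alpha> \<in> u \<and> \<beta> \<in> u \<longrightarrow> x \<in> cyl (bk_g (B K) i (\<chi> \<alpha>) (\<chi> \<beta>))"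
    if ab: "\<alpha> < \<kappa>" "\<beta> < \<kappa>" "\<alpha> \<noteq> \<beta>" "i < \<iota>" for \<alpha> \<beta> i
  proof (rule limit[OF ab(1,2)])
    fix K u \<chi> assume p: "(K, u, \<chi>) \<in> G" "\<alpha> \<in> u" "\<beta> \<in> u"
    show "length (bk_g (B K) i (\<chi> \<alpha>) (\<chi> \<beta>)) = bk_n (B K)"
      by (rule is_brickD(3)[OF brick at(1)[OF p(1,2)] at(1)[OF p(1,3)] ne[OF p ab(3)] ab(4)])
  qed (rule extD(7)[OF _ _ _ ab(3,4)])
  then obtain \<Gamma> where \<Gamma>: "\<And>\<alpha> \<beta> i K u \<chi>. \<alpha> < \<kappa> \<Longrightarrow> \<beta> < \<kappa> \<Longrightarrow> \<alpha> \<noteq> \<beta> \<Longrightarrow> i < \<iota> \<Longrightarrow>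
      (K, u, \<chi>) \<in> G \<Longrightarrow> \<alpha> \<in> u \<Longrightarrow> \<beta> \<in> u \<Longrightarrow> \<Gamma> \<alpha> \<beta> i \<in> cyl (bk_g (B K) i (\<chi> \<alpha>) (\<chi> \<beta>))"
    by metis
  have inj: "\<rho> \<alpha> \<noteq> \<rho> \<beta>" if ab: "\<alpha> < \<kappa>" "\<beta> < \<kappa>" "\<alpha> \<noteq> \<beta>" for \<alpha> \<beta>
  proof
    assume eq: "\<rho> \<alpha> = \<rho> \<beta>"
    obtain K u \<chi> where p: "(K, u, \<chi>) \<in> G" "\<alpha> \<in> u" "\<beta> \<in> u" using reach[OF ab(1,2)] by blast
    have "bk_eta (B K) (\<chi> \<alpha>) = init_seg (bk_n (B K)) (\<rho> \<alpha>)"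
      "bk_eta (B K) (\<chi> \<beta>) = init_seg (bk_n (B K)) (\<rho> \<beta>)"
      using init_seg_eq[OF \<rho>[OF p(1,2) ab(1)], of "bk_n (B K)"] at(2)[OF p(1,2)]
        init_seg_eq[OF \<rho>[OF p(1,3) ab(2)], of "bk_n (B K)"] at(2)[OF p(1,3)] by simp_all
    then have "\<chi> \<alpha> = \<chi> \<beta>"
      using eq inj_onD[OF is_brickD(2)[OF brick] _ at(1)[OF p(1,2)] at(1)[OF p(1,3)]] by simp
    then show False using ne[OF p ab(3)] by blast
  qed
  have branch: "\<Gamma> \<alpha> \<beta> i \<in> Br" if ab: "\<alpha> < \<kappa>" "\<beta> < \<kappa>" "\<alpha> \<noteq> \<beta>" "i < \<iota>" for \<alpha> \<beta> i
  proof -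
    obtain K u \<chi> where p: "(K, u, \<chi>) \<in> G" "\<alpha> \<in> u" "\<beta> \<in> u" using reach[OF ab(1,2)] by blast
    define h where "h = bk_h (B K) i (\<chi> \<alpha>) (\<chi> \<beta>)"
    have "init_seg n (\<Gamma> \<alpha> \<beta> i) \<in> T h" for n
    proof -
      obtain K' u' \<chi>' where q: "(K', u', \<chi>') \<in> G" "\<alpha> \<in> u'" "\<beta> \<in> u'" "n \<le> bk_n (B K')"
        using reach[OF ab(1,2)] by blast
      obtain K2 u2 \<chi>2 where r: "((K2, u2, \<chi>2), (K, u, \<chi>)) \<in> ext" "((K2, u2, \<chi>2), (K', u', \<chi>')) \<in> ext"
        using dir[OF p(1) q(1)] by blast
      have "bk_h (B K') i (\<chi>' \<alpha>) (\<chi>' \<beta>) = h"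
        using extD(6)[OF r(1) p(2,3) ab(3,4)] extD(6)[OF r(2) q(2,3) ab(3,4)] by (simp add: h_def)
      then have g: "bk_g (B K') i (\<chi>' \<alpha>) (\<chi>' \<beta>) \<in> T h" "length (bk_g (B K') i (\<chi>' \<alpha>) (\<chi>' \<beta>)) = bk_n (B K')"
        using is_brickD(3,4)[OF brick at(1)[OF q(1,2)] at(1)[OF q(1,3)] ne[OF q(1-3) ab(3)] ab(4)] by auto
      have "init_seg n (\<Gamma> \<alpha> \<beta> i) = take n (bk_g (B K') i (\<chi>' \<alpha>) (\<chi>' \<beta>))"
        using init_seg_eq[OF \<Gamma>[OF ab q(1-3)], of n] g(2) q(4) by simp
      then have "prefix (init_seg n (\<Gamma> \<alpha> \<beta> i)) (bk_g (B K') i (\<chi>' \<alpha>) (\<chi>' \<beta>))"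
        by (simp add: take_is_prefix)
      then show ?thesis by (rule tree_prefix[OF tree g(1)])
    qed
    then show ?thesis by (auto simp: Br_def branches_def)
  qed
  have sum: "\<rho> \<alpha> + \<Gamma> \<alpha> \<beta> i = \<rho> \<beta> + \<Gamma> \<beta> \<alpha> i" if ab: "\<alpha> < \<kappa>" "\<beta> < \<kappa>" "\<alpha> \<noteq> \<beta>" "i < \<iota>" for \<alpha> \<beta> i
  proof
    fix j
    obtain K u \<chi> where p: "(K, u, \<chi>) \<in> G" "\<alpha> \<in> u" "\<beta> \<in> u" "Suc j \<le> bk_n (B K)"
      using reach[OF ab(1,2)] by blast
    let ?x = "\<chi> \<alpha>" and ?y = "\<chi> \<beta>"
    note xy = at(1)[OF p(1,2)] at(1)[OF p(1,3)] ne[OF p(1-3) ab(3)]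
    have len: "length (bk_g (B K) i ?x ?y) = bk_n (B K)" "length (bk_g (B K) i ?y ?x) = bk_n (B K)"
      by (rule is_brickD(3)[OF brick xy ab(4)], rule is_brickD(3)[OF brick xy(2,1) xy(3)[symmetric] ab(4)])
    have "bk_eta (B K) ?x ! j + bk_g (B K) i ?x ?y ! j = bk_eta (B K) ?y ! j + bk_g (B K) i ?y ?x ! j"
      using is_brickD(5)[OF brick xy ab(4)] ladd_eq_iff[OF at(2)[OF p(1,2)] len(1) at(2)[OF p(1,3)] len(2)] p(4)
      by simp
    moreover have "bk_eta (B K) ?x ! j = \<rho> \<alpha> j" "bk_eta (B K) ?y ! j = \<rho> \<beta> j"
      using \<rho>[OF p(1,2) ab(1)] \<rho>[OF p(1,3) ab(2)] at(2)[OF p(1,2)] at(2)[OF p(1,3)] p(4)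
      by (simp_all add: mem_cyl_iff)
    moreover have "bk_g (B K) i ?x ?y ! j = \<Gamma> \<alpha> \<beta> i j" "bk_g (B K) i ?y ?x ! j = \<Gamma> \<beta> \<alpha> i j"
      using \<Gamma>[OF ab p(1-3)] \<Gamma>[OF ab(2,1) ab(3)[symmetric] ab(4) p(1,3,2)] len p(4)
      by (simp_all add: mem_cyl_iff)
    ultimately show "(\<rho> \<alpha> + \<Gamma> \<alpha> \<beta> i) j = (\<rho> \<beta> + \<Gamma> \<beta> \<alpha> i) j" by simp
  qed
  have overlap: "|{..<2 * \<iota>}| \<le>o |translate (\<rho> \<alpha>) Br \<inter> translate (\<rho> \<beta>) Br|"
    if ab: "\<alpha> < \<kappa>" "\<beta> < \<kappa>" "\<alpha> \<noteq> \<beta>" for \<alpha> \<beta>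
  proof -
    define zs where "zs = map (\<Gamma> \<alpha> \<beta>) [0..<\<iota>] @ map (\<Gamma> \<beta> \<alpha>) [0..<\<iota>]"
    obtain K u \<chi> where p: "(K, u, \<chi>) \<in> G" "\<alpha> \<in> u" "\<beta> \<in> u" using reach[OF ab(1,2)] by blast
    let ?n = "bk_n (B K)" and ?x = "\<chi> \<alpha>" and ?y = "\<chi> \<beta>"
    note xy = at(1)[OF p(1,2)] at(1)[OF p(1,3)] ne[OF p(1-3) ab(3)]
    have "init_seg ?n (\<Gamma> \<alpha> \<beta> i) = bk_g (B K) i ?x ?y" "init_seg ?n (\<Gamma> \<beta> \<alpha> i) = bk_g (B K) i ?y ?x"
      if i: "i < \<iota>" for i
      using init_seg_eq[OF \<Gamma>[OF ab i p(1-3)], of ?n] is_brickD(3)[OF brick xy i]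
        init_seg_eq[OF \<Gamma>[OF ab(2,1) ab(3)[symmetric] i p(1,3,2)], of ?n]
        is_brickD(3)[OF brick xy(2,1) xy(3)[symmetric] i] by simp_all
    then have "map (init_seg ?n) zs = map (\<lambda>i. bk_g (B K) i ?x ?y) [0..<\<iota>] @ map (\<lambda>i. bk_g (B K) i ?y ?x) [0..<\<iota>]"
      by (simp add: zs_def)
    then have "distinct zs" using is_brickD(6)[OF brick xy] distinct_map by metis
    then have "distinct (map ((+) (\<rho> \<alpha>)) zs)"
      unfolding distinct_map by (auto intro!: inj_onI)
    moreover have "set (map ((+) (\<rho> \<alpha>)) zs) \<subseteq> translate (\<rho> \<alpha>) Br \<inter> translate (\<rho> \<beta>) Br"
    proof
      fix z assume "z \<in> set (map ((+) (\<rho> \<alpha>)) zs)"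
      then consider i where "i < \<iota>" "z = \<rho> \<alpha> + \<Gamma> \<alpha> \<beta> i" | i where "i < \<iota>" "z = \<rho> \<alpha> + \<Gamma> \<beta> \<alpha> i"
        by (auto simp: zs_def)
      then show "z \<in> translate (\<rho> \<alpha>) Br \<inter> translate (\<rho> \<beta>) Br"
      proof cases
        case 1
        then show ?thesis
          using branch[OF ab 1(1)] branch[OF ab(2,1) ab(3)[symmetric] 1(1)] sum[OF ab 1(1)]
          unfolding translate_def by blast
      next
        case 2
        have "\<rho> \<alpha> + \<Gamma> \<beta> \<alpha> i = \<rho> \<beta> + \<Gamma> \<alpha> \<beta> i"
          using sum[OF ab 2(1)] by (metis add.left_commute cantor_add_cancel)
        then show ?thesis
          using branch[OF ab 2(1)] branch[OF ab(2,1) ab(3)[symmetric] 2(1)] 2(2)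
          unfolding translate_def by blast
      qed
    qed
    ultimately have "|{..<length (map ((+) (\<rho> \<alpha>)) zs)}| \<le>o |translate (\<rho> \<alpha>) Br \<inter> translate (\<rho> \<beta>) Br|"
      by (rule card_of_distinct_list)
    moreover have "length (map ((+) (\<rho> \<alpha>)) zs) = 2 * \<iota>" by (simp add: zs_def)
    ultimately show ?thesis by (simp only:)
  qed
  have "|{..<2 * \<iota>}| \<le>o |translate (\<rho> \<alpha>) Br \<inter> translate (\<rho> \<beta>) Br|" if ab: "\<alpha> < \<kappa>" "\<beta> < \<kappa>" for \<alpha> \<beta>
  proof (cases "\<alpha> = \<beta>")
    case True
    \<comment> \<open>a single translate contains its intersection with any other one\<close>
    have "infinite ({..<\<kappa>} - {\<alpha>})" using infinite by simp
    then have "{..<\<kappa>} - {\<alpha>} \<noteq> {}" by (metis finite.emptyI)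
    then obtain \<gamma> where "\<gamma> < \<kappa>" "\<alpha> \<noteq> \<gamma>" by blast
    from overlap[OF ab(1) this]
    have "|{..<2 * \<iota>}| \<le>o |translate (\<rho> \<alpha>) Br|"
      using card_of_mono1[of "translate (\<rho> \<alpha>) Br \<inter> translate (\<rho> \<gamma>) Br" "translate (\<rho> \<alpha>) Br"]
        ordLeq_transitive by blast
    then show ?thesis using True by simp
  qed (rule overlap[OF ab])
  moreover have "inj_on \<rho> {..<\<kappa>}" using inj by (auto intro!: inj_onI)
  ultimately show ?thesis unfolding Br_def by blast
qed

end

theorem corollary5p2:
  fixes \<epsilon> \<kappa> :: ordinal
    and \<iota> :: nat
    and S :: "nat yzr"
    and T :: "nat \<Rightarrow> bit list set"
    and c :: "nat \<Rightarrow> nat"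
    and B :: "(nat \<Rightarrow> bit) set"
  assumes "ord_zero < \<epsilon>" and "\<epsilon> < omega1" and "2 \<le> \<iota>"
    and "cute \<epsilon> S"
    and "\<And>m. tree (T m)" and "\<And>m. no_maximal_nodes (T m)"
    and "controlled_amalgamation S \<iota> T c"
    and "Ord \<epsilon> \<le> ndrk_sup \<iota> T"
    and "ndrk_sup \<iota> T \<le> Ord (ord_suc (ord_suc (ord_mult omega (ord_suc (ord_suc \<epsilon>)))))"
    and "B = (\<Union>m. branches (T m))"
    and "martins_axiom"
    and "is_aleph \<epsilon> \<kappa>" and "|{..<\<kappa>}| <o |UNIV :: nat set set|"
  shows "(\<exists>\<rho> :: ordinal \<Rightarrow> nat \<Rightarrow> bit. inj_on \<rho> {..<\<kappa>} \<and>
            (\<forall>\<alpha><\<kappa>. \<forall>\<beta><\<kappa>.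
               |{..<2 * \<iota>}| \<le>o |translate (\<rho> \<alpha>) B \<inter> translate (\<rho> \<beta>) B| )) \<and>
         (\<forall>P. perfect_set P \<longrightarrow>
            (\<exists>\<eta>\<in>P. \<exists>\<nu>\<in>P.
               |translate \<eta> B \<inter> translate \<nu> B| <o |{..<2 * \<iota>}| ))"
proof
  have B: "B = (\<Union>m. branches (T m))" by fact
  obtain s where s: "yzr_system \<epsilon> s" "ypts s = {..<\<kappa>}"
    using ex_yzr_system[OF \<open>ord_zero < \<epsilon>\<close> \<open>is_aleph \<epsilon> \<kappa>\<close> ordLess_imp_ordLeq[OF \<open>|{..<\<kappa>}| <o _\<close>]]
    by blast
  have inf: "infinite {..<\<kappa>}"
    using \<open>is_aleph \<epsilon> \<kappa>\<close> by (simp add: is_aleph_def infinite_cardinal_def)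
  from \<open>controlled_amalgamation S \<iota> T c\<close> have "\<exists>Bs. amalgamating_bricks \<epsilon> \<kappa> \<iota> S T c Bs s"
    unfolding controlled_amalgamation_def
  proof (elim exE conjE, goal_cases)
    case (1 Bs)
    show ?case
    proof (intro exI[of _ Bs] amalgamating_bricks.intro)
      show "is_brick S \<iota> T c (Bs n)" "brick_le \<iota> (Bs n) (Bs (Suc n))" for n
        using 1(1,2) by simp_all
    qed (fact s inf 1 \<open>cute \<epsilon> S\<close>)+
  qed
  then obtain Bs where Bs: "amalgamating_bricks \<epsilon> \<kappa> \<iota> S T c Bs s" ..
  show "\<exists>\<rho> :: ordinal \<Rightarrow> nat \<Rightarrow> bit. inj_on \<rho> {..<\<kappa>} \<and>
      (\<forall>\<alpha><\<kappa>. \<forall>\<beta><\<kappa>.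
         |{..<2 * \<iota>}| \<le>o |translate (\<rho> \<alpha>) B \<inter> translate (\<rho> \<beta>) B| )"
    unfolding B
    by (rule amalgamating_bricks.ex_overlapping_family[OF Bs]) fact+
  have "ndrk_sup \<iota> T \<noteq> Infty"
    using \<open>ndrk_sup \<iota> T \<le> Ord _\<close> by (auto simp: less_eq_xordinal_def)
  then show "\<forall>P. perfect_set P \<longrightarrow>
      (\<exists>\<eta>\<in>P. \<exists>\<nu>\<in>P. |translate \<eta> B \<inter> translate \<nu> B| <o |{..<2 * \<iota>}| )"
    using bounded_rank_no_perfect_overlap B by blast
qed

end
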